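(* There exist constants $C>0$ and $\beta>0$, depending only on $\widetilde\mu$, such that $|L(E)-L(E')|\le C|E-E'|^\beta$ for all $E,E'\in\hat\Sigma$.
   Context: Let $\widetilde\mu$ be a Borel probability measure on $\mathbb R$ with compact support $\mathcal A$ containing at least two points; $\Omega=\mathcal A^{\mathbb Z}$, $\mu=\widetilde\mu^{\mathbb Z}$. For $E\in\mathbb R$, $M^E(\alpha)=\begin{pmatrix}E-\alpha&-1\\1&0\end{pmatrix}$, $M_n^E(\omega)=M^E(\omega_{n-1})\cdots M^E(\omega_0)$ for $n\ge1$, and $L(E)=\lim_{n\to\infty}\frac1n\int_\Omega\log\|M_n^E\|\,d\mu$. $\hat\Sigma=[-\kappa,\kappa]$ with $\kappa=2+\max_{\alpha\in\mathcal A}|\alpha|$. *)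

theory Defs
  imports "HOL-Analysis.Analysis" "HOL-Probability.Probability"
begin

definition msupp :: "real measure \<Rightarrow> real set" where
  "msupp m = {x. \<forall>e>0. measure m (ball x e) > 0}"

definition transfer :: "real \<Rightarrow> real \<Rightarrow> real^2^2" where
  "transfer E a = (\<chi> i j. if i = 1 then (if j = 1 then E - a else -1)
                            else (if j = 1 then 1 else 0))"

primrec transfer_n :: "real \<Rightarrow> (int \<Rightarrow> real) \<Rightarrow> nat \<Rightarrow> real^2^2" where
  "transfer_n E \<omega> 0 = mat 1"
| "transfer_n E \<omega> (Suc n) = transfer E (\<omega> (int n)) ** transfer_n E \<omega> n"

definition opnorm :: "real^2^2 \<Rightarrow> real" where
  "opnorm A = onorm (\<lambda>x. A *v x)"

definition lyap :: "real measure \<Rightarrow> real \<Rightarrow> real" where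
  "lyap m E = lim (\<lambda>n. (1 / real n) *
      integral\<^sup>L (Pi\<^sub>M (UNIV :: int set) (\<lambda>_. m)) (\<lambda>\<omega>. ln (opnorm (transfer_n E \<omega> n))))"

end

theory Submission
  imports Defs
begin

text \<open>
  The transfer matrices act linearly on the plane, and averaging \<open>g (M v)\<close> over one random matrix \<open>M\<close> defines
  a contraction \<open>P\<close> of the square integrable functions. If \<open>P (P g)\<close> had almost the norm of \<open>g\<close>, then \<open>g\<close> and
  \<open>P g\<close> would both be almost invariant under a shear, the quotient of two transfer matrices, hence both
  concentrated near its axis; but \<open>P g\<close> is close to \<open>g \<circ> M\<close>, and \<open>M\<close> moves that axis away from itself.
  The resulting spectral gap is uniform in the energy and makes the mean of \<open>ln \<parallel>M\<^sub>n\<parallel>\<close> unbounded in \<open>n\<close>.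

  Consequently there is one \<open>n\<close> for which the mean of \<open>ln \<bar>M\<^sub>n v\<bar>\<close> is at least \<open>1\<close> for all unit vectors \<open>v\<close>: if \<open>v\<close>
  nearly minimises this mean, then with positive probability so do its images under one and two steps, three of
  these vectors are pairwise separated, and a matrix can contract at most one of three separated vectors.

  Such a drift makes the projective action contract the mean of \<open>d\<^sup>s\<close>, where \<open>d\<close> is the projective distance
  and \<open>s\<close> is small. Run two energies on the same potential: the orbits stay at distance \<open>O(\<bar>E - E'\<bar>\<^sup>s)\<close>
  in this sense, and the increments of the logarithmic growth are Lipschitz in \<open>d\<close>.
\<close>

section \<open>Shears, transfer maps and square masses on the plane\<close>

text \<open>The letters may take only two values, so the measure itself smooths nothing; what is
  averaged is a function on the plane, where every matrix of determinant 1 preserves Lebesgue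
  measure. A single step of \<open>P\<close> cannot suffice: almost invariance of \<open>g\<close>
  only places it near one axis, which is no contradiction. The gap becomes growth when
  \<open>P\<close> acts on the indicator of the unit disc: if the norm stayed below a fixed
  \<open>K\<close> with probability above \<open>1/2\<close>, the disc of radius \<open>1/K\<close>
  would return to the unit disc that often, although the square mass of the return probability
  decays. Growth of the norm is not growth of every vector, since a large matrix of determinant 1
  contracts some direction; this is what the three vectors are for. Once all vectors grow in mean,
  directions contract, because the area spanned by two vectors is constant. The same contraction, at
  equal energies and different starting vectors, shows that the mean growth forgets its starting
  vector up to a constant. So it is additive in \<open>n\<close> up to a constant, and this gives
  the convergence to \<open>L(E)\<close>.\<close>

definition shift_map :: "real \<Rightarrow> real \<times> real \<Rightarrow> real \<times> real" where
  "shift_map t p = (t * fst p - snd p, fst p)"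

definition shift_inv :: "real \<Rightarrow> real \<times> real \<Rightarrow> real \<times> real" where
  "shift_inv t p = (snd p, t * snd p - fst p)"

definition shear :: "real \<Rightarrow> real \<times> real \<Rightarrow> real \<times> real" where
  "shear c p = (fst p + c * snd p, snd p)"

text \<open>The area form, preserved since shift maps have determinant 1; below it measures angles
  and bounds inverses.\<close>

definition wedge :: "real \<times> real \<Rightarrow> real \<times> real \<Rightarrow> real" where
  "wedge p q = fst p * snd q - snd p * fst q"

text \<open>Letters are clipped to \<open>[-R, R]\<close> so that all bounds hold for every sequence
  and not merely almost surely. On the support of the measure the clipping changes nothing, and
  \<open>lyap_eq\<close> removes it.\<close>

definition clip :: "real \<Rightarrow> real \<Rightarrow> real" where
  "clip R a = max (- R) (min R a)"

lemma shift_inv_shift_map [simp]: "shift_inv t (shift_map t p) = p"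
  by (simp add: shift_inv_def shift_map_def)

lemma shift_map_eq_0_iff [simp]: "shift_map t p = 0 \<longleftrightarrow> p = 0"
  by (auto simp: shift_map_def zero_prod_def prod_eq_iff)

lemma shift_map_add: "shift_map t (p + q) = shift_map t p + shift_map t q"
  by (simp add: shift_map_def algebra_simps)

lemma shift_map_scaleR: "shift_map t (c *\<^sub>R p) = c *\<^sub>R shift_map t p"
  by (simp add: shift_map_def algebra_simps)

lemma shift_map_shear: "shift_map s p = shear (s - t) (shift_map t p)"
  by (simp add: shift_map_def shear_def algebra_simps)

lemma shear_shear: "shear c (shear d p) = shear (c + d) p"
  by (simp add: shear_def algebra_simps)

lemma shear_0 [simp]: "shear 0 p = p"
  by (simp add: shear_def)

lemma wedge_shift_map [simp]: "wedge (shift_map t p) (shift_map t q) = wedge p q"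
  by (simp add: wedge_def shift_map_def algebra_simps)

lemma norm_fst_snd: "norm (p :: real \<times> real) = sqrt ((fst p)\<^sup>2 + (snd p)\<^sup>2)"
  by (cases p) (simp add: norm_Pair)

lemma norm_le_abs_sum: "norm (p :: real \<times> real) \<le> \<bar>fst p\<bar> + \<bar>snd p\<bar>"
  unfolding norm_fst_snd by (rule sqrt_sum_squares_le_sum_abs)

lemma abs_fst_le_norm: "\<bar>fst (p :: real \<times> real)\<bar> \<le> norm p"
  by (cases p) (simp add: norm_Pair real_le_rsqrt)

lemma abs_snd_le_norm: "\<bar>snd (p :: real \<times> real)\<bar> \<le> norm p"
  by (cases p) (simp add: norm_Pair real_le_rsqrt)

lemma norm_shift_map_le:
  assumes "\<bar>t\<bar> \<le> b"
  shows "norm (shift_map t p) \<le> (b + 2) * norm p"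
proof -
  have "norm (shift_map t p) \<le> \<bar>t * fst p - snd p\<bar> + \<bar>fst p\<bar>"
    using norm_le_abs_sum[of "shift_map t p"] by (simp add: shift_map_def)
  also have "\<dots> \<le> \<bar>t\<bar> * \<bar>fst p\<bar> + \<bar>snd p\<bar> + \<bar>fst p\<bar>"
    by (simp add: abs_mult[symmetric])
  also have "\<dots> \<le> b * norm p + norm p + norm p"
    using assms by (intro add_mono mult_mono abs_fst_le_norm abs_snd_le_norm) auto
  finally show ?thesis by (simp add: algebra_simps)
qed

lemma norm_shift_map_ge:
  assumes "\<bar>t\<bar> \<le> b"
  shows "norm p \<le> (b + 2) * norm (shift_map t p)"
proof -
  define w where "w = shift_map t p"
  have p: "p = shift_inv t w" by (simp add: w_def)
  have "norm p \<le> \<bar>snd w\<bar> + \<bar>t * snd w - fst w\<bar>"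
    using norm_le_abs_sum[of p] by (simp add: p shift_inv_def)
  also have "\<dots> \<le> \<bar>snd w\<bar> + (\<bar>t\<bar> * \<bar>snd w\<bar> + \<bar>fst w\<bar>)"
    by (simp add: abs_mult[symmetric])
  also have "\<dots> \<le> norm w + (b * norm w + norm w)"
    using assms by (intro add_mono mult_mono abs_fst_le_norm abs_snd_le_norm) auto
  finally show ?thesis by (simp add: w_def algebra_simps)
qed

lemma borel_measurable_fst_comp [measurable (raw)]:
  fixes f :: "'a \<Rightarrow> real \<times> real"
  shows "f \<in> borel_measurable M \<Longrightarrow> (\<lambda>x. fst (f x)) \<in> borel_measurable M"
  by (rule borel_measurable_continuous_on[of fst]) (auto intro: continuous_intros)

lemma borel_measurable_snd_comp [measurable (raw)]:
  fixes f :: "'a \<Rightarrow> real \<times> real"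
  shows "f \<in> borel_measurable M \<Longrightarrow> (\<lambda>x. snd (f x)) \<in> borel_measurable M"
  by (rule borel_measurable_continuous_on[of snd]) (auto intro: continuous_intros)

lemma borel_measurable_shift_map [measurable (raw)]:
  assumes [measurable]: "f \<in> borel_measurable M" "g \<in> borel_measurable M"
  shows "(\<lambda>x. shift_map (f x) (g x)) \<in> borel_measurable M"
  unfolding shift_map_def by measurable

lemma borel_measurable_shift_inv [measurable (raw)]:
  assumes [measurable]: "f \<in> borel_measurable M" "g \<in> borel_measurable M"
  shows "(\<lambda>x. shift_inv (f x) (g x)) \<in> borel_measurable M"
  unfolding shift_inv_def by measurable

lemma borel_measurable_shear [measurable (raw)]:
  assumes [measurable]: "f \<in> borel_measurable M" "g \<in> borel_measurable M"
  shows "(\<lambda>x. shear (f x) (g x)) \<in> borel_measurable M"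
  unfolding shear_def by measurable

lemma borel_measurable_wedge [measurable (raw)]:
  assumes [measurable]: "f \<in> borel_measurable M" "g \<in> borel_measurable M"
  shows "(\<lambda>x. wedge (f x) (g x)) \<in> borel_measurable M"
  unfolding wedge_def by measurable

lemma borel_measurable_clip [measurable (raw)]:
  assumes [measurable]: "f \<in> borel_measurable M"
  shows "(\<lambda>x. clip R (f x)) \<in> borel_measurable M"
  unfolding clip_def by measurable

section \<open>Invariance of Lebesgue measure on the plane\<close>

lemma nn_integral_lborel_Pair:
  fixes f :: "real \<times> real \<Rightarrow> ennreal"
  assumes [measurable]: "f \<in> borel_measurable borel"
  shows "(\<integral>\<^sup>+p. f p \<partial>lborel) = (\<integral>\<^sup>+u. \<integral>\<^sup>+v. f (u, v) \<partial>lborel \<partial>lborel)"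
    and "(\<integral>\<^sup>+p. f p \<partial>lborel) = (\<integral>\<^sup>+v. \<integral>\<^sup>+u. f (u, v) \<partial>lborel \<partial>lborel)"
proof -
  have [measurable]: "f \<in> borel_measurable (lborel \<Otimes>\<^sub>M lborel)"
    by (simp add: lborel_prod)
  show "(\<integral>\<^sup>+p. f p \<partial>lborel) = (\<integral>\<^sup>+u. \<integral>\<^sup>+v. f (u, v) \<partial>lborel \<partial>lborel)"
    by (subst lborel.nn_integral_fst) (simp_all add: lborel_prod)
  show "(\<integral>\<^sup>+p. f p \<partial>lborel) = (\<integral>\<^sup>+v. \<integral>\<^sup>+u. f (u, v) \<partial>lborel \<partial>lborel)"
    by (subst lborel_pair.nn_integral_snd) (simp_all add: lborel_prod case_prod_unfold)
qed

text \<open>Each horizontal line is translated, so Fubini with the inner integral over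
  \<open>u\<close> reduces this to translation invariance on the line.\<close>

lemma nn_integral_shear:
  fixes f :: "real \<times> real \<Rightarrow> ennreal"
  assumes [measurable]: "f \<in> borel_measurable borel"
  shows "(\<integral>\<^sup>+p. f (shear c p) \<partial>lborel) = (\<integral>\<^sup>+p. f p \<partial>lborel)"
proof -
  have "(\<integral>\<^sup>+p. f (shear c p) \<partial>lborel) = (\<integral>\<^sup>+v. \<integral>\<^sup>+u. f (u + c * v, v) \<partial>lborel \<partial>lborel)"
    by (subst nn_integral_lborel_Pair(2)) (simp_all add: shear_def)
  also have "\<dots> = (\<integral>\<^sup>+v. \<integral>\<^sup>+u. f (u, v) \<partial>lborel \<partial>lborel)"
  proof (rule nn_integral_cong)
    fix v :: real
    show "(\<integral>\<^sup>+u. f (u + c * v, v) \<partial>lborel) = (\<integral>\<^sup>+u. f (u, v) \<partial>lborel)"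
      by (subst nn_integral_real_affine[of "\<lambda>u. f (u, v)" 1 "c * v"]) (simp_all add: add.commute)
  qed
  finally show ?thesis by (subst nn_integral_lborel_Pair(2)) simp_all
qed

text \<open>Now the inner integral runs over \<open>v\<close>, on which the map is a reflection
  followed by a translation; the other coordinate is only renamed.\<close>

lemma nn_integral_shift_map:
  fixes f :: "real \<times> real \<Rightarrow> ennreal"
  assumes [measurable]: "f \<in> borel_measurable borel"
  shows "(\<integral>\<^sup>+p. f (shift_map t p) \<partial>lborel) = (\<integral>\<^sup>+p. f p \<partial>lborel)"
proof -
  have "(\<integral>\<^sup>+p. f (shift_map t p) \<partial>lborel) = (\<integral>\<^sup>+u. \<integral>\<^sup>+v. f (t * u - v, u) \<partial>lborel \<partial>lborel)"
    by (subst nn_integral_lborel_Pair(1)) (simp_all add: shift_map_def)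
  also have "\<dots> = (\<integral>\<^sup>+u. \<integral>\<^sup>+v. f (v, u) \<partial>lborel \<partial>lborel)"
  proof (rule nn_integral_cong)
    fix u :: real
    show "(\<integral>\<^sup>+v. f (t * u - v, u) \<partial>lborel) = (\<integral>\<^sup>+v. f (v, u) \<partial>lborel)"
      by (subst nn_integral_real_affine[of "\<lambda>v. f (v, u)" "-1" "t * u"]) (simp_all)
  qed
  finally show ?thesis by (subst nn_integral_lborel_Pair(2)) simp_all
qed

section \<open>Squared mass and almost shear-invariant functions\<close>

definition sq_mass :: "(real \<times> real \<Rightarrow> real) \<Rightarrow> ennreal" where
  "sq_mass g = (\<integral>\<^sup>+p. ennreal ((g p)\<^sup>2) \<partial>lborel)"

lemma sq_mass_shear:
  "g \<in> borel_measurable borel \<Longrightarrow> sq_mass (\<lambda>p. g (shear c p)) = sq_mass g"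
  unfolding sq_mass_def by (rule nn_integral_shear) simp

lemma sq_mass_shift_map:
  "g \<in> borel_measurable borel \<Longrightarrow> sq_mass (\<lambda>p. g (shift_map t p)) = sq_mass g"
  unfolding sq_mass_def by (rule nn_integral_shift_map) simp

lemma sum_sq_le: "(x + y)\<^sup>2 \<le> 2 * x\<^sup>2 + 2 * (y::real)\<^sup>2"
  using zero_le_power2[of "x - y"] by (simp add: power2_eq_square algebra_simps)

lemma ennreal_sum_sq_le: "ennreal ((x + y)\<^sup>2) \<le> 2 * ennreal (x\<^sup>2) + 2 * ennreal (y\<^sup>2)"
proof -
  have "ennreal ((x + y)\<^sup>2) \<le> ennreal (2 * x\<^sup>2 + 2 * y\<^sup>2)"
    by (rule ennreal_leI[OF sum_sq_le])
  thus ?thesis by (simp add: ennreal_plus ennreal_mult')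
qed

lemma sq_mass_add_le:
  assumes [measurable]: "f \<in> borel_measurable borel" "g \<in> borel_measurable borel"
  shows "sq_mass (\<lambda>p. f p + g p) \<le> 2 * sq_mass f + 2 * sq_mass g"
proof -
  have "sq_mass (\<lambda>p. f p + g p) \<le> (\<integral>\<^sup>+p. 2 * ennreal ((f p)\<^sup>2) + 2 * ennreal ((g p)\<^sup>2) \<partial>lborel)"
    unfolding sq_mass_def by (intro nn_integral_mono ennreal_sum_sq_le)
  also have "\<dots> = 2 * sq_mass f + 2 * sq_mass g"
    unfolding sq_mass_def by (simp add: nn_integral_add nn_integral_cmult)
  finally show ?thesis .
qed

text \<open>Each further shear costs the crude factor of \<open>sq_mass_add_le\<close>. The bound is
  exponential in \<open>k\<close>, which is harmless because only a fixed number of powers enters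
  the spectral gap.\<close>

lemma sq_mass_shear_power:
  assumes [measurable]: "g \<in> borel_measurable borel"
    and eps: "sq_mass (\<lambda>p. g (shear c p) - g p) \<le> ennreal e"
    and e: "0 \<le> e"
  shows "sq_mass (\<lambda>p. g (shear (real k * c) p) - g p) \<le> ennreal (4 ^ k * e)"
proof (induction k)
  case 0
  thus ?case using e by (simp add: sq_mass_def)
next
  case (Suc k)
  have "sq_mass (\<lambda>p. g (shear (real (Suc k) * c) p) - g p) =
      sq_mass (\<lambda>p. (g (shear c (shear (real k * c) p)) - g (shear (real k * c) p)) + (g (shear (real k * c) p) - g p))"
    by (simp add: shear_shear algebra_simps)
  also have "\<dots> \<le> 2 * sq_mass (\<lambda>p. g (shear c (shear (real k * c) p)) - g (shear (real k * c) p))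
      + 2 * sq_mass (\<lambda>p. g (shear (real k * c) p) - g p)"
    by (rule sq_mass_add_le) measurable
  also have "sq_mass (\<lambda>p. g (shear c (shear (real k * c) p)) - g (shear (real k * c) p)) =
      sq_mass (\<lambda>p. g (shear c p) - g p)"
    by (rule sq_mass_shear[of "\<lambda>p. g (shear c p) - g p"]) measurable
  also have "2 * sq_mass (\<lambda>p. g (shear c p) - g p) + 2 * sq_mass (\<lambda>p. g (shear (real k * c) p) - g p)
      \<le> 2 * ennreal e + 2 * ennreal (4 ^ k * e)"
    by (intro add_mono mult_left_mono eps Suc.IH) auto
  also have "\<dots> = ennreal (2 * e + 2 * (4 ^ k * e))"
    using e by (simp add: ennreal_plus ennreal_mult')
  also have "\<dots> \<le> ennreal (4 ^ Suc k * e)"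
  proof (rule ennreal_leI)
    have "1 * e \<le> 4 ^ k * e" using e by (intro mult_right_mono) auto
    thus "2 * e + 2 * (4 ^ k * e) \<le> 4 ^ Suc k * e" by (simp add: mult.commute)
  qed
  finally show ?case .
qed

text \<open>The complement of a sector around \<open>snd p = 0\<close>, the axis that all shears
  fix.\<close>

definition cone :: "real \<Rightarrow> (real \<times> real) set" where
  "cone L = {p. \<bar>fst p\<bar> < L * \<bar>snd p\<bar>}"

lemma cone_sets [measurable]: "cone L \<in> sets borel"
proof -
  have "{p \<in> space borel. \<bar>fst p\<bar> < L * \<bar>snd (p :: real \<times> real)\<bar>} \<in> sets borel" by measurable
  thus ?thesis by (simp add: cone_def)
qed

text \<open>The first coordinates of the two sheared points differ by
  \<open>(s - t) * snd p\<close>, too much for two points of the cone with the same second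
  coordinate.\<close>

lemma cone_shear_disjoint:
  assumes "shear s p \<in> cone L" "shear t p \<in> cone L" "2 * L \<le> \<bar>s - t\<bar>"
  shows False
proof -
  have v: "snd p \<noteq> 0"
    using assms(1) by (auto simp: cone_def shear_def)
  have "\<bar>s - t\<bar> * \<bar>snd p\<bar> = \<bar>(fst p + s * snd p) - (fst p + t * snd p)\<bar>"
    by (simp add: abs_mult[symmetric] algebra_simps)
  also have "\<dots> \<le> \<bar>fst p + s * snd p\<bar> + \<bar>fst p + t * snd p\<bar>" by simp
  also have "\<dots> < L * \<bar>snd p\<bar> + L * \<bar>snd p\<bar>"
    using assms by (auto simp: cone_def shear_def)
  finally have "\<bar>s - t\<bar> * \<bar>snd p\<bar> < 2 * L * \<bar>snd p\<bar>" by simp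
  thus False using v assms(3) by (simp add: mult_less_cancel_right)
qed

text \<open>The shears of the cone by multiples of \<open>j * c\<close> are disjoint, so an almost invariant
  function cannot put much mass on any one of them.\<close>
lemma cone_mass_le:
  assumes [measurable]: "g \<in> borel_measurable borel"
    and G: "sq_mass g = ennreal G" "0 \<le> G"
    and eps: "sq_mass (\<lambda>p. g (shear c p) - g p) \<le> ennreal (e * G)" "0 \<le> e"
    and jc: "2 * L \<le> real j * c" and n: "n > 0" and L: "L \<ge> 0"
  shows "(\<integral>\<^sup>+p. indicator (cone L) p * ennreal ((g p)\<^sup>2) \<partial>lborel)
    \<le> ennreal ((2 / real n + 2 * 4 ^ (j * n) * e) * G)"
proof -
  let ?I = "\<integral>\<^sup>+p. indicator (cone L) p * ennreal ((g p)\<^sup>2) \<partial>lborel"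
  let ?s = "\<lambda>i. real (j * i) * c"
  let ?ind = "\<lambda>i p. indicator (cone L) (shear (?s i) p) :: ennreal"
  \<comment> \<open>The integral over the cone is carried to its \<open>i\<close>-th sheared copy;
    there \<open>g\<close> of the sheared point is traded for \<open>g\<close>, at the cost of the
    error of the largest power.\<close>
  have step: "?I \<le> 2 * (\<integral>\<^sup>+p. ?ind i p * ennreal ((g p)\<^sup>2) \<partial>lborel) + ennreal (2 * 4 ^ (j * n) * e * G)"
    if i: "i < n" for i
  proof -
    have "?I = (\<integral>\<^sup>+p. ?ind i p * ennreal ((g (shear (?s i) p))\<^sup>2) \<partial>lborel)"
      by (subst nn_integral_shear[where f = "\<lambda>p. indicator (cone L) p * ennreal ((g p)\<^sup>2)"]) measurable
    also have "\<dots> \<le> (\<integral>\<^sup>+p. 2 * (?ind i p * ennreal ((g p)\<^sup>2)) + 2 * ennreal ((g (shear (?s i) p) - g p)\<^sup>2) \<partial>lborel)"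
    proof (rule nn_integral_mono)
      fix p
      have "ennreal ((g (shear (?s i) p))\<^sup>2) \<le> 2 * ennreal ((g p)\<^sup>2) + 2 * ennreal ((g (shear (?s i) p) - g p)\<^sup>2)"
        using ennreal_sum_sq_le[of "g p" "g (shear (?s i) p) - g p"] by simp
      thus "?ind i p * ennreal ((g (shear (?s i) p))\<^sup>2) \<le>
          2 * (?ind i p * ennreal ((g p)\<^sup>2)) + 2 * ennreal ((g (shear (?s i) p) - g p)\<^sup>2)"
        by (auto simp: indicator_def)
    qed
    also have "\<dots> = 2 * (\<integral>\<^sup>+p. ?ind i p * ennreal ((g p)\<^sup>2) \<partial>lborel)
        + 2 * sq_mass (\<lambda>p. g (shear (?s i) p) - g p)"
      unfolding sq_mass_def by (simp add: nn_integral_add nn_integral_cmult)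
    also have "\<dots> \<le> 2 * (\<integral>\<^sup>+p. ?ind i p * ennreal ((g p)\<^sup>2) \<partial>lborel) + 2 * ennreal (4 ^ (j * i) * (e * G))"
      using eps G by (intro add_mono mult_left_mono sq_mass_shear_power) auto
    also have "2 * ennreal (4 ^ (j * i) * (e * G)) = ennreal (2 * (4 ^ (j * i) * (e * G)))"
      using eps G by (simp add: ennreal_mult')
    also have "\<dots> \<le> ennreal (2 * 4 ^ (j * n) * e * G)"
    proof (rule ennreal_leI)
      have "(4::real) ^ (j * i) \<le> 4 ^ (j * n)" using i by (intro power_increasing) auto
      hence "4 ^ (j * i) * (e * G) \<le> 4 ^ (j * n) * (e * G)" using eps G by (intro mult_right_mono) auto
      thus "2 * (4 ^ (j * i) * (e * G)) \<le> 2 * 4 ^ (j * n) * e * G" by simp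
    qed
    finally show ?thesis by (simp add: add_left_mono)
  qed
  \<comment> \<open>Distinct indices give shear parameters at least \<open>j * c \<ge> 2 * L\<close>
    apart, so at most one of these shears takes \<open>p\<close> into the cone.\<close>
  have le1: "(\<Sum>i<n. ?ind i p) \<le> 1" for p
  proof (cases "\<exists>i<n. shear (?s i) p \<in> cone L")
    case True
    then obtain i where i: "i < n" "shear (?s i) p \<in> cone L" by blast
    have "?ind k p = 0" if "k \<in> {..<n} - {i}" for k
    proof (rule ccontr)
      assume "?ind k p \<noteq> 0"
      hence k: "shear (?s k) p \<in> cone L" by (auto simp: indicator_def split: if_splits)
      have "1 \<le> \<bar>real i - real k\<bar>" using that by (cases "i < k") auto
      hence "1 * (real j * c) \<le> \<bar>real i - real k\<bar> * (real j * c)"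
        using jc L by (intro mult_right_mono) auto
      also have "\<dots> = \<bar>?s i - ?s k\<bar>"
      proof -
        have "\<bar>real i - real k\<bar> * (real j * c) = \<bar>(real i - real k) * (real j * c)\<bar>"
          using jc L abs_of_nonneg[of "real j * c"] by (simp add: abs_mult[of _ "real j * c"])
        thus ?thesis by (simp add: algebra_simps)
      qed
      finally show False using cone_shear_disjoint[OF i(2) k] jc by simp
    qed
    hence "(\<Sum>k<n. ?ind k p) = ?ind i p"
      using i(1) by (subst sum.remove[of _ i]) auto
    thus ?thesis by (simp add: indicator_def)
  next
    case False
    hence "(\<Sum>i<n. ?ind i p) = 0" by (intro sum.neutral) (auto simp: indicator_def)
    thus ?thesis by simp
  qed
  \<comment> \<open>The \<open>n\<close> bounds are averaged: the disjoint copies together hold at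
    most the whole mass once, whence \<open>2 / real n\<close>.\<close>
  have "of_nat n * ?I = (\<Sum>i<n. ?I)" by simp
  also have "\<dots> \<le> (\<Sum>i<n. 2 * (\<integral>\<^sup>+p. ?ind i p * ennreal ((g p)\<^sup>2) \<partial>lborel) + ennreal (2 * 4 ^ (j * n) * e * G))"
    by (intro sum_mono step) auto
  also have "\<dots> = 2 * (\<integral>\<^sup>+p. (\<Sum>i<n. ?ind i p) * ennreal ((g p)\<^sup>2) \<partial>lborel)
      + of_nat n * ennreal (2 * 4 ^ (j * n) * e * G)"
  proof -
    have "(\<integral>\<^sup>+p. (\<Sum>i<n. ?ind i p) * ennreal ((g p)\<^sup>2) \<partial>lborel)
        = (\<Sum>i<n. \<integral>\<^sup>+p. ?ind i p * ennreal ((g p)\<^sup>2) \<partial>lborel)"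
      unfolding sum_distrib_right by (rule nn_integral_sum) measurable
    thus ?thesis by (simp only: sum.distrib sum_distrib_left sum_constant card_lessThan)
  qed
  also have "\<dots> \<le> 2 * sq_mass g + of_nat n * ennreal (2 * 4 ^ (j * n) * e * G)"
  proof -
    have "(\<integral>\<^sup>+p. (\<Sum>i<n. ?ind i p) * ennreal ((g p)\<^sup>2) \<partial>lborel) \<le> sq_mass g"
      unfolding sq_mass_def
    proof (rule nn_integral_mono)
      fix p
      show "(\<Sum>i<n. ?ind i p) * ennreal ((g p)\<^sup>2) \<le> ennreal ((g p)\<^sup>2)"
        using mult_right_mono[OF le1[of p], of "ennreal ((g p)\<^sup>2)"] by simp
    qed
    thus ?thesis by (intro add_mono mult_left_mono order_refl) auto
  qed
  also have "\<dots> = ennreal (2 * G + real n * (2 * 4 ^ (j * n) * e * G))"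
    using G eps by (simp add: ennreal_plus ennreal_mult' ennreal_of_nat_eq_real_of_nat)
  finally have fin: "of_nat n * ?I \<le> ennreal (2 * G + real n * (2 * 4 ^ (j * n) * e * G))" .
  have "?I = ennreal (1 / real n) * (of_nat n * ?I)"
    using n by (simp add: mult.assoc[symmetric] ennreal_of_nat_eq_real_of_nat ennreal_mult'[symmetric])
  also have "\<dots> \<le> ennreal (1 / real n) * ennreal (2 * G + real n * (2 * 4 ^ (j * n) * e * G))"
    by (intro mult_left_mono fin) auto
  also have "\<dots> = ennreal ((2 / real n + 2 * 4 ^ (j * n) * e) * G)"
    using n by (simp add: ennreal_mult'[symmetric] field_simps)
  finally show ?thesis .
qed

text \<open>The sector around the axis and its image under a shift map meet only in the origin: the
  axis goes to the line through \<open>(t, 1)\<close>, which is far from horizontal as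
  \<open>t\<close> is bounded.\<close>

lemma cone_cover:
  assumes "\<bar>t\<bar> \<le> b" "b \<ge> 0" "p \<noteq> 0"
  shows "p \<in> cone (b + 2) \<or> shift_inv t p \<in> cone (b + 2)"
proof (rule ccontr)
  assume "\<not> ?thesis"
  hence 1: "(b + 2) * \<bar>snd p\<bar> \<le> \<bar>fst p\<bar>"
    and 2: "(b + 2) * \<bar>t * snd p - fst p\<bar> \<le> \<bar>snd p\<bar>"
    by (auto simp: cone_def shift_inv_def not_less)
  have "\<bar>t * snd p\<bar> \<le> b * \<bar>snd p\<bar>"
    using assms by (simp add: abs_mult mult_right_mono)
  hence 3: "2 * \<bar>snd p\<bar> \<le> \<bar>t * snd p - fst p\<bar>" using 1 by (simp add: algebra_simps)
  have "2 * \<bar>t * snd p - fst p\<bar> \<le> (b + 2) * \<bar>t * snd p - fst p\<bar>"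
    using assms by (intro mult_right_mono) auto
  hence 4: "2 * \<bar>t * snd p - fst p\<bar> \<le> \<bar>snd p\<bar>" using 2 by (rule order_trans)
  have "x \<le> 0" if "2 * y \<le> x" "2 * x \<le> y" for x y :: real using that by linarith
  from this[OF 4 3] have "snd p = 0" by simp
  moreover from this have "(b + 2) * \<bar>fst p\<bar> \<le> 0" using 2 by simp
  hence "fst p = 0" using assms by (simp add: mult_le_0_iff)
  ultimately show False using assms by (simp add: prod_eq_iff)
qed

section \<open>Spectral gap of the Koopman operator\<close>

text \<open>The points \<open>x0\<close> and \<open>y0\<close> of the support are the only
  nondegeneracy that enters; the bound \<open>R\<close> acts through \<open>clip\<close>.\<close>

locale random_potential = prob_space m for m :: "real measure" +
  fixes R x0 y0 :: real
  assumes sets_m [simp, measurable_cong]: "sets m = sets borel"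
    and R_nonneg: "0 \<le> R"
    and x0_le: "\<bar>x0\<bar> \<le> R" and y0_le: "\<bar>y0\<bar> \<le> R" and x0_less_y0: "x0 < y0"
    and prob_x0: "\<And>r. r > 0 \<Longrightarrow> prob (ball x0 r) > 0"
    and prob_y0: "\<And>r. r > 0 \<Longrightarrow> prob (ball y0 r) > 0"
begin

abbreviation T :: "real \<Rightarrow> real \<Rightarrow> real \<times> real \<Rightarrow> real \<times> real" where
  "T E a \<equiv> shift_map (E - clip R a)"

definition koop :: "real \<Rightarrow> (real \<times> real \<Rightarrow> real) \<Rightarrow> real \<times> real \<Rightarrow> real" where
  "koop E g p = (\<integral>a. g (T E a p) \<partial>m)"

text \<open>The variance of \<open>g (T E a p)\<close> over the letter \<open>a\<close>, integrated
  over the plane; by \<open>sq_mass_koop\<close> it is exactly the mass that \<open>koop\<close>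
  loses.\<close>

definition defect :: "real \<Rightarrow> (real \<times> real \<Rightarrow> real) \<Rightarrow> ennreal" where
  "defect E g = (\<integral>\<^sup>+a. sq_mass (\<lambda>p. g (T E a p) - koop E g p) \<partial>m)"

lemma abs_clip_le: "\<bar>clip R a\<bar> \<le> R"
  using R_nonneg by (auto simp: clip_def)

lemma abs_pot_le: "\<bar>E\<bar> \<le> R + 2 \<Longrightarrow> \<bar>E - clip R a\<bar> \<le> 2 * R + 2"
  using abs_clip_le[of a] by linarith

lemma clip_ball: "a \<in> ball z r \<Longrightarrow> \<bar>z\<bar> \<le> R \<Longrightarrow> \<bar>clip R a - z\<bar> < r"
  by (auto simp: clip_def dist_real_def)

lemma koop_measurable [measurable (raw)]:
  assumes [measurable]: "g \<in> borel_measurable borel" "f \<in> borel_measurable M"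
  shows "(\<lambda>x. koop E g (f x)) \<in> borel_measurable M"
proof -
  have "koop E g \<in> borel_measurable borel"
    unfolding koop_def[abs_def] by measurable
  from measurable_compose[OF assms(2) this] show ?thesis .
qed

lemma abs_koop_le:
  assumes [measurable]: "g \<in> borel_measurable borel" and g: "\<And>p. \<bar>g p\<bar> \<le> 1"
  shows "\<bar>koop E g p\<bar> \<le> 1"
proof -
  have int: "integrable m (\<lambda>a. g (T E a p))"
    by (rule integrable_const_bound[of _ 1]) (use g in auto)
  have "\<bar>koop E g p\<bar> \<le> (\<integral>a. \<bar>g (T E a p)\<bar> \<partial>m)"
    unfolding koop_def by (rule integral_abs_bound)
  also have "\<dots> \<le> (\<integral>a. 1 \<partial>m)"
    by (intro integral_mono) (use g int in auto)
  finally show ?thesis by (simp add: prob_space)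
qed

sublocale lborel_m: pair_sigma_finite "lborel :: (real \<times> real) measure" m ..

text \<open>At each point the second moment is the squared mean plus the variance. Integrating over
  the plane, Fubini and the invariance of \<open>sq_mass\<close> under each \<open>T E a\<close>
  turn the left side into \<open>sq_mass g\<close>.\<close>

lemma sq_mass_koop:
  assumes [measurable]: "g \<in> borel_measurable borel" and g: "\<And>p. \<bar>g p\<bar> \<le> 1"
  shows "sq_mass g = sq_mass (koop E g) + defect E g"
proof -
  have pt: "(\<integral>\<^sup>+a. ennreal ((g (T E a p))\<^sup>2) \<partial>m) =
      ennreal ((koop E g p)\<^sup>2) + (\<integral>\<^sup>+a. ennreal ((g (T E a p) - koop E g p)\<^sup>2) \<partial>m)" for p
  proof -
    have sq: "(x::real)\<^sup>2 \<le> 1" if "\<bar>x\<bar> \<le> 1" for x using that by (simp add: abs_square_le_1)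
    have int: "integrable m (\<lambda>a. g (T E a p))"
      by (rule integrable_const_bound[of _ 1]) (use g in auto)
    have int2: "integrable m (\<lambda>a. (g (T E a p))\<^sup>2)"
      by (rule integrable_const_bound[of _ 1]) (use g sq in auto)
    have int3: "integrable m (\<lambda>a. (g (T E a p) - koop E g p)\<^sup>2)"
    proof (rule integrable_const_bound[of _ 4])
      have "(g (T E a p) - koop E g p)\<^sup>2 \<le> 4" for a
      proof -
        have "\<bar>g (T E a p) - koop E g p\<bar> \<le> 2"
          using g[of "T E a p"] abs_koop_le[OF assms, of E p] by linarith
        hence "(\<bar>g (T E a p) - koop E g p\<bar>)\<^sup>2 \<le> 2\<^sup>2" by (intro power_mono) auto
        thus ?thesis by simp
      qed
      thus "AE a in m. norm ((g (T E a p) - koop E g p)\<^sup>2) \<le> 4" by simp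
    qed measurable
    have "(\<integral>a. (g (T E a p))\<^sup>2 \<partial>m) = (koop E g p)\<^sup>2 + (\<integral>a. (g (T E a p) - koop E g p)\<^sup>2 \<partial>m)"
      using variance_eq[OF int int2] by (simp add: koop_def)
    moreover have "(\<integral>\<^sup>+a. ennreal ((g (T E a p))\<^sup>2) \<partial>m) = ennreal (\<integral>a. (g (T E a p))\<^sup>2 \<partial>m)"
      by (rule nn_integral_eq_integral[OF int2]) simp
    moreover have "(\<integral>\<^sup>+a. ennreal ((g (T E a p) - koop E g p)\<^sup>2) \<partial>m) =
        ennreal (\<integral>a. (g (T E a p) - koop E g p)\<^sup>2 \<partial>m)"
      by (rule nn_integral_eq_integral[OF int3]) simp
    ultimately show ?thesis by (simp add: ennreal_plus)
  qed
  have "sq_mass g = (\<integral>\<^sup>+a. sq_mass (\<lambda>p. g (T E a p)) \<partial>m)"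
    by (simp add: sq_mass_shift_map emeasure_space_1)
  also have "\<dots> = (\<integral>\<^sup>+p. \<integral>\<^sup>+a. ennreal ((g (T E a p))\<^sup>2) \<partial>m \<partial>lborel)"
    unfolding sq_mass_def by (subst lborel_m.Fubini') measurable
  also have "\<dots> = sq_mass (koop E g) + (\<integral>\<^sup>+p. \<integral>\<^sup>+a. ennreal ((g (T E a p) - koop E g p)\<^sup>2) \<partial>m \<partial>lborel)"
    unfolding pt sq_mass_def by (subst nn_integral_add) measurable
  also have "(\<integral>\<^sup>+p. \<integral>\<^sup>+a. ennreal ((g (T E a p) - koop E g p)\<^sup>2) \<partial>m \<partial>lborel) = defect E g"
    unfolding defect_def sq_mass_def by (subst lborel_m.Fubini') measurable
  finally show ?thesis .
qed

text \<open>Markov's inequality on \<open>A\<close>; the factor \<open>2\<close> leaves room for a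
  strict contradiction.\<close>

lemma exists_le_of_nn_integral_le:
  assumes "A \<in> sets m" "prob A > 0" "(\<integral>\<^sup>+a. f a \<partial>m) \<le> ennreal D" "D > 0"
  shows "\<exists>a\<in>A. f a \<le> ennreal (2 * D / prob A)"
proof (rule ccontr)
  assume "\<not> ?thesis"
  hence "ennreal (2 * D / prob A) * indicator A a \<le> f a" for a
    by (cases "a \<in> A") (auto simp: not_le)
  hence "(\<integral>\<^sup>+a. ennreal (2 * D / prob A) * indicator A a \<partial>m) \<le> (\<integral>\<^sup>+a. f a \<partial>m)"
    by (rule nn_integral_mono)
  also note assms(3)
  finally have "(\<integral>\<^sup>+a. ennreal (2 * D / prob A) * indicator A a \<partial>m) \<le> ennreal D" .
  moreover have "(\<integral>\<^sup>+a. ennreal (2 * D / prob A) * indicator A a \<partial>m) = ennreal (2 * D)"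
    using assms by (simp add: nn_integral_cmult_indicator emeasure_eq_measure ennreal_mult'[symmetric])
  ultimately show False using assms(4) by simp
qed

lemma exists_good_letter:
  assumes "z = x0 \<or> z = y0" "r > 0" "defect E g \<le> ennreal D" "D > 0"
  shows "\<exists>a\<in>ball z r. sq_mass (\<lambda>p. g (T E a p) - koop E g p)
    \<le> ennreal (2 * D / min (prob (ball x0 r)) (prob (ball y0 r)))"
proof -
  have pos: "prob (ball x0 r) > 0" "prob (ball y0 r) > 0"
    using prob_x0 prob_y0 assms(2) by blast+
  have z: "prob (ball z r) > 0" and le: "min (prob (ball x0 r)) (prob (ball y0 r)) \<le> prob (ball z r)"
    using assms(1) pos by (elim disjE; simp only:; simp)+
  have "ball z r \<in> sets m" by simp
  then obtain a where a: "a \<in> ball z r"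
      "sq_mass (\<lambda>p. g (T E a p) - koop E g p) \<le> ennreal (2 * D / prob (ball z r))"
    using exists_le_of_nn_integral_le[OF _ z assms(3)[unfolded defect_def] assms(4)] by blast
  have "2 * D / prob (ball z r) \<le> 2 * D / min (prob (ball x0 r)) (prob (ball y0 r))"
    by (rule divide_left_mono[OF le]) (use pos z assms(4) in simp_all)
  hence "ennreal (2 * D / prob (ball z r)) \<le> ennreal (2 * D / min (prob (ball x0 r)) (prob (ball y0 r)))"
    by (rule ennreal_leI)
  from order_trans[OF a(2) this] a(1) show ?thesis by blast
qed

text \<open>A good letter \<open>a\<close> near \<open>x0\<close> and a good letter \<open>b\<close>
  near \<open>y0\<close> make \<open>g (T E a p)\<close> and \<open>g (T E b p)\<close> both close
  to \<open>koop E g p\<close>, hence close to each other. Since \<open>T E a\<close> is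
  \<open>T E b\<close> followed by a shear, a change of variables removes \<open>T E b\<close>. With
  \<open>r\<close> a quarter of the gap, the shear parameter is at least
  \<open>4 * r - 2 * r\<close>.\<close>

lemma almost_shear_invariant:
  fixes r defines "r \<equiv> (y0 - x0) / 4"
  defines "q \<equiv> min (prob (ball x0 r)) (prob (ball y0 r))"
  assumes [measurable]: "g \<in> borel_measurable borel"
    and def: "defect E g \<le> ennreal D" "D > 0"
  shows "\<exists>c\<ge>2 * r. sq_mass (\<lambda>p. g (shear c p) - g p) \<le> ennreal (8 * D / q)"
proof -
  have r: "r > 0" using x0_less_y0 by (simp add: r_def)
  have q: "q > 0" using prob_x0[OF r] prob_y0[OF r] by (simp add: q_def)
  obtain a where a: "a \<in> ball x0 r" and ga: "sq_mass (\<lambda>p. g (T E a p) - koop E g p) \<le> ennreal (2 * D / q)"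
    using exists_good_letter[of x0 r E g D] def r unfolding q_def by blast
  obtain b where b: "b \<in> ball y0 r" and gb: "sq_mass (\<lambda>p. g (T E b p) - koop E g p) \<le> ennreal (2 * D / q)"
    using exists_good_letter[of y0 r E g D] def r unfolding q_def by blast
  define c where "c = clip R b - clip R a"
  have "c \<ge> 2 * r"
    using clip_ball[OF a x0_le] clip_ball[OF b y0_le] unfolding c_def r_def abs_less_iff by argo
  moreover have "sq_mass (\<lambda>p. g (shear c p) - g p) \<le> ennreal (8 * D / q)"
  proof -
    have T: "T E a p = shear c (T E b p)" for p
      by (subst shift_map_shear[of _ _ "E - clip R b"]) (simp add: c_def)
    have "sq_mass (\<lambda>p. g (shear c p) - g p) = sq_mass (\<lambda>p. g (shear c (T E b p)) - g (T E b p))"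
      by (rule sq_mass_shift_map[symmetric]) measurable
    also have "\<dots> = sq_mass (\<lambda>p. (g (T E a p) - koop E g p) + - (g (T E b p) - koop E g p))"
      by (simp add: T)
    also have "\<dots> \<le> 2 * sq_mass (\<lambda>p. g (T E a p) - koop E g p)
        + 2 * sq_mass (\<lambda>p. - (g (T E b p) - koop E g p))"
      by (rule sq_mass_add_le) measurable
    also have "sq_mass (\<lambda>p. - (g (T E b p) - koop E g p)) = sq_mass (\<lambda>p. g (T E b p) - koop E g p)"
      unfolding sq_mass_def by (simp add: power2_commute)
    also have "2 * sq_mass (\<lambda>p. g (T E a p) - koop E g p) + 2 * sq_mass (\<lambda>p. g (T E b p) - koop E g p)
        \<le> 2 * ennreal (2 * D / q) + 2 * ennreal (2 * D / q)"
      by (intro add_mono mult_left_mono ga gb) auto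
    also have "\<dots> = ennreal (8 * D / q)"
    proof -
      have "2 * ennreal (2 * D / q) = ennreal (2 * (2 * D / q))"
        using def q by (subst ennreal_mult') simp_all
      moreover have "ennreal (8 * D / q) = ennreal (2 * (2 * D / q)) + ennreal (2 * (2 * D / q))"
        using def q by (subst ennreal_plus[symmetric]) simp_all
      ultimately show ?thesis by (simp only:)
    qed
    finally show ?thesis .
  qed
  ultimately show ?thesis by blast
qed

text \<open>If two steps lost less than the share \<open>\<theta>\<close>, then \<open>g\<close> and
  \<open>koop E g\<close> would both have little mass on the cone. Since \<open>g (T E a p)\<close>
  is close to \<open>koop E g p\<close>, \<open>g\<close> would also have little mass on the image
  of the cone under \<open>T E a\<close>; but by \<open>cone_cover\<close> the two sets cover the
  plane.\<close>

theorem koop_spectral_gap: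
  "\<exists>\<rho>. 0 < \<rho> \<and> \<rho> < 1 \<and> (\<forall>E g. \<bar>E\<bar> \<le> R + 2 \<longrightarrow> g \<in> borel_measurable borel \<longrightarrow> (\<forall>p. \<bar>g p\<bar> \<le> 1) \<longrightarrow>
    sq_mass g < \<infinity> \<longrightarrow> sq_mass (koop E (koop E g)) \<le> ennreal \<rho> * sq_mass g)"
proof -
  define b where "b = 2 * R + 2"
  define L where "L = b + 2"
  define r where "r = (y0 - x0) / 4"
  define q where "q = min (prob (ball x0 r)) (prob (ball y0 r))"
  have r: "r > 0" using x0_less_y0 by (simp add: r_def)
  have q: "q > 0" "q \<le> 1"
    using prob_x0[OF r] prob_y0[OF r] by (auto simp: q_def intro: min.coboundedI1)
  have b: "b \<ge> 0" and L: "L \<ge> 0" using R_nonneg by (auto simp: b_def L_def)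
  \<comment> \<open>\<open>2 * r\<close> is the smallest shear parameter that
    \<open>almost_shear_invariant\<close> can return, so this \<open>j\<close> separates the cones
    in all cases.\<close>
  obtain j :: nat where j: "2 * L \<le> real j * (2 * r)"
  proof -
    obtain j :: nat where "L / r \<le> real j" using real_arch_simple by blast
    thus ?thesis using r by (intro that[of j]) (simp add: field_simps)
  qed
  define K where "K = (4::real) ^ (j * 32)"
  have K: "K \<ge> 1" by (simp add: K_def)
  \<comment> \<open>With \<open>32\<close> copies of the cone the first term is \<open>2/32\<close>,
    and \<open>512\<close> makes the error term another \<open>1/16\<close>; together they give the
    \<open>1/8\<close> of \<open>cone_small\<close>.\<close>
  define \<theta> where "\<theta> = q / (512 * K)"
  have th3: "\<theta> \<le> q / 512"
    unfolding \<theta>_def using q K by (intro divide_left_mono) auto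
  have th: "\<theta> > 0" "\<theta> < 1/2" "\<theta> \<le> q / 512"
    using q K th3 by (auto simp: \<theta>_def)
  have thq: "2 * K * (16 * \<theta> / q) = 1/16" using q K by (simp add: \<theta>_def)
  have cone_small: "(\<integral>\<^sup>+p. indicator (cone L) p * ennreal ((g p)\<^sup>2) \<partial>lborel) \<le> ennreal (G / 8)"
    if gm [measurable]: "g \<in> borel_measurable borel" and G: "sq_mass g = ennreal G" "0 < G"
      and d: "defect E g \<le> ennreal (2 * \<theta> * G)" for E g G
  proof -
    obtain c where c: "c \<ge> 2 * r" "sq_mass (\<lambda>p. g (shear c p) - g p) \<le> ennreal (8 * (2 * \<theta> * G) / q)"
      using almost_shear_invariant[OF gm d] G th unfolding r_def q_def by auto
    have "real j * (2 * r) \<le> real j * c" using c by (intro mult_left_mono) auto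
    hence jc: "2 * L \<le> real j * c" using j by linarith
    have "sq_mass (\<lambda>p. g (shear c p) - g p) \<le> ennreal ((16 * \<theta> / q) * G)"
      using c(2) by (simp add: field_simps)
    from cone_mass_le[OF gm G(1) less_imp_le[OF G(2)] this _ jc _ L, of 32]
    have "(\<integral>\<^sup>+p. indicator (cone L) p * ennreal ((g p)\<^sup>2) \<partial>lborel)
        \<le> ennreal ((2 / real 32 + 2 * 4 ^ (j * 32) * (16 * \<theta> / q)) * G)"
      using th q by simp
    also have "(2 / real 32 + 2 * 4 ^ (j * 32) * (16 * \<theta> / q)) * G = G / 8"
      unfolding K_def[symmetric] thq by simp
    finally show ?thesis .
  qed
  have main: "sq_mass (koop E (koop E g)) \<le> ennreal (1 - \<theta>) * sq_mass g"
    if E: "\<bar>E\<bar> \<le> R + 2" and [measurable]: "g \<in> borel_measurable borel"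
      and g1: "\<And>p. \<bar>g p\<bar> \<le> 1" and fin: "sq_mass g < \<infinity>" for E g
  proof (rule ccontr)
    let ?h = "koop E g"
    obtain G where G: "sq_mass g = ennreal G" "0 \<le> G"
      using fin by (cases "sq_mass g") auto
    assume "\<not> ?thesis"
    hence gt: "ennreal ((1 - \<theta>) * G) < sq_mass (koop E ?h)"
      using th G by (simp add: not_le ennreal_mult')
    have e1: "ennreal G = sq_mass ?h + defect E g"
      using sq_mass_koop[OF that(2) g1, of E] G by simp
    have e2: "sq_mass ?h = sq_mass (koop E ?h) + defect E ?h"
      using sq_mass_koop[of ?h E] abs_koop_le[OF that(2) g1, of E] by simp
    have fh: "sq_mass ?h \<le> ennreal G" using e1 by simp
    obtain H where H: "sq_mass ?h = ennreal H" "0 \<le> H" using fh by (cases "sq_mass ?h") (auto simp: top_unique)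
    obtain W where W: "defect E g = ennreal W" "0 \<le> W" using e1 by (cases "defect E g") auto
    obtain H2 where H2: "sq_mass (koop E ?h) = ennreal H2" "0 \<le> H2"
      using e2 H by (cases "sq_mass (koop E ?h)") auto
    obtain W2 where W2: "defect E ?h = ennreal W2" "0 \<le> W2"
      using e2 H by (cases "defect E ?h") auto
    have r1: "G = H + W" using e1 H W G by (simp add: ennreal_plus[symmetric] del: ennreal_plus)
    have r2: "H = H2 + W2" using e2 H H2 W2 by (simp add: ennreal_plus[symmetric] del: ennreal_plus)
    have r3: "(1 - \<theta>) * G < H2" using gt H2 th G by (simp add: ennreal_less_iff)
    hence Gpos: "G > 0" using r1 r2 W W2 G th by (cases "G = 0") auto
    have W': "W \<le> \<theta> * G" and W2': "W2 \<le> \<theta> * G" using r1 r2 r3 W W2 by (auto simp: algebra_simps)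
    have HG: "H \<le> G" using r1 W by simp
    \<comment> \<open>\<open>koop E g\<close> keeps at least half of the mass, so its own loss
      \<open>W2 \<le> \<theta> * G\<close> is at most \<open>2 * \<theta> * H\<close>, as
      \<open>cone_small\<close> requires.\<close>
    have "(1/2) * G \<le> (1 - \<theta>) * G" using th Gpos by (intro mult_right_mono) auto
    hence H12: "G \<le> 2 * H" using r2 r3 W2 by linarith
    have Hpos: "H > 0" using H12 Gpos by simp
    have "\<theta> * G \<le> \<theta> * (2 * H)" using H12 th by (intro mult_left_mono) auto
    hence W2h: "W2 \<le> 2 * \<theta> * H" using W2' by simp
    have "\<theta> * G \<ge> 0" using th Gpos by simp
    hence Wg: "W \<le> 2 * \<theta> * G" using W' by linarith
    have c1: "(\<integral>\<^sup>+p. indicator (cone L) p * ennreal ((g p)\<^sup>2) \<partial>lborel) \<le> ennreal (G / 8)"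
      by (rule cone_small[of g G E]) (use G Gpos W Wg in \<open>auto intro: ennreal_leI\<close>)
    have c2: "(\<integral>\<^sup>+p. indicator (cone L) p * ennreal ((?h p)\<^sup>2) \<partial>lborel) \<le> ennreal (H / 8)"
      by (rule cone_small[of ?h H E]) (use H Hpos W2 W2h in \<open>auto intro: ennreal_leI\<close>)
    \<comment> \<open>One letter near \<open>x0\<close> makes \<open>g (T E a p)\<close> close to
      \<open>koop E g p\<close> in square mass, so that the smallness of \<open>koop E g\<close> on
      the cone passes to it.\<close>
    have "\<theta> * G > 0" using th Gpos by simp
    then obtain a where a: "sq_mass (\<lambda>p. g (T E a p) - ?h p) \<le> ennreal (2 * (\<theta> * G) / q)"
      using exists_good_letter[of x0 r E g "\<theta> * G"] r W W' unfolding q_def by (auto intro: ennreal_leI)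
    have c3: "(\<integral>\<^sup>+p. indicator (cone L) p * ennreal ((g (T E a p))\<^sup>2) \<partial>lborel)
        \<le> ennreal (2 * (H / 8) + 2 * (2 * (\<theta> * G) / q))"
    proof -
      have "(\<integral>\<^sup>+p. indicator (cone L) p * ennreal ((g (T E a p))\<^sup>2) \<partial>lborel)
          \<le> (\<integral>\<^sup>+p. 2 * (indicator (cone L) p * ennreal ((?h p)\<^sup>2)) + 2 * ennreal ((g (T E a p) - ?h p)\<^sup>2) \<partial>lborel)"
      proof (rule nn_integral_mono)
        fix p
        show "indicator (cone L) p * ennreal ((g (T E a p))\<^sup>2) \<le>
          2 * (indicator (cone L) p * ennreal ((?h p)\<^sup>2)) + 2 * ennreal ((g (T E a p) - ?h p)\<^sup>2)"
          using ennreal_sum_sq_le[of "?h p" "g (T E a p) - ?h p"] by (auto simp: indicator_def)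
      qed
      also have "\<dots> = 2 * (\<integral>\<^sup>+p. indicator (cone L) p * ennreal ((?h p)\<^sup>2) \<partial>lborel)
          + 2 * sq_mass (\<lambda>p. g (T E a p) - ?h p)"
        unfolding sq_mass_def by (simp add: nn_integral_add nn_integral_cmult)
      also have "\<dots> \<le> 2 * ennreal (H / 8) + 2 * ennreal (2 * (\<theta> * G) / q)"
        by (intro add_mono mult_left_mono c2 a) auto
      also have "\<dots> = ennreal (2 * (H / 8) + 2 * (2 * (\<theta> * G) / q))"
      proof -
        have two: "2 * ennreal x = ennreal (2 * x)" if "0 \<le> x" for x
          using that by (subst ennreal_mult') simp_all
        have "0 \<le> H / 8" "0 \<le> 2 * (\<theta> * G) / q" using H th Gpos q by simp_all
        thus ?thesis by (subst ennreal_plus) (simp_all only: two mult_nonneg_nonneg zero_le_numeral)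
      qed
      finally show ?thesis .
    qed
    have "ennreal G = (\<integral>\<^sup>+p. ennreal ((g p)\<^sup>2) \<partial>lborel)" using G by (simp add: sq_mass_def)
    also have "\<dots> \<le> (\<integral>\<^sup>+p. indicator (cone L) p * ennreal ((g p)\<^sup>2)
        + indicator (cone L) (shift_inv (E - clip R a) p) * ennreal ((g p)\<^sup>2) \<partial>lborel)"
    \<comment> \<open>The origin escapes \<open>cone_cover\<close>, but it is a null set.\<close>
    proof (rule nn_integral_mono_AE)
      have "AE p in lborel. p \<noteq> (0 :: real \<times> real)" by (rule AE_lborel_singleton)
      thus "AE p in lborel. ennreal ((g p)\<^sup>2) \<le> indicator (cone L) p * ennreal ((g p)\<^sup>2)
        + indicator (cone L) (shift_inv (E - clip R a) p) * ennreal ((g p)\<^sup>2)"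
      proof eventually_elim
        fix p :: "real \<times> real" assume "p \<noteq> 0"
        with cone_cover[OF abs_pot_le[OF E, of a] _ this] R_nonneg
        have "p \<in> cone L \<or> shift_inv (E - clip R a) p \<in> cone L" by (simp add: L_def b_def)
        thus "ennreal ((g p)\<^sup>2) \<le> indicator (cone L) p * ennreal ((g p)\<^sup>2)
          + indicator (cone L) (shift_inv (E - clip R a) p) * ennreal ((g p)\<^sup>2)"
          by (auto simp: indicator_def)
      qed
    qed
    also have "\<dots> = (\<integral>\<^sup>+p. indicator (cone L) p * ennreal ((g p)\<^sup>2) \<partial>lborel)
        + (\<integral>\<^sup>+p. indicator (cone L) (shift_inv (E - clip R a) p) * ennreal ((g p)\<^sup>2) \<partial>lborel)"
      by (rule nn_integral_add) measurable
    also have "(\<integral>\<^sup>+p. indicator (cone L) (shift_inv (E - clip R a) p) * ennreal ((g p)\<^sup>2) \<partial>lborel)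
        = (\<integral>\<^sup>+p. indicator (cone L) p * ennreal ((g (T E a p))\<^sup>2) \<partial>lborel)"
      using nn_integral_shift_map[of "\<lambda>p. indicator (cone L) (shift_inv (E - clip R a) p) * ennreal ((g p)\<^sup>2)"
          "E - clip R a"] by simp
    also have "(\<integral>\<^sup>+p. indicator (cone L) p * ennreal ((g p)\<^sup>2) \<partial>lborel)
        + (\<integral>\<^sup>+p. indicator (cone L) p * ennreal ((g (T E a p))\<^sup>2) \<partial>lborel)
        \<le> ennreal (G / 8) + ennreal (2 * (H / 8) + 2 * (2 * (\<theta> * G) / q))"
      by (intro add_mono c1 c3)
    also have "\<dots> = ennreal (G / 8 + (2 * (H / 8) + 2 * (2 * (\<theta> * G) / q)))"
      using H th Gpos q by (subst ennreal_plus) simp_all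
    finally have "G \<le> G / 8 + (2 * (H / 8) + 2 * (2 * (\<theta> * G) / q))"
      using H th Gpos q by (subst (asm) ennreal_le_iff) (auto intro!: add_nonneg_nonneg)
    moreover have "2 * (2 * (\<theta> * G) / q) \<le> G / 128"
    proof -
      have "\<theta> / q \<le> 1 / 512" using th q by (simp add: field_simps)
      hence "\<theta> / q * G \<le> 1 / 512 * G" using Gpos by (intro mult_right_mono) auto
      thus ?thesis by (simp add: mult.commute)
    qed
    \<comment> \<open>The three shares are at most \<open>1/8\<close>, \<open>1/4\<close> and
      \<open>1/128\<close>, less than \<open>1\<close> in all.\<close>
    ultimately show False using HG Gpos by simp
  qed
  show ?thesis
    by (rule exI[of _ "1 - \<theta>"]) (use th main in auto)
qed

end

section \<open>Random orbits and growth of the norm\<close>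

lemma abs_wedge_le: "\<bar>wedge p q\<bar> \<le> norm p * norm q"
proof -
  have "wedge p q = inner p (snd q, - fst q)"
    by (cases p, cases q) (simp add: wedge_def)
  also have "\<bar>\<dots>\<bar> \<le> norm p * norm (snd q, - fst q)"
    by (rule Cauchy_Schwarz_ineq2)
  also have "norm (snd q, - fst q) = norm q"
    by (simp add: norm_fst_snd add.commute)
  finally show ?thesis .
qed

lemma wedge_perp: "wedge p (- snd p, fst p) = (norm p)\<^sup>2"
  by (simp add: wedge_def norm_fst_snd power2_eq_square)

lemma norm_perp: "norm (- snd p, fst p) = norm (p :: real \<times> real)"
  by (simp add: norm_fst_snd add.commute)

context random_potential
begin

text \<open>One-sided sequences suffice because the products read only the letters
  \<open>0, ..., n - 1\<close>; \<open>lyap_eq\<close> makes the passage from two-sided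
  ones.\<close>

abbreviation S :: "(nat \<Rightarrow> real) measure" where
  "S \<equiv> \<Pi>\<^sub>M i\<in>UNIV. m"

sublocale S: prob_space S
  by (rule prob_space_PiM) (rule prob_space_axioms)

sublocale seq: sequence_space m
  by unfold_locales

primrec orb :: "real \<Rightarrow> (nat \<Rightarrow> real) \<Rightarrow> nat \<Rightarrow> real \<times> real \<Rightarrow> real \<times> real" where
  "orb E \<omega> 0 p = p"
| "orb E \<omega> (Suc n) p = T E (\<omega> n) (orb E \<omega> n p)"

text \<open>The Hilbert-Schmidt norm of the product, from its two columns. As the determinant is 1,
  it also bounds the inverse, see \<open>norm_le_HS_orb\<close>.\<close>

definition HS :: "real \<Rightarrow> (nat \<Rightarrow> real) \<Rightarrow> nat \<Rightarrow> real" where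
  "HS E \<omega> n = norm (norm (orb E \<omega> n (1, 0)), norm (orb E \<omega> n (0, 1)))"

text \<open>A common bound for one transfer matrix and its inverse: on the window
  \<open>\<bar>E\<bar> \<le> R + 2\<close> the entry \<open>E - clip R a\<close> is at most
  \<open>2 * R + 2\<close>, and \<open>norm_shift_map_le\<close> adds \<open>2\<close>.\<close>

definition step_bound :: real where
  "step_bound = 2 * R + 4"

lemma step_bound_ge: "step_bound \<ge> 4"
  using R_nonneg by (simp add: step_bound_def)

lemma orb_measurable [measurable (raw)]:
  assumes [measurable]: "f \<in> measurable M (\<Pi>\<^sub>M i\<in>UNIV. borel)" "g \<in> borel_measurable M"
  shows "(\<lambda>x. orb E (f x) n (g x)) \<in> borel_measurable M"
  by (induction n) simp_all

lemma HS_measurable [measurable]: "(\<lambda>\<omega>. HS E \<omega> n) \<in> borel_measurable S"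
proof -
  have "HS E \<omega> n = sqrt ((norm (orb E \<omega> n (1, 0)))\<^sup>2 + (norm (orb E \<omega> n (0, 1)))\<^sup>2)" for \<omega>
    by (simp add: HS_def norm_Pair)
  thus ?thesis by simp
qed

lemma orb_add: "orb E \<omega> n (p + q) = orb E \<omega> n p + orb E \<omega> n q"
  by (induction n) (simp_all add: shift_map_add)

lemma orb_scaleR: "orb E \<omega> n (c *\<^sub>R p) = c *\<^sub>R orb E \<omega> n p"
  by (induction n) (simp_all add: shift_map_scaleR)

lemma orb_expand: "orb E \<omega> n p = fst p *\<^sub>R orb E \<omega> n (1, 0) + snd p *\<^sub>R orb E \<omega> n (0, 1)"
  by (cases p) (simp add: orb_scaleR[symmetric] orb_add[symmetric])

lemma orb_eq_0_iff [simp]: "orb E \<omega> n p = 0 \<longleftrightarrow> p = 0"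
  by (induction n) auto

lemma wedge_orb [simp]: "wedge (orb E \<omega> n p) (orb E \<omega> n q) = wedge p q"
  by (induction n) auto

lemma norm_T_le: "\<bar>E\<bar> \<le> R + 2 \<Longrightarrow> norm (T E a p) \<le> step_bound * norm p"
  using norm_shift_map_le[OF abs_pot_le, of E a p] by (simp add: step_bound_def add.commute)

lemma norm_T_ge: "\<bar>E\<bar> \<le> R + 2 \<Longrightarrow> norm p \<le> step_bound * norm (T E a p)"
  using norm_shift_map_ge[OF abs_pot_le, of E p a] by (simp add: step_bound_def add.commute)

lemma norm_orb_le: "\<bar>E\<bar> \<le> R + 2 \<Longrightarrow> norm (orb E \<omega> n p) \<le> step_bound ^ n * norm p"
proof (induction n)
  case (Suc n)
  have "norm (orb E \<omega> (Suc n) p) \<le> step_bound * norm (orb E \<omega> n p)"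
    using norm_T_le[OF Suc.prems] by simp
  also have "\<dots> \<le> step_bound * (step_bound ^ n * norm p)"
    using Suc step_bound_ge by (intro mult_left_mono) auto
  finally show ?case by simp
qed simp

lemma norm_orb_ge: "\<bar>E\<bar> \<le> R + 2 \<Longrightarrow> norm p \<le> step_bound ^ n * norm (orb E \<omega> n p)"
proof (induction n)
  case (Suc n)
  have "norm p \<le> step_bound ^ n * norm (orb E \<omega> n p)" using Suc by simp
  also have "\<dots> \<le> step_bound ^ n * (step_bound * norm (orb E \<omega> (Suc n) p))"
    using norm_T_ge[OF Suc.prems] step_bound_ge by (intro mult_left_mono) auto
  finally show ?case by (simp add: ac_simps)
qed simp

lemma norm_orb_le_HS: "norm (orb E \<omega> n p) \<le> HS E \<omega> n * norm p"
proof -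
  let ?a = "norm (orb E \<omega> n (1, 0))" and ?b = "norm (orb E \<omega> n (0, 1))"
  have "norm (orb E \<omega> n p) \<le> \<bar>fst p\<bar> * ?a + \<bar>snd p\<bar> * ?b"
    by (subst orb_expand) (rule order_trans[OF norm_triangle_ineq], simp)
  also have "\<dots> = inner (?a, ?b) (\<bar>fst p\<bar>, \<bar>snd p\<bar>)" by simp
  also have "\<dots> \<le> norm (?a, ?b) * norm (\<bar>fst p\<bar>, \<bar>snd p\<bar>)" by (rule norm_cauchy_schwarz)
  also have "norm (\<bar>fst p\<bar>, \<bar>snd p\<bar>) = norm p" by (simp add: norm_fst_snd)
  finally show ?thesis by (simp add: HS_def)
qed

text \<open>The squared norm of \<open>p\<close> is the area spanned by \<open>p\<close> and its
  rotation by a right angle; the product preserves this area, while it stretches the rotated vector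
  by at most \<open>HS\<close>.\<close>

lemma norm_le_HS_orb: "norm p \<le> HS E \<omega> n * norm (orb E \<omega> n p)"
proof (cases "p = 0")
  case False
  have "(norm p)\<^sup>2 = wedge (orb E \<omega> n p) (orb E \<omega> n (- snd p, fst p))"
    by (simp only: wedge_orb wedge_perp)
  also have "\<dots> \<le> norm (orb E \<omega> n p) * norm (orb E \<omega> n (- snd p, fst p))"
    using abs_wedge_le by (rule order_trans[OF abs_ge_self])
  also have "\<dots> \<le> norm (orb E \<omega> n p) * (HS E \<omega> n * norm p)"
    using norm_orb_le_HS[of E \<omega> n "(- snd p, fst p)"] by (intro mult_left_mono) (auto simp: norm_perp)
  finally have "norm p * norm p \<le> (HS E \<omega> n * norm (orb E \<omega> n p)) * norm p"
    by (simp add: power2_eq_square ac_simps)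
  thus ?thesis using False by (simp add: mult_le_cancel_right)
qed (simp add: HS_def)

text \<open>The columns span area 1, which is at most the product of their lengths.\<close>

lemma HS_ge_1: "HS E \<omega> n \<ge> 1"
proof -
  have H0: "HS E \<omega> n \<ge> 0" by (simp add: HS_def)
  have "1 = \<bar>wedge (orb E \<omega> n (1, 0)) (orb E \<omega> n (0, 1))\<bar>"
    unfolding wedge_orb by (simp add: wedge_def)
  also have "\<dots> \<le> norm (orb E \<omega> n (1, 0)) * norm (orb E \<omega> n (0, 1))" by (rule abs_wedge_le)
  also have "\<dots> \<le> HS E \<omega> n * HS E \<omega> n"
    using norm_orb_le_HS[of E \<omega> n "(1, 0)"] norm_orb_le_HS[of E \<omega> n "(0, 1)"] H0
    by (intro mult_mono) (auto simp: norm_Pair)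
  finally have "1\<^sup>2 \<le> (HS E \<omega> n)\<^sup>2" by (simp add: power2_eq_square)
  thus ?thesis using H0 by (rule power2_le_imp_le)
qed

section \<open>Splitting an independent sequence\<close>

lemma orb_cong: "(\<And>i. i < n \<Longrightarrow> \<omega> i = \<omega>' i) \<Longrightarrow> orb E \<omega> n p = orb E \<omega>' n p"
  by (induction n) auto

lemma orb_comb_seq_left: "orb E (comb_seq k \<omega> \<omega>') k p = orb E \<omega> k p"
  by (rule orb_cong) (simp add: comb_seq_def)

lemma orb_comb_seq: "orb E (comb_seq k \<omega> \<omega>') (k + n) p = orb E \<omega>' n (orb E \<omega> k p)"
  by (induction n) (simp_all add: orb_comb_seq_left, simp add: comb_seq_def)

lemma comb_seq_measurable [measurable]:
  "(\<lambda>x. comb_seq k (fst x) (snd x)) \<in> measurable (S \<Otimes>\<^sub>M S) S"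
  using measurable_comb_seq[of k m] by (simp add: case_prod_unfold)

sublocale SS: pair_prob_space S S
  by unfold_locales

text \<open>Independence: the first \<open>k\<close> letters of one sequence followed by a second,
  independent sequence have the law of a single sequence.\<close>

lemma integral_S_comb_seq:
  fixes F :: "(nat \<Rightarrow> real) \<Rightarrow> real"
  assumes [measurable]: "F \<in> borel_measurable S" and F: "\<And>\<omega>. \<bar>F \<omega>\<bar> \<le> B"
  shows "(\<integral>\<omega>. F \<omega> \<partial>S) = (\<integral>\<omega>. (\<integral>\<omega>'. F (comb_seq k \<omega> \<omega>') \<partial>S) \<partial>S)"
proof -
  have "(\<integral>\<omega>. F \<omega> \<partial>S) = (\<integral>\<omega>. F \<omega> \<partial>(distr (S \<Otimes>\<^sub>M S) S (\<lambda>(\<omega>, \<omega>'). comb_seq k \<omega> \<omega>')))"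
    by (simp add: seq.PiM_comb_seq)
  also have "\<dots> = (\<integral>x. F (comb_seq k (fst x) (snd x)) \<partial>(S \<Otimes>\<^sub>M S))"
    by (subst integral_distr) (simp_all add: case_prod_unfold)
  also have "\<dots> = (\<integral>\<omega>. (\<integral>\<omega>'. F (comb_seq k \<omega> \<omega>') \<partial>S) \<partial>S)"
  proof -
    have "integrable (S \<Otimes>\<^sub>M S) (\<lambda>(\<omega>, \<omega>'). F (comb_seq k \<omega> \<omega>'))"
      unfolding case_prod_unfold
      by (rule SS.integrable_const_bound[of _ B]) (use F in auto)
    from SS.integral_fst'[OF this] show ?thesis by (simp add: case_prod_unfold)
  qed
  finally show ?thesis .
qed

lemma integral_S_coord:
  fixes h :: "real \<Rightarrow> real"
  assumes [measurable]: "h \<in> borel_measurable borel"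
  shows "(\<integral>\<omega>. h (\<omega> n) \<partial>S) = (\<integral>a. h a \<partial>m)"
proof -
  have "m = distr S m (\<lambda>\<omega>. \<omega> n)"
    using seq.PiM_component[of n] by simp
  hence "(\<integral>a. h a \<partial>m) = (\<integral>a. h a \<partial>(distr S m (\<lambda>\<omega>. \<omega> n)))" by simp
  also have "\<dots> = (\<integral>\<omega>. h (\<omega> n) \<partial>S)"
    by (rule integral_distr) measurable
  finally show ?thesis by simp
qed

lemma integral_first_step:
  fixes F :: "real \<times> real \<Rightarrow> real"
  assumes [measurable]: "F \<in> borel_measurable borel" and F: "\<And>\<omega>. \<bar>F (orb E \<omega> (Suc n) p)\<bar> \<le> B"
  shows "(\<integral>\<omega>. F (orb E \<omega> (Suc n) p) \<partial>S) = (\<integral>a. (\<integral>\<omega>. F (orb E \<omega> n (T E a p)) \<partial>S) \<partial>m)"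
proof -
  have "(\<integral>\<omega>. F (orb E \<omega> (Suc n) p) \<partial>S) =
      (\<integral>\<omega>. (\<integral>\<omega>'. F (orb E (comb_seq 1 \<omega> \<omega>') (Suc n) p) \<partial>S) \<partial>S)"
    by (rule integral_S_comb_seq[OF _ F]) measurable
  also have "\<dots> = (\<integral>\<omega>. (\<integral>\<omega>'. F (orb E \<omega>' n (T E (\<omega> 0) p)) \<partial>S) \<partial>S)"
    using orb_comb_seq[of E 1 _ _ n p] by simp
  also have "\<dots> = (\<integral>a. (\<integral>\<omega>. F (orb E \<omega> n (T E a p)) \<partial>S) \<partial>m)"
    by (rule integral_S_coord[where h = "\<lambda>a. (\<integral>\<omega>. F (orb E \<omega> n (T E a p)) \<partial>S)"]) measurable
  finally show ?thesis .
qed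

text \<open>The iterates of \<open>koop\<close> on the indicator of the unit disc, written as
  probabilities.\<close>

definition hit :: "real \<Rightarrow> nat \<Rightarrow> real \<times> real \<Rightarrow> real" where
  "hit E n p = (\<integral>\<omega>. indicator (ball 0 1) (orb E \<omega> n p) \<partial>S)"

lemma hit_measurable [measurable]: "hit E n \<in> borel_measurable borel"
proof -
  have [measurable]: "ball (0 :: real \<times> real) 1 \<in> sets borel" by simp
  show ?thesis unfolding hit_def[abs_def] by measurable
qed

lemma abs_hit_le: "\<bar>hit E n p\<bar> \<le> 1"
proof -
  have "\<bar>hit E n p\<bar> \<le> (\<integral>\<omega>. \<bar>indicator (ball 0 1) (orb E \<omega> n p)\<bar> \<partial>S)"
    unfolding hit_def by (rule integral_abs_bound)
  also have "\<dots> \<le> (\<integral>\<omega>. 1 \<partial>S)"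
    by (intro integral_mono S.integrable_const_bound[of _ 1]) (auto simp: indicator_def)
  finally show ?thesis by (simp add: S.prob_space)
qed

text \<open>\<open>koop\<close> averages over the first letter of the product, so the conditioning
  is on the first step and not on the last.\<close>

lemma hit_Suc: "hit E (Suc n) = koop E (hit E n)"
  unfolding hit_def[abs_def] koop_def[abs_def]
  by (intro ext integral_first_step[of _ _ _ _ 1]) (auto simp: indicator_def)

lemma sq_mass_hit_0: "sq_mass (hit E 0) = emeasure lborel (ball (0 :: real \<times> real) 1)"
proof -
  have "hit E 0 = indicator (ball 0 1)"
    by (auto simp: hit_def S.prob_space)
  hence "sq_mass (hit E 0) = (\<integral>\<^sup>+p. indicator (ball 0 1) (p :: real \<times> real) \<partial>lborel)"
    unfolding sq_mass_def by (intro nn_integral_cong) (auto simp: indicator_def)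
  thus ?thesis by simp
qed

lemma emeasure_ball_eq: "r \<ge> 0 \<Longrightarrow> emeasure lborel (ball (0 :: real \<times> real) r) = ennreal (measure lborel (ball (0 :: real \<times> real) r))"
  by (rule emeasure_eq_ennreal_measure) (use emeasure_lborel_ball_finite[of "0 :: real \<times> real" r] in auto)

text \<open>Where \<open>HS \<le> K\<close>, the disc of radius \<open>1 / K\<close> is mapped into
  the unit disc. So on that small disc \<open>hit\<close> is at least the probability of this event,
  while its square mass decays like \<open>\<rho> ^ n\<close>. The time is \<open>2 * n\<close>
  because the gap concerns two steps.\<close>

lemma HS_tail:
  "\<exists>\<rho>. 0 < \<rho> \<and> \<rho> < 1 \<and> (\<forall>E n K. \<bar>E\<bar> \<le> R + 2 \<longrightarrow> K > 0 \<longrightarrow>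
     (measure S {\<omega>\<in>space S. HS E \<omega> (2 * n) \<le> K})\<^sup>2 * measure lborel (ball (0 :: real \<times> real) (1 / K))
       \<le> \<rho> ^ n * measure lborel (ball (0 :: real \<times> real) 1))"
proof -
  obtain \<rho> where rho: "0 < \<rho>" "\<rho> < 1"
    and gap: "\<And>E g. \<bar>E\<bar> \<le> R + 2 \<Longrightarrow> g \<in> borel_measurable borel \<Longrightarrow> (\<And>p. \<bar>g p\<bar> \<le> 1) \<Longrightarrow>
      sq_mass g < \<infinity> \<Longrightarrow> sq_mass (koop E (koop E g)) \<le> ennreal \<rho> * sq_mass g"
    using koop_spectral_gap by blast
  let ?V = "\<lambda>r. measure lborel (ball (0 :: real \<times> real) r)"
  have decay: "sq_mass (hit E (2 * n)) \<le> ennreal (\<rho> ^ n * ?V 1)" if E: "\<bar>E\<bar> \<le> R + 2" for E n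
  proof (induction n)
    case 0
    show ?case by (simp add: sq_mass_hit_0 emeasure_ball_eq)
  next
    case (Suc n)
    have "sq_mass (hit E (2 * Suc n)) = sq_mass (koop E (koop E (hit E (2 * n))))"
      by (simp add: hit_Suc)
    also have "\<dots> \<le> ennreal \<rho> * sq_mass (hit E (2 * n))"
      by (rule gap[OF E _ abs_hit_le]) (use Suc.IH in \<open>auto intro: order_le_less_trans\<close>)
    also have "\<dots> \<le> ennreal \<rho> * ennreal (\<rho> ^ n * ?V 1)"
      by (intro mult_left_mono Suc.IH) auto
    finally show ?case using rho by (simp add: ennreal_mult'[symmetric] ac_simps)
  qed
  have "(measure S {\<omega>\<in>space S. HS E \<omega> (2 * n) \<le> K})\<^sup>2 * ?V (1 / K) \<le> \<rho> ^ n * ?V 1"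
    if E: "\<bar>E\<bar> \<le> R + 2" and K: "K > 0" for E n K
  proof -
    let ?A = "{\<omega>\<in>space S. HS E \<omega> (2 * n) \<le> K}"
    have le: "measure S ?A \<le> hit E (2 * n) p" if p: "p \<in> ball 0 (1 / K)" for p
    proof -
      have "orb E \<omega> (2 * n) p \<in> ball 0 1" if w: "HS E \<omega> (2 * n) \<le> K" for \<omega>
      proof -
        have "norm (orb E \<omega> (2 * n) p) \<le> K * norm p"
          using norm_orb_le_HS[of E \<omega> "2 * n" p] w by (meson mult_right_mono norm_ge_zero order_trans)
        also have "\<dots> < 1" using p K by (simp add: field_simps)
        finally show ?thesis by simp
      qed
      hence "indicator ?A \<omega> \<le> (indicator (ball 0 1) (orb E \<omega> (2 * n) p) :: real)" for \<omega>
        by (auto simp: indicator_def)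
      hence "(\<integral>\<omega>. indicator ?A \<omega> \<partial>S) \<le> hit E (2 * n) p"
        unfolding hit_def by (intro integral_mono S.integrable_const_bound[of _ 1]) (auto simp: indicator_def)
      thus ?thesis by simp
    qed
    have "ennreal ((measure S ?A)\<^sup>2 * ?V (1 / K)) = (\<integral>\<^sup>+p. ennreal ((measure S ?A)\<^sup>2) * indicator (ball 0 (1 / K)) (p :: real \<times> real) \<partial>lborel)"
      using K by (simp add: nn_integral_cmult_indicator emeasure_ball_eq ennreal_mult')
    also have "\<dots> \<le> sq_mass (hit E (2 * n))"
      unfolding sq_mass_def
    proof (rule nn_integral_mono)
      fix p :: "real \<times> real"
      show "ennreal ((measure S ?A)\<^sup>2) * indicator (ball 0 (1 / K)) p \<le> ennreal ((hit E (2 * n) p)\<^sup>2)"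
        using le[of p] by (auto simp: indicator_def intro!: ennreal_leI power_mono)
    qed
    also have "\<dots> \<le> ennreal (\<rho> ^ n * ?V 1)" by (rule decay[OF E])
    finally show ?thesis using rho by simp
  qed
  with rho show ?thesis by blast
qed

lemma ln_HS_integrable: "\<bar>E\<bar> \<le> R + 2 \<Longrightarrow> integrable S (\<lambda>\<omega>. ln (HS E \<omega> n))"
proof -
  assume E: "\<bar>E\<bar> \<le> R + 2"
  let ?B = "2 * step_bound ^ n"
  have "HS E \<omega> n \<le> ?B" for \<omega>
  proof -
    have "HS E \<omega> n \<le> norm (orb E \<omega> n (1, 0)) + norm (orb E \<omega> n (0, 1))"
      unfolding HS_def using norm_le_abs_sum[of "(norm (orb E \<omega> n (1, 0)), norm (orb E \<omega> n (0, 1)))"] by simp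
    also have "\<dots> \<le> step_bound ^ n * norm (1::real, 0::real) + step_bound ^ n * norm (0::real, 1::real)"
      by (intro add_mono norm_orb_le E)
    finally show ?thesis by (simp add: norm_Pair)
  qed
  hence "norm (ln (HS E \<omega> n)) \<le> ln ?B" for \<omega>
    using HS_ge_1[of E \<omega> n] step_bound_ge by (simp add: ln_mono)
  thus ?thesis by (intro S.integrable_const_bound[of _ "ln ?B"]) auto
qed

theorem log_HS_unbounded:
  "\<exists>n. \<forall>E. \<bar>E\<bar> \<le> R + 2 \<longrightarrow> (\<integral>\<omega>. ln (HS E \<omega> n) \<partial>S) \<ge> B"
proof -
  \<comment> \<open>The event \<open>HS > K\<close> will have probability at least
    \<open>1/2\<close>, hence the factor \<open>2\<close>; \<open>max\<close> ensures
    \<open>ln K \<ge> 0\<close>.\<close>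
  define K where "K = exp (2 * max B 0)"
  have K: "K \<ge> 1" "ln K = 2 * max B 0" by (auto simp: K_def)
  let ?V = "\<lambda>r. measure lborel (ball (0 :: real \<times> real) r)"
  obtain \<rho> where rho: "0 < \<rho>" "\<rho> < 1"
    and tail: "\<forall>E n K. \<bar>E\<bar> \<le> R + 2 \<longrightarrow> K > 0 \<longrightarrow>
     (measure S {\<omega>\<in>space S. HS E \<omega> (2 * n) \<le> K})\<^sup>2 * ?V (1 / K) \<le> \<rho> ^ n * ?V 1"
    using HS_tail by (elim exE conjE)
  have V: "?V r > 0" if "r > 0" for r
    using content_ball_pos[OF that, of "0 :: real \<times> real"] by simp
  hence V: "?V 1 > 0" "?V (1 / K) > 0" using K by simp_all
  have "(\<lambda>n. \<rho> ^ n) \<longlonglongrightarrow> 0" using rho by (intro LIMSEQ_power_zero) auto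
  \<comment> \<open>Below this threshold the tail bound makes the squared probability at most
    \<open>1/4\<close>. The energy does not occur in it, so one \<open>n\<close> serves all
    energies.\<close>
  moreover have "?V (1 / K) / (4 * ?V 1) > 0" using V by simp
  ultimately have "eventually (\<lambda>n. \<rho> ^ n < ?V (1 / K) / (4 * ?V 1)) sequentially"
    by (rule order_tendstoD)
  then obtain n where n: "\<rho> ^ n < ?V (1 / K) / (4 * ?V 1)"
    by (auto simp: eventually_sequentially)
  have "(\<integral>\<omega>. ln (HS E \<omega> (2 * n)) \<partial>S) \<ge> B" if E: "\<bar>E\<bar> \<le> R + 2" for E
  proof -
    let ?A = "{\<omega>\<in>space S. HS E \<omega> (2 * n) \<le> K}"
    have "(measure S ?A)\<^sup>2 * ?V (1 / K) \<le> \<rho> ^ n * ?V 1"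
      using tail E K by simp
    also have "\<dots> \<le> (1/2)\<^sup>2 * ?V (1 / K)" using n V by (simp add: field_simps power2_eq_square)
    finally have "(measure S ?A)\<^sup>2 \<le> (1/2)\<^sup>2" using V by (simp only: mult_le_cancel_right)
    hence A: "measure S ?A \<le> 1/2" by (rule power2_le_imp_le) simp
    have "B \<le> (1 - 1/2) * ln K" using K by simp
    also have "\<dots> \<le> (1 - measure S ?A) * ln K" using A K by (intro mult_right_mono) auto
    also have "\<dots> = (\<integral>\<omega>. ln K * indicator (space S - ?A) \<omega> \<partial>S)"
      by (simp add: S.prob_compl)
    also have "\<dots> \<le> (\<integral>\<omega>. ln (HS E \<omega> (2 * n)) \<partial>S)"
    proof (rule integral_mono)
      fix \<omega>
      have "ln (HS E \<omega> (2 * n)) \<ge> 0" using HS_ge_1 by simp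
      moreover have "ln (HS E \<omega> (2 * n)) \<ge> ln K" if "\<omega> \<in> space S - ?A"
        using that K by (intro ln_mono) auto
      ultimately show "ln K * indicator (space S - ?A) \<omega> \<le> ln (HS E \<omega> (2 * n))"
        by (auto simp: indicator_def)
    qed (auto intro!: ln_HS_integrable E S.integrable_const_bound[of _ 1])
    finally show ?thesis .
  qed
  thus ?thesis by blast
qed

end

section \<open>Separated triples of vectors\<close>

text \<open>Cramer's rule for the coordinates of \<open>e\<close> in terms of \<open>p\<close> and
  \<open>q\<close>, cleared of the denominator.\<close>

lemma wedge_expand: "wedge p q *\<^sub>R e = wedge e q *\<^sub>R p - wedge e p *\<^sub>R q"
  by (simp add: wedge_def prod_eq_iff algebra_simps)

lemma wedge_commute: "wedge q p = - wedge p q"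
  by (simp add: wedge_def)

lemma wedge_parallel:
  assumes "p \<noteq> 0" "wedge p q = 0" "wedge p r = 0"
  shows "wedge q r = 0"
proof -
  have "wedge q r *\<^sub>R p = 0"
    using wedge_expand[of q r p] assms by simp
  thus ?thesis using assms(1) by simp
qed

text \<open>Positive exactly when no two of the three vectors are linearly dependent, and continuous
  in them.\<close>

definition spread :: "real \<times> real \<Rightarrow> real \<times> real \<Rightarrow> real \<times> real \<Rightarrow> real" where
  "spread p q r = \<bar>wedge p q\<bar> * \<bar>wedge p r\<bar> * \<bar>wedge q r\<bar>"

lemma spread_nonneg: "spread p q r \<ge> 0"
  by (simp add: spread_def)

text \<open>Six triples formed from \<open>p\<close> and its images under one and two steps, enough
  for one of them to be independent in pairs whatever \<open>p\<close> is. In \<open>ts\<close> the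
  second letter is the earlier step. All six letters are separate parameters because later they are
  known only approximately.\<close>

definition orbit_spread ::
    "real \<times> real \<Rightarrow> real \<Rightarrow> real \<Rightarrow> real \<Rightarrow> real \<Rightarrow> real \<Rightarrow> real \<Rightarrow> real" where
  "orbit_spread p s t ss ts st tt =
     spread p (shift_map s p) (shift_map t p)
   + spread p (shift_map t p) (shift_map st (shift_map t p))
   + spread p (shift_map t p) (shift_map tt (shift_map t p))
   + spread p (shift_map s p) (shift_map ts (shift_map s p))
   + spread p (shift_map s p) (shift_map ss (shift_map s p))
   + spread (shift_map s p) (shift_map ss (shift_map s p)) (shift_map ts (shift_map s p))"

lemma wedge_shift_map_two: "wedge (shift_map s p) (shift_map t p) = (s - t) * (fst p)\<^sup>2"
  by (simp add: wedge_def shift_map_def power2_eq_square algebra_simps)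

text \<open>Projectively, \<open>s\<close> would fix two lines that \<open>t\<close> exchanges: the slopes of the fixed lines have product
  \<open>1\<close>, whereas an exchange forces \<open>t = 0\<close> and slopes of product \<open>-1\<close>.\<close>
lemma no_invariant_pair:
  assumes "s \<noteq> t" "fst p \<noteq> 0"
    and 1: "wedge p (shift_map s p) = 0"
    and 2: "wedge (shift_map t p) (shift_map s (shift_map t p)) = 0"
    and 3: "wedge p (shift_map t (shift_map t p)) = 0"
  shows False
proof -
  define u where "u = fst p"
  define v where "v = snd p / u"
  have u: "u \<noteq> 0" using assms by (simp add: u_def)
  have p: "p = (u, u * v)" using u by (simp add: v_def u_def prod_eq_iff)
  have "wedge p (shift_map s p) = u\<^sup>2 * (1 + v\<^sup>2 - s * v)"
    by (simp add: p wedge_def shift_map_def power2_eq_square algebra_simps)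
  hence e1: "1 + v\<^sup>2 - s * v = 0" using 1 u by simp
  define w where "w = t - v"
  have "wedge (shift_map t p) (shift_map s (shift_map t p)) = u\<^sup>2 * (1 + w\<^sup>2 - s * w)"
    by (simp add: p w_def wedge_def shift_map_def power2_eq_square algebra_simps)
  hence e2: "1 + w\<^sup>2 - s * w = 0" using 2 u by simp
  have "wedge p (shift_map t (shift_map t p)) = u\<^sup>2 * (t * (1 - v * w))"
    by (simp add: p w_def wedge_def shift_map_def power2_eq_square algebra_simps)
  hence e3: "t = 0 \<or> v * w = 1" using 3 u by auto
  \<comment> \<open>\<open>v\<close> is the slope of \<open>p\<close>, and its image under
    \<open>t\<close> is a multiple of \<open>(w, 1)\<close>. Both numbers are roots of
    \<open>1 + x\<^sup>2 - s * x\<close>, and distinct roots would have sum \<open>s\<close>,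
    whereas \<open>v + w = t\<close>.\<close>
  have "(v - w) * (v + w - s) = (1 + v\<^sup>2 - s * v) - (1 + w\<^sup>2 - s * w)"
    by (simp add: power2_eq_square algebra_simps)
  also have "\<dots> = 0" by (simp only: e1 e2)
  finally have "(v - w) * (v + w - s) = 0" .
  moreover have "v + w = t" by (simp add: w_def)
  ultimately have vw: "v = w" using assms(1) by simp
  from e3 show False
  proof
    assume "t = 0"
    hence "v = 0" using vw \<open>v + w = t\<close> by linarith
    thus False using e1 by simp
  next
    assume vw1: "v * w = 1"
    have "s * v = 1 + v\<^sup>2" using e1 by simp
    also have "\<dots> = 2" using vw1 by (simp add: vw power2_eq_square)
    finally have sv: "s * v = 2" .
    have "t * v = v * v + v * w" by (simp add: \<open>v + w = t\<close>[symmetric] algebra_simps)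
    also have "\<dots> = 2" using vw1 by (simp add: vw)
    finally have "(s - t) * v = 0" using sv by (simp add: algebra_simps)
    moreover have "v \<noteq> 0" using sv by auto
    ultimately show False using assms(1) by simp
  qed
qed

text \<open>Since \<open>s\<close> fixes the line of \<open>p\<close>, the different letter
  \<open>t\<close> moves it. Then the two vanishing spreads can only mean that \<open>s\<close> also
  fixes the line of the image under \<open>t\<close>, and that \<open>t\<close> brings this line
  back: the case excluded by \<open>no_invariant_pair\<close>.\<close>

lemma orbit_spread_pos_aux:
  assumes st: "s \<noteq> t" and u: "fst p \<noteq> 0" and 1: "wedge p (shift_map s p) = 0"
    and 2: "spread p (shift_map t p) (shift_map s (shift_map t p)) = 0"
    and 3: "spread p (shift_map t p) (shift_map t (shift_map t p)) = 0"
  shows False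
proof -
  have p0: "p \<noteq> 0" using u by auto
  have w: "wedge p (shift_map t p) \<noteq> 0"
  proof
    assume "wedge p (shift_map t p) = 0"
    from wedge_parallel[OF p0 1 this] show False
      using st u by (simp add: wedge_shift_map_two)
  qed
  have "wedge p (shift_map s (shift_map t p)) \<noteq> 0"
  proof
    assume "wedge p (shift_map s (shift_map t p)) = 0"
    from wedge_parallel[OF p0 1 this] show False using w by simp
  qed
  hence "wedge (shift_map t p) (shift_map s (shift_map t p)) = 0"
    using 2 w by (simp add: spread_def)
  moreover have "wedge p (shift_map t (shift_map t p)) = 0"
    using 3 w by (simp add: spread_def)
  ultimately show False using no_invariant_pair[OF st u 1] by blast
qed

text \<open>On the vertical line both letters act alike, so the two choices differ only one step
  later; the sixth triple covers this. Otherwise the two images of \<open>p\<close> are independent,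
  and the first triple vanishes only if a letter fixes the line of \<open>p\<close>; the auxiliary
  lemma then applies for either letter.\<close>

lemma orbit_spread_pos:
  assumes st: "s \<noteq> t" and p: "p \<noteq> 0"
  shows "orbit_spread p s t s t s t > 0"
proof (rule ccontr)
  have zero: "a = 0 \<and> b = 0 \<and> c = 0 \<and> d = 0 \<and> e = 0 \<and> f = 0"
    if "a \<ge> 0" "b \<ge> 0" "c \<ge> 0" "d \<ge> 0" "e \<ge> 0" "f \<ge> 0" "a + b + c + d + e + f \<le> 0"
    for a b c d e f :: real using that by linarith
  assume "\<not> ?thesis"
  hence z: "spread p (shift_map s p) (shift_map t p) = 0"
    "spread p (shift_map t p) (shift_map s (shift_map t p)) = 0"
    "spread p (shift_map t p) (shift_map t (shift_map t p)) = 0"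
    "spread p (shift_map s p) (shift_map t (shift_map s p)) = 0"
    "spread p (shift_map s p) (shift_map s (shift_map s p)) = 0"
    "spread (shift_map s p) (shift_map s (shift_map s p)) (shift_map t (shift_map s p)) = 0"
    using zero[of "spread p (shift_map s p) (shift_map t p)"
        "spread p (shift_map t p) (shift_map s (shift_map t p))"
        "spread p (shift_map t p) (shift_map t (shift_map t p))"
        "spread p (shift_map s p) (shift_map t (shift_map s p))"
        "spread p (shift_map s p) (shift_map s (shift_map s p))"
        "spread (shift_map s p) (shift_map s (shift_map s p)) (shift_map t (shift_map s p))"]
    unfolding orbit_spread_def not_less by (simp_all only: spread_nonneg simp_thms)
  show False
  proof (cases "fst p = 0")
    case True
    hence "snd p \<noteq> 0" using p by (auto simp: prod_eq_iff)
    thus False using z(6) st True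
      by (simp add: spread_def wedge_shift_map_two) (simp add: wedge_def shift_map_def)
  next
    case False
    hence "wedge (shift_map s p) (shift_map t p) \<noteq> 0"
      using st by (simp add: wedge_shift_map_two)
    hence "wedge p (shift_map s p) = 0 \<or> wedge p (shift_map t p) = 0"
      using z(1) by (simp add: spread_def)
    thus False
    proof
      assume "wedge p (shift_map s p) = 0"
      thus False using orbit_spread_pos_aux[OF st False _ z(2,3)] by blast
    next
      assume "wedge p (shift_map t p) = 0"
      thus False using orbit_spread_pos_aux[OF st[symmetric] False _ z(4,5)] by blast
    qed
  qed
qed

section \<open>Uniformity by compactness\<close>

lemma compact_uniform_lower_bound:
  fixes f :: "'a::metric_space \<times> 'b::heine_borel \<Rightarrow> real"
  assumes K: "compact K" and cont: "continuous_on UNIV f" and pos: "\<And>k. k \<in> K \<Longrightarrow> f (k, c) > 0"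
  shows "\<exists>\<delta>>0. \<exists>r>0. \<forall>k\<in>K. \<forall>z. dist z c < r \<longrightarrow> f (k, z) \<ge> \<delta>"
proof (cases "K = {}")
  case True
  thus ?thesis by (auto intro: exI[of _ 1])
next
  case False
  have "continuous_on K (\<lambda>k. f (k, c))"
    by (rule continuous_on_compose2[OF cont]) (auto intro!: continuous_intros)
  from continuous_attains_inf[OF K False this] obtain k0 where k0: "k0 \<in> K" "\<forall>k\<in>K. f (k0, c) \<le> f (k, c)" by blast
  define \<delta> where "\<delta> = f (k0, c) / 2"
  have d: "\<delta> > 0" using pos[OF k0(1)] by (simp add: \<delta>_def)
  have "uniformly_continuous_on (K \<times> cball c 1) f"
    by (intro compact_uniformly_continuous continuous_on_subset[OF cont] compact_Times K) auto
  then obtain r where r: "r > 0"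
    and uc: "\<And>x y. x \<in> K \<times> cball c 1 \<Longrightarrow> y \<in> K \<times> cball c 1 \<Longrightarrow> dist y x < r \<Longrightarrow> dist (f y) (f x) < \<delta>"
    unfolding uniformly_continuous_on_def using d by blast
  have "f (k, z) \<ge> \<delta>" if k: "k \<in> K" and z: "dist z c < min r 1" for k z
  proof -
    have "dist (f (k, z)) (f (k, c)) < \<delta>"
      using z k by (intro uc) (auto simp: dist_Pair_Pair dist_commute)
    hence "f (k, z) > f (k, c) - \<delta>" by (simp add: dist_real_def abs_less_iff)
    moreover have "f (k, c) \<ge> 2 * \<delta>" using k0 k by (simp add: \<delta>_def)
    ultimately show ?thesis by simp
  qed
  thus ?thesis using d r by (intro exI[of _ \<delta>] conjI exI[of _ "min r 1"]) auto
qed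

lemma dist_Pair_le: "dist (a, b) (c, d) \<le> dist a c + dist b d"
  unfolding dist_Pair_Pair using sqrt_sum_squares_le_sum_abs[of "dist a c" "dist b d"] by simp

lemma continuous_on_shift_map [continuous_intros]:
  "continuous_on A f \<Longrightarrow> continuous_on A g \<Longrightarrow> continuous_on A (\<lambda>x. shift_map (f x) (g x))"
  unfolding shift_map_def by (intro continuous_intros)

lemma continuous_on_spread [continuous_intros]:
  "continuous_on A f \<Longrightarrow> continuous_on A g \<Longrightarrow> continuous_on A h \<Longrightarrow>
    continuous_on A (\<lambda>x. spread (f x) (g x) (h x))"
  unfolding spread_def wedge_def by (intro continuous_intros)

text \<open>The energy and the unit vector together range over a compact set, and the spread is
  continuous in them and in the letters. A tolerance \<open>r / 6\<close> for each of the six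
  letters keeps the total distance below \<open>r\<close>.\<close>

lemma orbit_spread_uniform:
  assumes "x0 \<noteq> y0"
  shows "\<exists>\<delta>>0. \<exists>r>0. \<forall>E p a b aa ba ab bb. \<bar>E\<bar> \<le> B \<longrightarrow> norm p = 1 \<longrightarrow>
    \<bar>a - x0\<bar> < r \<longrightarrow> \<bar>b - y0\<bar> < r \<longrightarrow> \<bar>aa - x0\<bar> < r \<longrightarrow> \<bar>ba - y0\<bar> < r \<longrightarrow> \<bar>ab - x0\<bar> < r \<longrightarrow> \<bar>bb - y0\<bar> < r \<longrightarrow>
    orbit_spread p (E - a) (E - b) (E - aa) (E - ba) (E - ab) (E - bb) \<ge> \<delta>"
proof -
  define f :: "(real \<times> real \<times> real) \<times> (real \<times> real \<times> real \<times> real \<times> real \<times> real) \<Rightarrow> real" where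
    "f = (\<lambda>((E, p), (a, b, aa, ba, ab, bb)).
      orbit_spread p (E - a) (E - b) (E - aa) (E - ba) (E - ab) (E - bb))"
  have "continuous_on UNIV f"
    unfolding f_def orbit_spread_def case_prod_unfold
    by (intro continuous_intros)
  moreover have "compact ({-B..B} \<times> sphere (0 :: real \<times> real) 1)"
    by (intro compact_Times) auto
  moreover have "f (k, (x0, y0, x0, y0, x0, y0)) > 0" if "k \<in> {-B..B} \<times> sphere 0 1" for k
    using that assms by (cases k) (auto simp: f_def intro!: orbit_spread_pos)
  ultimately obtain \<delta> r where d: "\<delta> > 0" "r > 0"
    and bd: "\<And>k z. k \<in> {-B..B} \<times> sphere 0 1 \<Longrightarrow> dist z (x0, y0, x0, y0, x0, y0) < r \<Longrightarrow> f (k, z) \<ge> \<delta>"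
    using compact_uniform_lower_bound[of "{-B..B} \<times> sphere (0 :: real \<times> real) 1" f "(x0, y0, x0, y0, x0, y0)"]
    by blast
  have "orbit_spread p (E - a) (E - b) (E - aa) (E - ba) (E - ab) (E - bb) \<ge> \<delta>"
    if "\<bar>E\<bar> \<le> B" "norm p = 1" and c: "\<bar>a - x0\<bar> < r / 6" "\<bar>b - y0\<bar> < r / 6" "\<bar>aa - x0\<bar> < r / 6"
      "\<bar>ba - y0\<bar> < r / 6" "\<bar>ab - x0\<bar> < r / 6" "\<bar>bb - y0\<bar> < r / 6" for E p a b aa ba ab bb
  proof -
    have "dist (a, b, aa, ba, ab, bb) (x0, y0, x0, y0, x0, y0) \<le>
        dist a x0 + (dist b y0 + (dist aa x0 + (dist ba y0 + (dist ab x0 + dist bb y0))))"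
      by (intro order_trans[OF dist_Pair_le] add_left_mono order_refl)
    also have "\<dots> < r" using c unfolding dist_real_def by linarith
    finally have "f ((E, p), (a, b, aa, ba, ab, bb)) \<ge> \<delta>"
      using that by (intro bd) auto
    thus ?thesis by (simp add: f_def)
  qed
  thus ?thesis using d by (intro exI[of _ \<delta>] conjI exI[of _ "r / 6"]) auto
qed

section \<open>Mean logarithmic growth of a vector\<close>

context random_potential
begin

definition lnn :: "real \<Rightarrow> nat \<Rightarrow> real \<times> real \<Rightarrow> real" where
  "lnn E n p = (\<integral>\<omega>. ln (norm (orb E \<omega> n p)) \<partial>S)"

lemma ln_step_bound_pos: "ln step_bound > 0"
  using step_bound_ge by simp

lemma abs_ln_diff_le:
  assumes "x > 0" "y > 0" "c > 0" "x \<le> c * y" "y \<le> c * x"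
  shows "\<bar>ln x - ln y\<bar> \<le> ln (c :: real)"
proof -
  have "ln x \<le> ln (c * y)" "ln y \<le> ln (c * x)" using assms by (auto intro!: ln_mono)
  thus ?thesis using assms by (simp add: ln_mult abs_le_iff)
qed

lemma abs_ln_norm_orb_le:
  assumes "\<bar>E\<bar> \<le> R + 2" "p \<noteq> 0"
  shows "\<bar>ln (norm (orb E \<omega> n p)) - ln (norm p)\<bar> \<le> real n * ln step_bound"
proof -
  have "\<bar>ln (norm (orb E \<omega> n p)) - ln (norm p)\<bar> \<le> ln (step_bound ^ n)"
    using norm_orb_le[OF assms(1)] norm_orb_ge[OF assms(1)] assms step_bound_ge
    by (intro abs_ln_diff_le) auto
  thus ?thesis using step_bound_ge by (simp add: ln_realpow)
qed

lemma abs_ln_norm_T_le: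
  assumes "\<bar>E\<bar> \<le> R + 2" "p \<noteq> 0"
  shows "\<bar>ln (norm (T E a p)) - ln (norm p)\<bar> \<le> ln step_bound"
  using norm_T_le[OF assms(1)] norm_T_ge[OF assms(1)] assms step_bound_ge
  by (intro abs_ln_diff_le) auto

lemma abs_ln_norm_orb_le':
  assumes "\<bar>E\<bar> \<le> R + 2" "p \<noteq> 0"
  shows "\<bar>ln (norm (orb E \<omega> n p))\<bar> \<le> \<bar>ln (norm p)\<bar> + real n * ln step_bound"
  using abs_ln_norm_orb_le[OF assms, of \<omega> n] by linarith

lemma integrable_ln_norm_orb:
  assumes "\<bar>E\<bar> \<le> R + 2" "p \<noteq> 0"
  shows "integrable S (\<lambda>\<omega>. ln (norm (orb E \<omega> n p)))"
  using abs_ln_norm_orb_le'[OF assms]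
  by (intro S.integrable_const_bound[of _ "\<bar>ln (norm p)\<bar> + real n * ln step_bound"]) auto

lemma integral_S_le:
  assumes "integrable S f" "\<And>\<omega>. f \<omega> \<le> (c :: real)"
  shows "(\<integral>\<omega>. f \<omega> \<partial>S) \<le> c"
proof -
  have "(\<integral>\<omega>. f \<omega> \<partial>S) \<le> (\<integral>\<omega>. c \<partial>S)" using assms by (intro integral_mono) auto
  thus ?thesis by (simp add: S.prob_space)
qed

lemma integral_S_ge:
  assumes "integrable S f" "\<And>\<omega>. f \<omega> \<ge> (c :: real)"
  shows "(\<integral>\<omega>. f \<omega> \<partial>S) \<ge> c"
proof -
  have "(\<integral>\<omega>. f \<omega> \<partial>S) \<ge> (\<integral>\<omega>. c \<partial>S)" using assms by (intro integral_mono) auto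
  thus ?thesis by (simp add: S.prob_space)
qed

lemma lnn_bounds:
  assumes "\<bar>E\<bar> \<le> R + 2" "p \<noteq> 0"
  shows "\<bar>lnn E n p - ln (norm p)\<bar> \<le> real n * ln step_bound"
proof -
  have "ln (norm p) - real n * ln step_bound \<le> lnn E n p"
    unfolding lnn_def using abs_ln_norm_orb_le[OF assms] integrable_ln_norm_orb[OF assms]
    by (intro integral_S_ge) (auto simp: abs_le_iff algebra_simps)
  moreover have "lnn E n p \<le> ln (norm p) + real n * ln step_bound"
    unfolding lnn_def using abs_ln_norm_orb_le[OF assms] integrable_ln_norm_orb[OF assms]
    by (intro integral_S_le) (auto simp: abs_le_iff algebra_simps)
  ultimately show ?thesis by (simp add: abs_le_iff)
qed

lemma lnn_scaleR:
  assumes "\<bar>E\<bar> \<le> R + 2" "p \<noteq> 0" "c > 0"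
  shows "lnn E n (c *\<^sub>R p) = ln c + lnn E n p"
proof -
  have "lnn E n (c *\<^sub>R p) = (\<integral>\<omega>. ln c + ln (norm (orb E \<omega> n p)) \<partial>S)"
    unfolding lnn_def using assms by (simp add: orb_scaleR ln_mult)
  also have "\<dots> = ln c + lnn E n p"
    unfolding lnn_def using integrable_ln_norm_orb[OF assms(1,2)]
    by (subst Bochner_Integration.integral_add) (simp_all add: S.prob_space)
  finally show ?thesis .
qed

lemma lnn_Suc_le:
  assumes "\<bar>E\<bar> \<le> R + 2" "p \<noteq> 0"
  shows "lnn E (Suc n) p \<le> lnn E n p + ln step_bound"
proof -
  have "lnn E (Suc n) p \<le> (\<integral>\<omega>. ln (norm (orb E \<omega> n p)) + ln step_bound \<partial>S)"
    unfolding lnn_def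
  proof (rule integral_mono)
    fix \<omega>
    show "ln (norm (orb E \<omega> (Suc n) p)) \<le> ln (norm (orb E \<omega> n p)) + ln step_bound"
      using abs_ln_norm_T_le[OF assms(1), of "orb E \<omega> n p" "\<omega> n"] assms by (simp add: abs_le_iff)
    show "integrable S (\<lambda>\<omega>. ln (norm (orb E \<omega> (Suc n) p)))"
      by (rule integrable_ln_norm_orb[OF assms])
    show "integrable S (\<lambda>\<omega>. ln (norm (orb E \<omega> n p)) + ln step_bound)"
      using integrable_ln_norm_orb[OF assms] by auto
  qed
  also have "\<dots> = lnn E n p + ln step_bound"
    unfolding lnn_def using integrable_ln_norm_orb[OF assms]
    by (subst Bochner_Integration.integral_add) (simp_all add: S.prob_space)
  finally show ?thesis .
qed

lemma lnn_measurable [measurable]: "lnn E n \<in> borel_measurable borel"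
  unfolding lnn_def[abs_def] by measurable

lemma lnn_first_step:
  assumes "\<bar>E\<bar> \<le> R + 2" "p \<noteq> 0"
  shows "lnn E (Suc n) p = (\<integral>a. lnn E n (T E a p) \<partial>m)"
  unfolding lnn_def
  by (rule integral_first_step[of "\<lambda>p. ln (norm p)" _ _ _ "\<bar>ln (norm p)\<bar> + real (Suc n) * ln step_bound"])
     (use abs_ln_norm_orb_le'[OF assms, of _ "Suc n"] in auto)

text \<open>With \<open>c\<close> the infimum of \<open>lnn E n\<close> over unit vectors, this
  measures how far the direction of \<open>p\<close> is from minimising the mean growth.\<close>

definition excess :: "real \<Rightarrow> nat \<Rightarrow> real \<Rightarrow> real \<times> real \<Rightarrow> real" where
  "excess E n c p = lnn E n p - ln (norm p) - c"

text \<open>The mean excess of the images is at most \<open>C + 2 * ln step_bound\<close>: one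
  logarithm pays for the extra step in \<open>lnn E (Suc n) p\<close>, the other for the norm of the
  image. As the excess is nonnegative, Markov's inequality yields a letter in
  \<open>A\<close>.\<close>

lemma excess_step:
  assumes E: "\<bar>E\<bar> \<le> R + 2" and p: "p \<noteq> 0"
    and pos: "\<And>q. q \<noteq> 0 \<Longrightarrow> excess E n c q \<ge> 0"
    and C: "excess E n c p \<le> C"
    and A: "A \<in> sets m" "prob A \<ge> \<pi>" "\<pi> > 0"
  shows "\<exists>a\<in>A. excess E n c (T E a p) \<le> 2 * (C + 2 * ln step_bound) / \<pi>"
proof -
  let ?f = "\<lambda>a. excess E n c (T E a p)"
  have C0: "C + 2 * ln step_bound > 0"
    using pos[OF p] C ln_step_bound_pos by linarith
  have Tp: "T E a p \<noteq> 0" for a using p by simp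
  have i1: "integrable m (\<lambda>a. lnn E n (T E a p))"
  proof (rule integrable_const_bound[of _ "\<bar>ln (norm p)\<bar> + ln step_bound + real n * ln step_bound"])
    have "\<bar>lnn E n (T E a p)\<bar> \<le> \<bar>ln (norm p)\<bar> + ln step_bound + real n * ln step_bound" for a
      using lnn_bounds[OF E Tp, of n a] abs_ln_norm_T_le[OF E p, of a] by linarith
    thus "AE a in m. norm (lnn E n (T E a p)) \<le> \<bar>ln (norm p)\<bar> + ln step_bound + real n * ln step_bound" by simp
  qed measurable
  have i2: "integrable m (\<lambda>a. ln (norm (T E a p)))"
  proof (rule integrable_const_bound[of _ "\<bar>ln (norm p)\<bar> + ln step_bound"])
    have "\<bar>ln (norm (T E a p))\<bar> \<le> \<bar>ln (norm p)\<bar> + ln step_bound" for a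
      using abs_ln_norm_T_le[OF E p, of a] by linarith
    thus "AE a in m. norm (ln (norm (T E a p))) \<le> \<bar>ln (norm p)\<bar> + ln step_bound" by simp
  qed measurable
  have "(\<integral>a. ln (norm (T E a p)) \<partial>m) \<ge> (\<integral>a. ln (norm p) - ln step_bound \<partial>m)"
  proof (rule integral_mono)
    show "ln (norm p) - ln step_bound \<le> ln (norm (T E a p))" for a
      using abs_ln_norm_T_le[OF E p, of a] by linarith
  qed (use i2 in auto)
  hence l2: "(\<integral>a. ln (norm (T E a p)) \<partial>m) \<ge> ln (norm p) - ln step_bound" by (simp add: prob_space)
  have "(\<integral>a. ?f a \<partial>m) = lnn E (Suc n) p - (\<integral>a. ln (norm (T E a p)) \<partial>m) - c"
    unfolding excess_def lnn_first_step[OF E p] using i1 i2 by (simp add: prob_space)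
  also have "\<dots> \<le> C + 2 * ln step_bound"
    using lnn_Suc_le[OF E p, of n] l2 C unfolding excess_def by linarith
  finally have "(\<integral>a. ?f a \<partial>m) \<le> C + 2 * ln step_bound" .
  moreover have "integrable m ?f" unfolding excess_def using i1 i2 by auto
  moreover have "AE a in m. 0 \<le> ?f a" using pos[OF Tp] by simp
  ultimately have "(\<integral>\<^sup>+a. ennreal (?f a) \<partial>m) \<le> ennreal (C + 2 * ln step_bound)"
    by (simp add: nn_integral_eq_integral ennreal_leI)
  moreover have pA: "prob A > 0" using A(2,3) by linarith
  ultimately obtain a where a: "a \<in> A" "ennreal (?f a) \<le> ennreal (2 * (C + 2 * ln step_bound) / prob A)"
    using exists_le_of_nn_integral_le[OF A(1) _ _ C0] by blast
  have "2 * (C + 2 * ln step_bound) / prob A \<ge> 0" using pA C0 by simp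
  from a(2) this have "?f a \<le> 2 * (C + 2 * ln step_bound) / prob A"
    by (subst (asm) ennreal_le_iff)
  also have "\<dots> \<le> 2 * (C + 2 * ln step_bound) / \<pi>"
    by (rule divide_left_mono[OF A(2)]) (use A(3) pA C0 in simp_all)
  finally show ?thesis using a(1) by blast
qed

text \<open>Both basis vectors are expanded in \<open>p\<close> and \<open>q\<close> by
  \<open>wedge_expand\<close>; a product that is small on two independent vectors is small. The
  factor \<open>2\<close> counts the columns.\<close>

lemma HS_le_pair:
  "\<bar>wedge p q\<bar> * HS E \<omega> n \<le> 2 * (norm q * norm (orb E \<omega> n p) + norm p * norm (orb E \<omega> n q))"
proof -
  let ?X = "orb E \<omega> n"
  have e: "\<bar>wedge p q\<bar> * norm (?X e) \<le> norm q * norm (?X p) + norm p * norm (?X q)" if "norm e = 1" for e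
  proof -
    have "\<bar>wedge p q\<bar> * norm (?X e) = norm (?X (wedge p q *\<^sub>R e))" by (simp add: orb_scaleR)
    also have "wedge p q *\<^sub>R e = wedge e q *\<^sub>R p + (- wedge e p) *\<^sub>R q"
      using wedge_expand[of p q e] by simp
    also have "norm (?X (wedge e q *\<^sub>R p + (- wedge e p) *\<^sub>R q)) \<le> \<bar>wedge e q\<bar> * norm (?X p) + \<bar>wedge e p\<bar> * norm (?X q)"
      unfolding orb_add orb_scaleR by (rule order_trans[OF norm_triangle_ineq]) simp
    also have "\<dots> \<le> norm q * norm (?X p) + norm p * norm (?X q)"
      using abs_wedge_le[of e q] abs_wedge_le[of e p] that by (intro add_mono mult_right_mono) auto
    finally show ?thesis .
  qed
  have "HS E \<omega> n \<le> norm (?X (1, 0)) + norm (?X (0, 1))"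
    unfolding HS_def using norm_le_abs_sum[of "(norm (?X (1, 0)), norm (?X (0, 1)))"] by simp
  hence "\<bar>wedge p q\<bar> * HS E \<omega> n \<le> \<bar>wedge p q\<bar> * norm (?X (1, 0)) + \<bar>wedge p q\<bar> * norm (?X (0, 1))"
    unfolding distrib_left[symmetric] by (rule mult_left_mono) simp
  thus ?thesis using e[of "(1, 0)"] e[of "(0, 1)"] by (simp add: norm_Pair)
qed

text \<open>The contracted direction of a matrix is close to at most one of three separated vectors.\<close>
lemma three_vectors_grow:
  assumes Y: "Y > 0" "\<And>p. p \<in> {p1, p2, p3} \<Longrightarrow> norm p \<le> Y \<and> 1 / Y \<le> norm p"
    and d: "d > 0" "\<bar>wedge p1 p2\<bar> \<ge> d" "\<bar>wedge p1 p3\<bar> \<ge> d" "\<bar>wedge p2 p3\<bar> \<ge> d"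
  shows "ln (norm (orb E \<omega> n p1)) + ln (norm (orb E \<omega> n p2)) + ln (norm (orb E \<omega> n p3))
    \<ge> ln (HS E \<omega> n) + (2 * ln (d / (4 * Y)) - ln Y)"
proof -
  let ?X = "orb E \<omega> n" and ?h = "HS E \<omega> n"
  have h: "?h \<ge> 1" by (rule HS_ge_1)
  \<comment> \<open>Two vectors both below \<open>c * ?h\<close> would give at most
    \<open>4 * Y * c * ?h = d * ?h\<close> in \<open>HS_le_pair\<close>, strictly.\<close>
  define c where "c = d / (4 * Y)"
  have c: "c > 0" using d Y by (simp add: c_def)
  have pair: "norm (?X p) \<ge> c * ?h \<or> norm (?X q) \<ge> c * ?h"
    if "p \<in> {p1, p2, p3}" "q \<in> {p1, p2, p3}" "\<bar>wedge p q\<bar> \<ge> d" for p q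
  proof (rule ccontr)
    assume "\<not> ?thesis"
    hence lt: "norm (?X p) < c * ?h" "norm (?X q) < c * ?h" by auto
    have "d * ?h \<le> \<bar>wedge p q\<bar> * ?h" using that h by (intro mult_right_mono) auto
    also have "\<dots> \<le> 2 * (norm q * norm (?X p) + norm p * norm (?X q))" by (rule HS_le_pair)
    also have "\<dots> \<le> 2 * (Y * norm (?X p) + Y * norm (?X q))"
      using Y that by (intro mult_left_mono add_mono mult_right_mono) auto
    also have "\<dots> < 2 * (Y * (c * ?h) + Y * (c * ?h))"
      using lt Y by (intro mult_strict_left_mono add_strict_mono) auto
    also have "\<dots> = d * ?h" using Y by (simp add: c_def)
    finally show False by simp
  qed
  have low: "norm (?X p) \<ge> 1 / (Y * ?h)" if "p \<in> {p1, p2, p3}" for p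
  proof -
    have "1 / Y \<le> ?h * norm (?X p)"
      using Y(2)[OF that] norm_le_HS_orb[of p E \<omega> n] by linarith
    thus ?thesis using Y(1) h by (simp add: field_simps)
  qed
  have big: "ln (norm (?X p)) \<ge> ln c + ln ?h" if "norm (?X p) \<ge> c * ?h" for p
  proof -
    have "ln (norm (?X p)) \<ge> ln (c * ?h)" using that c h by (intro ln_mono) auto
    thus ?thesis using c h by (simp add: ln_mult)
  qed
  have small: "ln (norm (?X p)) \<ge> - ln Y - ln ?h" if "p \<in> {p1, p2, p3}" for p
  proof -
    have "ln (norm (?X p)) \<ge> ln (1 / (Y * ?h))" using low[OF that] Y(1) h by (intro ln_mono) auto
    thus ?thesis using Y(1) h by (simp add: ln_div ln_mult)
  qed
  have s: "ln (norm (?X p1)) \<ge> - ln Y - ln ?h" "ln (norm (?X p2)) \<ge> - ln Y - ln ?h"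
    "ln (norm (?X p3)) \<ge> - ln Y - ln ?h" using small by auto
  \<comment> \<open>Two vectors contribute \<open>ln ?h\<close> each and the third loses at most
    \<open>ln ?h\<close>, so one \<open>ln ?h\<close> survives.\<close>
  consider "norm (?X p1) \<ge> c * ?h" "norm (?X p2) \<ge> c * ?h"
    | "norm (?X p1) \<ge> c * ?h" "norm (?X p3) \<ge> c * ?h"
    | "norm (?X p2) \<ge> c * ?h" "norm (?X p3) \<ge> c * ?h"
    using pair[of p1 p2] pair[of p1 p3] pair[of p2 p3] d by auto
  thus ?thesis unfolding c_def[symmetric]
  proof cases
    case 1 from big[OF 1(1)] big[OF 1(2)] s show "ln (norm (?X p1)) + ln (norm (?X p2)) + ln (norm (?X p3))
      \<ge> ln ?h + (2 * ln c - ln Y)" by linarith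
  next
    case 2 from big[OF 2(1)] big[OF 2(2)] s show "ln (norm (?X p1)) + ln (norm (?X p2)) + ln (norm (?X p3))
      \<ge> ln ?h + (2 * ln c - ln Y)" by linarith
  next
    case 3 from big[OF 3(1)] big[OF 3(2)] s show "ln (norm (?X p1)) + ln (norm (?X p2)) + ln (norm (?X p3))
      \<ge> ln ?h + (2 * ln c - ln Y)" by linarith
  qed
qed

text \<open>The tolerance \<open>1\<close> stands in for attaining the infimum; scaling extends the
  lower bound from unit vectors to all nonzero ones.\<close>

lemma exists_near_minimal:
  assumes E: "\<bar>E\<bar> \<le> R + 2"
  shows "\<exists>c p. norm p = 1 \<and> excess E n c p \<le> 1 \<and> (\<forall>q. q \<noteq> 0 \<longrightarrow> excess E n c q \<ge> 0)"
proof -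
  let ?A = "lnn E n ` {p. norm p = 1}"
  have "(1, 0) \<in> {p :: real \<times> real. norm p = 1}" by (simp add: norm_Pair)
  hence ne: "?A \<noteq> {}" by blast
  have bdd: "bdd_below ?A"
  proof (rule bdd_belowI2[of _ "- (real n * ln step_bound)"])
    fix p :: "real \<times> real" assume "p \<in> {p. norm p = 1}"
    hence "norm p = 1" "p \<noteq> 0" by auto
    thus "- (real n * ln step_bound) \<le> lnn E n p"
      using lnn_bounds[OF E, of p n] by (simp add: abs_le_iff)
  qed
  define c where "c = Inf ?A"
  obtain p where p: "norm p = 1" "lnn E n p < c + 1"
    using cInf_lessD[OF ne, of "c + 1"] by (auto simp: c_def)
  have "excess E n c q \<ge> 0" if q: "q \<noteq> 0" for q
  proof -
    have "q = norm q *\<^sub>R ((1 / norm q) *\<^sub>R q)" using q by simp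
    hence "lnn E n q = ln (norm q) + lnn E n ((1 / norm q) *\<^sub>R q)"
      using lnn_scaleR[OF E, of "(1 / norm q) *\<^sub>R q" "norm q" n] q by simp
    moreover have "c \<le> lnn E n ((1 / norm q) *\<^sub>R q)"
      unfolding c_def using q by (intro cInf_lower bdd imageI) simp
    ultimately show ?thesis by (simp add: excess_def)
  qed
  moreover have "excess E n c p \<le> 1" using p by (simp add: excess_def)
  ultimately show ?thesis using p(1) by blast
qed

end

section \<open>Uniform drift and projective contraction\<close>

text \<open>For negative \<open>x\<close> the quadratic lower bound for \<open>exp y\<close> at
  \<open>y = - x\<close> is inverted, using that
  \<open>(1 - y + y\<^sup>2) * (1 + y + y\<^sup>2 / 2)\<close> is at least \<open>1\<close>.\<close>

lemma exp_le_quadratic: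
  fixes x :: real
  assumes "\<bar>x\<bar> \<le> 1"
  shows "exp x \<le> 1 + x + x\<^sup>2"
proof (cases "x \<ge> 0")
  case True
  thus ?thesis using assms by (intro exp_bound) auto
next
  case False
  define y where "y = - x"
  have y: "y \<ge> 0" using False by (simp add: y_def)
  have q: "1 + y + y\<^sup>2 / 2 \<le> exp y" by (rule exp_lower_Taylor_quadratic[OF y])
  have nn: "1 - y + y\<^sup>2 \<ge> 0"
  proof -
    have "1 - y + y\<^sup>2 = (y - 1/2)\<^sup>2 + 3/4" by (simp add: power2_eq_square algebra_simps)
    thus ?thesis by simp
  qed
  have "1 \<le> 1 + y\<^sup>2 / 2 + y ^ 3 / 2 + y ^ 4 / 2" using y by simp
  also have "\<dots> = (1 - y + y\<^sup>2) * (1 + y + y\<^sup>2 / 2)"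
    by (simp add: power2_eq_square power3_eq_cube power4_eq_xxxx field_simps)
  also have "\<dots> \<le> (1 - y + y\<^sup>2) * exp y" by (intro mult_left_mono q nn)
  finally have "exp (- y) * 1 \<le> exp (- y) * ((1 - y + y\<^sup>2) * exp y)"
    by (intro mult_left_mono) auto
  also have "\<dots> = 1 - y + y\<^sup>2" by (simp add: exp_minus)
  finally show ?thesis by (simp add: y_def)
qed

text \<open>A share \<open>x / (a + b)\<close> does not decrease when raised to a power
  \<open>s \<le> 1\<close>, and the shares of \<open>a\<close> and \<open>b\<close> sum to
  \<open>1\<close>.\<close>

lemma add_powr_le:
  fixes a b s :: real
  assumes "0 \<le> a" "0 \<le> b" "0 < s" "s \<le> 1"
  shows "(a + b) powr s \<le> a powr s + b powr s"
proof (cases "a + b = 0")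
  case True
  thus ?thesis using assms by simp
next
  case False
  hence pos: "a + b > 0" using assms by linarith
  have le: "x / (a + b) * (a + b) powr s \<le> x powr s" if "0 \<le> x" "x \<le> a + b" for x
  proof -
    have "x / (a + b) = (x / (a + b)) powr 1" using that pos by simp
    also have "\<dots> \<le> (x / (a + b)) powr s" using that pos assms by (intro powr_mono') auto
    finally have "x / (a + b) * (a + b) powr s \<le> (x / (a + b)) powr s * (a + b) powr s"
      by (intro mult_right_mono) auto
    also have "\<dots> = x powr s" using that pos by (simp add: powr_divide)
    finally show ?thesis .
  qed
  have "(a + b) powr s = a / (a + b) * (a + b) powr s + b / (a + b) * (a + b) powr s"
    using pos by (simp add: add_divide_distrib[symmetric] distrib_right[symmetric])
  also have "\<dots> \<le> a powr s + b powr s" using assms by (intro add_mono le) auto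
  finally show ?thesis .
qed

text \<open>The sine of the angle between two lines.\<close>
definition pdist :: "real \<times> real \<Rightarrow> real \<times> real \<Rightarrow> real" where
  "pdist p q = \<bar>wedge p q\<bar> / (norm p * norm q)"

lemma pdist_nonneg: "pdist p q \<ge> 0"
  by (simp add: pdist_def)

lemma pdist_le_1: "pdist p q \<le> 1"
  using abs_wedge_le[of p q] by (auto simp: pdist_def divide_le_eq_1)

lemma pdist_powr_le_1: "0 < s \<Longrightarrow> pdist p q powr s \<le> 1"
  using powr_mono2[of s "pdist p q" 1] pdist_nonneg[of p q] pdist_le_1[of p q] by simp

lemma pdist_self [simp]: "pdist p p = 0"
  by (simp add: pdist_def wedge_def)

text \<open>Take norms in \<open>wedge_expand\<close> and divide by the product of the three
  norms.\<close>

lemma pdist_triangle: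
  assumes "p \<noteq> 0" "q \<noteq> 0" "r \<noteq> 0"
  shows "pdist p r \<le> pdist p q + pdist q r"
proof -
  have "\<bar>wedge p r\<bar> * norm q = norm (wedge q r *\<^sub>R p - wedge q p *\<^sub>R r)"
    using wedge_expand[of p r q] by (metis norm_scaleR)
  also have "\<dots> \<le> \<bar>wedge q r\<bar> * norm p + \<bar>wedge p q\<bar> * norm r"
    using norm_triangle_ineq4[of "wedge q r *\<^sub>R p" "wedge q p *\<^sub>R r"]
    by (simp add: wedge_commute[of p q])
  finally have "\<bar>wedge p r\<bar> * norm q / (norm p * norm q * norm r) \<le>
      (\<bar>wedge q r\<bar> * norm p + \<bar>wedge p q\<bar> * norm r) / (norm p * norm q * norm r)"
    by (intro divide_right_mono) auto
  thus ?thesis using assms by (simp add: pdist_def add_divide_distrib ac_simps)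
qed

lemma pdist_measurable [measurable (raw)]:
  assumes [measurable]: "f \<in> borel_measurable M" "g \<in> borel_measurable M"
  shows "(\<lambda>x. pdist (f x) (g x)) \<in> borel_measurable M"
  unfolding pdist_def by measurable

text \<open>With the sign that makes the inner product nonnegative, it lies in \<open>[0, 1]\<close>
  and dominates its square, so the squared distance is at most
  \<open>2 * (wedge p q)\<^sup>2\<close>.\<close>

lemma unit_vectors_close:
  assumes "norm p = 1" "norm q = 1"
  shows "\<exists>q'\<in>{q, - q}. norm (p - q') \<le> 2 * \<bar>wedge p q\<bar>"
proof -
  define q' where "q' = (if inner p q \<ge> 0 then q else - q)"
  have q': "norm q' = 1" "inner p q' = \<bar>inner p q\<bar>" "(wedge p q')\<^sup>2 = (wedge p q)\<^sup>2"
    using assms by (auto simp: q'_def wedge_def power2_eq_square algebra_simps)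
  have id: "(inner p q')\<^sup>2 + (wedge p q')\<^sup>2 = (norm p)\<^sup>2 * (norm q')\<^sup>2"
    by (cases p, cases q') (simp add: wedge_def norm_Pair power2_eq_square algebra_simps)
  have "inner p q' \<le> 1" using norm_cauchy_schwarz[of p q'] assms q' by simp
  hence "(inner p q')\<^sup>2 \<le> inner p q'"
    unfolding power2_eq_square by (rule mult_left_le) (use q'(2) in linarith)
  have "(norm (p - q'))\<^sup>2 = (norm p)\<^sup>2 + (norm q')\<^sup>2 - 2 * inner p q'"
    by (simp add: power2_norm_eq_inner inner_diff inner_commute)
  also have "\<dots> \<le> 2 - 2 * (inner p q')\<^sup>2" using \<open>(inner p q')\<^sup>2 \<le> inner p q'\<close> assms q' by simp
  also have "\<dots> = 2 * (wedge p q)\<^sup>2" using id assms q' by simp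
  also have "\<dots> \<le> (2 * \<bar>wedge p q\<bar>)\<^sup>2" by (simp add: power2_eq_square)
  finally have "norm (p - q') \<le> 2 * \<bar>wedge p q\<bar>" by (rule power2_le_imp_le) simp
  thus ?thesis by (auto simp: q'_def split: if_splits)
qed

context random_potential
begin

theorem uniform_drift:
  "\<exists>n. \<forall>E p. \<bar>E\<bar> \<le> R + 2 \<longrightarrow> p \<noteq> 0 \<longrightarrow> lnn E n p \<ge> 1 + ln (norm p)"
proof -
  obtain \<delta> r where d: "\<delta> > 0" and r: "r > 0"
    and spread: "\<And>E p a b aa ba ab bb. \<bar>E\<bar> \<le> R + 2 \<Longrightarrow> norm p = 1 \<Longrightarrow>
      \<bar>a - x0\<bar> < r \<Longrightarrow> \<bar>b - y0\<bar> < r \<Longrightarrow> \<bar>aa - x0\<bar> < r \<Longrightarrow> \<bar>ba - y0\<bar> < r \<Longrightarrow> \<bar>ab - x0\<bar> < r \<Longrightarrow> \<bar>bb - y0\<bar> < r \<Longrightarrow>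
      orbit_spread p (E - a) (E - b) (E - aa) (E - ba) (E - ab) (E - bb) \<ge> \<delta>"
    using orbit_spread_uniform[of x0 y0 "R + 2"] x0_less_y0 by auto
  define \<pi> where "\<pi> = min (prob (ball x0 r)) (prob (ball y0 r))"
  have pi: "\<pi> > 0" using prob_x0[OF r] prob_y0[OF r] by (simp add: \<pi>_def)
  define \<gamma> where "\<gamma> = ln step_bound"
  have ga: "\<gamma> > 0" using ln_step_bound_pos by (simp add: \<gamma>_def)
  \<comment> \<open>Bounds for the excess after one and after two steps, as
    \<open>excess_step\<close> returns them from a start of excess at most \<open>1\<close>.\<close>
  define C1 where "C1 = 2 * (1 + 2 * \<gamma>) / \<pi>"
  define C2 where "C2 = 2 * (C1 + 2 * \<gamma>) / \<pi>"
  have C: "C1 \<ge> 0" "C2 \<ge> 0" using pi ga by (auto simp: C1_def C2_def)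
  define C where "C = 1 + C1 + C2"
  define Y where "Y = step_bound ^ 2"
  have Y: "Y \<ge> 1" using step_bound_ge by (simp add: Y_def one_le_power)
  \<comment> \<open>One of the six triples has spread at least \<open>\<delta> / 6\<close>. Norms
    after at most two steps are bounded by \<open>Y\<close>, so two of its factors are at most
    \<open>Y\<^sup>2\<close> each, which leaves \<open>d0\<close> for the third.\<close>
  define d0 where "d0 = \<delta> / 6 / Y ^ 4"
  have d0: "d0 > 0" using d Y by (simp add: d0_def)
  define K where "K = 2 * ln (d0 / (4 * Y)) - ln Y"
  \<comment> \<open>The total mean growth of three good vectors, at most
    \<open>3 * (c + C + ln Y)\<close>, will dominate this integral plus \<open>K\<close>; the bound
    is chosen so that \<open>c \<ge> 1\<close> follows.\<close>
  obtain n where n: "\<And>E. \<bar>E\<bar> \<le> R + 2 \<Longrightarrow> (\<integral>\<omega>. ln (HS E \<omega> n) \<partial>S) \<ge> 3 + 3 * C + 3 * ln Y - K"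
    using log_HS_unbounded by blast
  have "lnn E n q \<ge> 1 + ln (norm q)" if E: "\<bar>E\<bar> \<le> R + 2" and q: "q \<noteq> 0" for E q
  proof -
    obtain c p where p: "norm p = 1" and cp: "excess E n c p \<le> 1"
      and pos: "\<And>q. q \<noteq> 0 \<Longrightarrow> excess E n c q \<ge> 0"
      using exists_near_minimal[OF E, of n] by blast
    define good where "good v \<longleftrightarrow> norm v \<le> Y \<and> 1 / Y \<le> norm v \<and> excess E n c v \<le> C" for v
    have three: "c \<ge> 1" if g: "good p1" "good p2" "good p3" and sp: "spread p1 p2 p3 \<ge> \<delta> / 6" for p1 p2 p3
    proof -
      have wY: "\<bar>wedge v w\<bar> \<le> Y\<^sup>2" if "good v" "good w" for v w
      proof -
        have "\<bar>wedge v w\<bar> \<le> norm v * norm w" by (rule abs_wedge_le)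
        also have "\<dots> \<le> Y * Y" using that Y by (intro mult_mono) (auto simp: good_def)
        finally show ?thesis by (simp add: power2_eq_square)
      qed
      have low: "d0 \<le> x" if "\<delta> / 6 \<le> x * y * z" "0 \<le> x" "0 \<le> y" "0 \<le> z" "y \<le> Y\<^sup>2" "z \<le> Y\<^sup>2" for x y z
      proof -
        have "x * y * z \<le> x * Y\<^sup>2 * Y\<^sup>2" using that by (intro mult_mono) auto
        hence "\<delta> / 6 \<le> x * Y ^ 4" using that(1) by (simp add: power2_eq_square power4_eq_xxxx ac_simps)
        thus ?thesis using Y by (simp add: d0_def divide_le_eq)
      qed
      have w: "\<bar>wedge p1 p2\<bar> \<ge> d0" "\<bar>wedge p1 p3\<bar> \<ge> d0" "\<bar>wedge p2 p3\<bar> \<ge> d0"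
        using low[of "\<bar>wedge p1 p2\<bar>" "\<bar>wedge p1 p3\<bar>" "\<bar>wedge p2 p3\<bar>"]
          low[of "\<bar>wedge p1 p3\<bar>" "\<bar>wedge p1 p2\<bar>" "\<bar>wedge p2 p3\<bar>"]
          low[of "\<bar>wedge p2 p3\<bar>" "\<bar>wedge p1 p2\<bar>" "\<bar>wedge p1 p3\<bar>"]
          sp wY[OF g(1,2)] wY[OF g(1,3)] wY[OF g(2,3)] unfolding spread_def
        by (simp_all add: ac_simps)
      have "1 / Y > 0" using Y by simp
      hence nz: "p1 \<noteq> 0" "p2 \<noteq> 0" "p3 \<noteq> 0" using g by (auto simp: good_def)
      note int = integrable_ln_norm_orb[OF E nz(1), of n] integrable_ln_norm_orb[OF E nz(2), of n]
        integrable_ln_norm_orb[OF E nz(3), of n]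
      have "(\<integral>\<omega>. ln (HS E \<omega> n) + K \<partial>S) \<le>
          (\<integral>\<omega>. ln (norm (orb E \<omega> n p1)) + ln (norm (orb E \<omega> n p2)) + ln (norm (orb E \<omega> n p3)) \<partial>S)"
      proof (rule integral_mono)
        fix \<omega>
        show "ln (HS E \<omega> n) + K \<le>
          ln (norm (orb E \<omega> n p1)) + ln (norm (orb E \<omega> n p2)) + ln (norm (orb E \<omega> n p3))"
          unfolding K_def using Y d0 w g
          by (intro three_vectors_grow[of Y p1 p2 p3 d0]) (auto simp: good_def)
      qed (use int ln_HS_integrable[OF E] in auto)
      hence "(\<integral>\<omega>. ln (HS E \<omega> n) \<partial>S) + K \<le> lnn E n p1 + lnn E n p2 + lnn E n p3"
        unfolding lnn_def using int ln_HS_integrable[OF E, of n] by (simp add: S.prob_space)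
      moreover have "lnn E n v \<le> c + C + ln Y" if "good v" "v \<noteq> 0" for v
      proof -
        have "ln (norm v) \<le> ln Y" using that by (intro ln_mono) (auto simp: good_def)
        thus ?thesis using that by (simp add: good_def excess_def)
      qed
      ultimately have "(\<integral>\<omega>. ln (HS E \<omega> n) \<partial>S) + K \<le> 3 * (c + C + ln Y)"
        using g nz by (smt (verit))
      thus ?thesis using n[OF E] by simp
    qed
    have step: "\<exists>a\<in>ball z r. excess E n c (T E a v) \<le> 2 * (C' + 2 * \<gamma>) / \<pi>"
      if z: "z = x0 \<or> z = y0" and v: "v \<noteq> 0" "excess E n c v \<le> C'" for z v C'
    proof -
      have "prob (ball z r) \<ge> \<pi>" using z by (auto simp: \<pi>_def)
      thus ?thesis unfolding \<gamma>_def using v pi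
        by (intro excess_step[OF E _ pos]) auto
    qed
    have p0: "p \<noteq> 0" using p by auto
    obtain a where a: "a \<in> ball x0 r" "excess E n c (T E a p) \<le> C1"
      using step[OF _ p0 cp, of x0] unfolding C1_def by auto
    obtain b where b: "b \<in> ball y0 r" "excess E n c (T E b p) \<le> C1"
      using step[OF _ p0 cp, of y0] unfolding C1_def by auto
    have pa: "T E a p \<noteq> 0" and pb: "T E b p \<noteq> 0" using p0 by auto
    obtain aa where aa: "aa \<in> ball x0 r" "excess E n c (T E aa (T E a p)) \<le> C2"
      using step[OF _ pa a(2), of x0] unfolding C2_def by auto
    obtain ba where ba: "ba \<in> ball y0 r" "excess E n c (T E ba (T E a p)) \<le> C2"
      using step[OF _ pa a(2), of y0] unfolding C2_def by auto
    obtain ab where ab: "ab \<in> ball x0 r" "excess E n c (T E ab (T E b p)) \<le> C2"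
      using step[OF _ pb b(2), of x0] unfolding C2_def by auto
    obtain bb where bb: "bb \<in> ball y0 r" "excess E n c (T E bb (T E b p)) \<le> C2"
      using step[OF _ pb b(2), of y0] unfolding C2_def by auto
    have n1: "norm (T E x p) \<le> step_bound" "1 \<le> step_bound * norm (T E x p)" for x
      using norm_T_le[OF E, of x p] norm_T_ge[OF E, of p x] p by auto
    have n2: "norm (T E y (T E x p)) \<le> Y" "1 \<le> Y * norm (T E y (T E x p))" for x y
    proof -
      have "norm (T E y (T E x p)) \<le> step_bound * norm (T E x p)" by (rule norm_T_le[OF E])
      also have "\<dots> \<le> step_bound * step_bound" using n1[of x] step_bound_ge by (intro mult_left_mono) auto
      finally show "norm (T E y (T E x p)) \<le> Y" by (simp add: Y_def power2_eq_square)
      have "1 \<le> step_bound * norm (T E x p)" by (rule n1)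
      also have "\<dots> \<le> step_bound * (step_bound * norm (T E y (T E x p)))"
        using step_bound_ge by (intro mult_left_mono norm_T_ge[OF E]) auto
      finally show "1 \<le> Y * norm (T E y (T E x p))" by (simp add: Y_def power2_eq_square ac_simps)
    qed
    have sY: "step_bound \<le> Y"
      using mult_left_mono[of 1 step_bound step_bound] step_bound_ge by (simp add: Y_def power2_eq_square)
    have n1': "norm (T E x p) \<le> Y" "1 \<le> Y * norm (T E x p)" for x
    proof -
      show "norm (T E x p) \<le> Y" using n1[of x] sY by linarith
      have "step_bound * norm (T E x p) \<le> Y * norm (T E x p)" using sY by (intro mult_right_mono) auto
      thus "1 \<le> Y * norm (T E x p)" using n1[of x] by linarith
    qed
    have goodI: "good v" if "norm v \<le> Y" "1 \<le> Y * norm v" "excess E n c v \<le> C" for v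
      unfolding good_def using that Y by (simp add: divide_le_eq mult.commute)
    have good: "good p" "good (T E a p)" "good (T E b p)" "good (T E aa (T E a p))"
      "good (T E ba (T E a p))" "good (T E ab (T E b p))" "good (T E bb (T E b p))"
      using p cp a(2) b(2) aa(2) ba(2) ab(2) bb(2) C Y n1' n2 by (auto intro!: goodI simp: C_def)
    have "orbit_spread p (E - clip R a) (E - clip R b) (E - clip R aa) (E - clip R ba)
        (E - clip R ab) (E - clip R bb) \<ge> \<delta>"
      by (intro spread E p clip_ball a b aa ba ab bb x0_le y0_le)
    hence "spread p (T E a p) (T E b p) \<ge> \<delta> / 6 \<or> spread p (T E b p) (T E ab (T E b p)) \<ge> \<delta> / 6
      \<or> spread p (T E b p) (T E bb (T E b p)) \<ge> \<delta> / 6 \<or> spread p (T E a p) (T E ba (T E a p)) \<ge> \<delta> / 6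
      \<or> spread p (T E a p) (T E aa (T E a p)) \<ge> \<delta> / 6
      \<or> spread (T E a p) (T E aa (T E a p)) (T E ba (T E a p)) \<ge> \<delta> / 6"
      unfolding orbit_spread_def by linarith
    hence "c \<ge> 1" using three good by blast
    thus ?thesis using pos[OF q] by (simp add: excess_def)
  qed
  thus ?thesis by blast
qed

text \<open>The wedge is preserved, so the distance is divided by the growth factors of both
  vectors.\<close>

lemma pdist_orb:
  assumes "p \<noteq> 0" "q \<noteq> 0"
  shows "pdist (orb E \<omega> n p) (orb E \<omega> n q) = pdist p q *
    exp (- (ln (norm (orb E \<omega> n p)) - ln (norm p)) - (ln (norm (orb E \<omega> n q)) - ln (norm q)))"
  using assms by (simp add: pdist_def exp_diff exp_minus exp_add field_simps)

text \<open>An exponential moment estimate: the log growth \<open>Z\<close> is bounded by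
  \<open>B\<close> and has mean at least \<open>1\<close>, so for small \<open>s\<close> the mean of
  \<open>exp (- s * Z)\<close> is at most
  \<open>1 - s + s\<^sup>2 * B\<^sup>2 \<le> 1 - s / 2\<close>.\<close>

theorem uniform_contraction:
  "\<exists>n s \<rho>. 0 < s \<and> s \<le> 1 \<and> 0 < \<rho> \<and> \<rho> < 1 \<and> (n :: nat) > 0 \<and>
    (\<forall>E p q. \<bar>E\<bar> \<le> R + 2 \<longrightarrow> p \<noteq> 0 \<longrightarrow> q \<noteq> 0 \<longrightarrow>
      (\<integral>\<omega>. pdist (orb E \<omega> n p) (orb E \<omega> n q) powr s \<partial>S) \<le> \<rho> * pdist p q powr s)"
proof -
  obtain n where n: "\<And>E p. \<bar>E\<bar> \<le> R + 2 \<Longrightarrow> p \<noteq> 0 \<Longrightarrow> lnn E n p \<ge> 1 + ln (norm p)"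
    using uniform_drift by blast
  have npos: "n > 0"
  proof (rule ccontr)
    assume "\<not> n > 0"
    moreover have "(1, 0) \<noteq> (0 :: real \<times> real)" by (simp add: zero_prod_def)
    ultimately show False using n[of 0 "(1, 0)"] R_nonneg by (simp add: lnn_def norm_Pair S.prob_space)
  qed
  define B where "B = real n * ln step_bound"
  have B: "B \<ge> 0" using ln_step_bound_pos by (simp add: B_def)
  \<comment> \<open>Small enough for \<open>s * B \<le> 1\<close>, the range of
    \<open>exp_le_quadratic\<close>, and for \<open>s * B\<^sup>2 \<le> 1/2\<close>, which leaves
    half of the drift.\<close>
  define s where "s = 1 / (2 * B\<^sup>2 + 2)"
  have s: "0 < s" "s \<le> 1" by (auto simp: s_def add_pos_nonneg add_nonneg_pos)
  have sB: "s * B \<le> 1"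
  proof -
    have "0 \<le> (B - 1)\<^sup>2" by simp
    hence "2 * B \<le> B\<^sup>2 + 1" by (simp add: power2_eq_square algebra_simps)
    hence "B \<le> 2 * B\<^sup>2 + 2" using B zero_le_power2[of B] by linarith
    thus ?thesis by (simp add: s_def divide_le_eq add_nonneg_pos)
  qed
  have sB2: "s * B\<^sup>2 \<le> 1 / 2"
    by (simp add: s_def divide_le_eq add_nonneg_pos)
  define Z where "Z E p \<omega> = ln (norm (orb E \<omega> n p)) - ln (norm p)" for E p \<omega>
  have Z: "\<bar>Z E p \<omega>\<bar> \<le> B" if "\<bar>E\<bar> \<le> R + 2" "p \<noteq> 0" for E p \<omega>
    using abs_ln_norm_orb_le[OF that] by (simp add: Z_def B_def)
  have Zm [measurable]: "Z E p \<in> borel_measurable S" for E p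
    unfolding Z_def[abs_def] by measurable
  have iE: "integrable S (\<lambda>\<omega>. exp (- s * Z E p \<omega>))" if E: "\<bar>E\<bar> \<le> R + 2" "p \<noteq> 0" for E p
  proof (rule S.integrable_const_bound[of _ "exp 1"])
    have "- s * Z E p \<omega> \<le> 1" for \<omega>
    proof -
      have "s * \<bar>Z E p \<omega>\<bar> \<le> s * B" using Z[OF E, of \<omega>] s by (intro mult_left_mono) auto
      moreover have "- s * Z E p \<omega> \<le> s * \<bar>Z E p \<omega>\<bar>"
        using s abs_ge_minus_self[of "s * Z E p \<omega>"] by (simp add: abs_mult)
      ultimately show ?thesis using sB by linarith
    qed
    thus "AE \<omega> in S. norm (exp (- s * Z E p \<omega>)) \<le> exp 1" by simp
  qed measurable
  have EZ: "(\<integral>\<omega>. exp (- s * Z E p \<omega>) \<partial>S) \<le> 1 - s / 2" if E: "\<bar>E\<bar> \<le> R + 2" "p \<noteq> 0" for E p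
  proof -
    have iZ: "integrable S (Z E p)"
      unfolding Z_def[abs_def] using integrable_ln_norm_orb[OF E] by auto
    have "(\<integral>\<omega>. exp (- s * Z E p \<omega>) \<partial>S) \<le> (\<integral>\<omega>. (1 + s / 2) - s * Z E p \<omega> \<partial>S)"
    proof (rule integral_mono)
      fix \<omega>
      have "s * \<bar>Z E p \<omega>\<bar> \<le> s * B" using Z[OF E, of \<omega>] s by (intro mult_left_mono) auto
      hence "s * \<bar>Z E p \<omega>\<bar> \<le> 1" using sB by linarith
      hence "\<bar>- s * Z E p \<omega>\<bar> \<le> 1" using s by (simp add: abs_mult)
      hence "exp (- s * Z E p \<omega>) \<le> 1 + - s * Z E p \<omega> + (- s * Z E p \<omega>)\<^sup>2"
        by (rule exp_le_quadratic)
      also have "(- s * Z E p \<omega>)\<^sup>2 \<le> s / 2"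
      proof -
        have "(- s * Z E p \<omega>)\<^sup>2 = s * (s * \<bar>Z E p \<omega>\<bar>\<^sup>2)" by (simp add: power2_eq_square)
        also have "\<dots> \<le> s * (s * B\<^sup>2)"
          using Z[OF E, of \<omega>] s by (intro mult_left_mono power_mono) auto
        also have "\<dots> \<le> s * (1 / 2)" using sB2 s by (intro mult_left_mono) auto
        finally show ?thesis by simp
      qed
      finally show "exp (- s * Z E p \<omega>) \<le> (1 + s / 2) - s * Z E p \<omega>" by simp
    qed (use iE[OF E] iZ in auto)
    also have "\<dots> = (1 + s / 2) - s * (\<integral>\<omega>. Z E p \<omega> \<partial>S)"
      using iZ by (subst Bochner_Integration.integral_diff) (simp_all add: S.prob_space)
    also have "(\<integral>\<omega>. Z E p \<omega> \<partial>S) = lnn E n p - ln (norm p)"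
      unfolding Z_def lnn_def using integrable_ln_norm_orb[OF E] by (simp add: S.prob_space)
    also have "(1 + s / 2) - s * (lnn E n p - ln (norm p)) \<le> (1 + s / 2) - s * 1"
      using n[OF E] s by (intro diff_left_mono mult_left_mono) auto
    finally show ?thesis by simp
  qed
  \<comment> \<open>Half the exponent, because the factors of \<open>p\<close> and \<open>q\<close>
    are dependent; they are separated by
    \<open>x * y \<le> (x\<^sup>2 + y\<^sup>2) / 2\<close>.\<close>
  define \<sigma> where "\<sigma> = s / 2"
  have "(\<integral>\<omega>. pdist (orb E \<omega> n p) (orb E \<omega> n q) powr \<sigma> \<partial>S) \<le> (1 - s / 2) * pdist p q powr \<sigma>"
    if E: "\<bar>E\<bar> \<le> R + 2" and p: "p \<noteq> 0" and q: "q \<noteq> 0" for E p q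
  proof -
    have "(\<integral>\<omega>. pdist (orb E \<omega> n p) (orb E \<omega> n q) powr \<sigma> \<partial>S) \<le>
        (\<integral>\<omega>. pdist p q powr \<sigma> * ((exp (- s * Z E p \<omega>) + exp (- s * Z E q \<omega>)) / 2) \<partial>S)"
    proof (rule integral_mono)
      fix \<omega>
      let ?x = "exp (- \<sigma> * Z E p \<omega>)" and ?y = "exp (- \<sigma> * Z E q \<omega>)"
      have "exp (- Z E p \<omega> - Z E q \<omega>) powr \<sigma> = ?x * ?y"
        by (simp add: powr_def exp_add[symmetric] algebra_simps)
      hence "pdist (orb E \<omega> n p) (orb E \<omega> n q) powr \<sigma> = pdist p q powr \<sigma> * (?x * ?y)"
        unfolding pdist_orb[OF p q] Z_def[symmetric] by (simp only: powr_mult pdist_nonneg exp_ge_zero)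
      also have "\<dots> \<le> pdist p q powr \<sigma> * ((?x\<^sup>2 + ?y\<^sup>2) / 2)"
      proof (rule mult_left_mono)
        have "0 \<le> (?x - ?y)\<^sup>2" by simp
        thus "?x * ?y \<le> (?x\<^sup>2 + ?y\<^sup>2) / 2" by (simp add: power2_eq_square algebra_simps)
      qed simp
      also have "?x\<^sup>2 = exp (- s * Z E p \<omega>)" by (simp add: exp_double[symmetric] \<sigma>_def)
      also have "?y\<^sup>2 = exp (- s * Z E q \<omega>)" by (simp add: exp_double[symmetric] \<sigma>_def)
      finally show "pdist (orb E \<omega> n p) (orb E \<omega> n q) powr \<sigma> \<le>
        pdist p q powr \<sigma> * ((exp (- s * Z E p \<omega>) + exp (- s * Z E q \<omega>)) / 2)" .
    next
      show "integrable S (\<lambda>\<omega>. pdist (orb E \<omega> n p) (orb E \<omega> n q) powr \<sigma>)"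
        using s by (intro S.integrable_const_bound[of _ 1]) (simp_all add: \<sigma>_def pdist_powr_le_1)
    qed (use iE[OF E p] iE[OF E q] in auto)
    also have "\<dots> = pdist p q powr \<sigma> *
        (((\<integral>\<omega>. exp (- s * Z E p \<omega>) \<partial>S) + (\<integral>\<omega>. exp (- s * Z E q \<omega>) \<partial>S)) / 2)"
      using iE[OF E p] iE[OF E q] by simp
    also have "\<dots> \<le> pdist p q powr \<sigma> * (1 - s / 2)"
      using EZ[OF E p] EZ[OF E q] by (intro mult_left_mono) auto
    finally show ?thesis by (simp add: mult.commute)
  qed
  thus ?thesis using s npos
    by (intro exI[of _ n] exI[of _ \<sigma>] exI[of _ "1 - s / 2"]) (auto simp: \<sigma>_def)
qed

end

section \<open>Coupling two energies\<close>

lemma abs_ln_diff_le_mult: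
  fixes x y c :: real
  assumes "c > 0" "1 \<le> c * x" "1 \<le> c * y"
  shows "\<bar>ln x - ln y\<bar> \<le> c * \<bar>x - y\<bar>"
proof -
  have *: "ln x - ln y \<le> c * \<bar>x - y\<bar>" if "1 \<le> c * x" "1 \<le> c * y" for x y
  proof -
    have pos: "x > 0" "y > 0" using that assms(1)
      by (auto intro: zero_less_mult_pos[of c] order_less_le_trans[OF zero_less_one])
    have "ln x - ln y = ln (x / y)" using pos by (simp add: ln_div)
    also have "\<dots> \<le> x / y - 1" using pos by (intro ln_le_minus_one) auto
    also have "\<dots> = 1 / y * (x - y)" using pos by (simp add: field_simps)
    also have "\<dots> \<le> 1 / y * \<bar>x - y\<bar>" using pos by (intro mult_left_mono) auto
    also have "\<dots> \<le> c * \<bar>x - y\<bar>"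
      using that pos by (intro mult_right_mono) (auto simp: divide_le_eq)
    finally show ?thesis .
  qed
  show ?thesis using *[of x y] *[of y x] assms by (auto simp: abs_le_iff abs_minus_commute)
qed

context random_potential
begin

lemma pdist_T_le:
  assumes E: "\<bar>E\<bar> \<le> R + 2" and pq: "p \<noteq> 0" "q \<noteq> 0"
  shows "pdist (T E a p) (T E a q) \<le> step_bound\<^sup>2 * pdist p q"
proof -
  have "norm p * norm q \<le> (step_bound * norm (T E a p)) * (step_bound * norm (T E a q))"
    using norm_T_ge[OF E] step_bound_ge by (intro mult_mono) auto
  hence "\<bar>wedge p q\<bar> * (norm p * norm q) \<le>
      \<bar>wedge p q\<bar> * ((step_bound * norm (T E a p)) * (step_bound * norm (T E a q)))"
    by (intro mult_left_mono) auto
  thus ?thesis using pq by (simp add: pdist_def field_simps power2_eq_square)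
qed

lemma pdist_T_energy_le:
  assumes E: "\<bar>E\<bar> \<le> R + 2" "\<bar>E'\<bar> \<le> R + 2" and q: "q \<noteq> 0"
  shows "pdist (T E a q) (T E' a q) \<le> step_bound\<^sup>2 * \<bar>E - E'\<bar>"
proof -
  have "\<bar>wedge (T E a q) (T E' a q)\<bar> = \<bar>E - E'\<bar> * \<bar>fst q\<bar>\<^sup>2"
    unfolding wedge_shift_map_two by (simp add: abs_mult)
  also have "\<dots> \<le> \<bar>E - E'\<bar> * (norm q)\<^sup>2"
    using abs_fst_le_norm[of q] by (intro mult_left_mono power_mono) auto
  also have "\<dots> \<le> \<bar>E - E'\<bar> * ((step_bound * norm (T E a q)) * (step_bound * norm (T E' a q)))"
    using norm_T_ge[OF E(1), of q a] norm_T_ge[OF E(2), of q a] step_bound_ge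
    unfolding power2_eq_square by (intro mult_left_mono mult_mono) auto
  finally show ?thesis using q by (simp add: pdist_def field_simps power2_eq_square)
qed

text \<open>The constant grows exponentially with \<open>n\<close>. It serves only up to the fixed
  contraction time; beyond that \<open>coupling_step\<close> takes over.\<close>

lemma pdist_orb_energy_le:
  "\<exists>c\<ge>0. \<forall>E E' p \<omega> k. \<bar>E\<bar> \<le> R + 2 \<longrightarrow> \<bar>E'\<bar> \<le> R + 2 \<longrightarrow> p \<noteq> 0 \<longrightarrow> k \<le> n \<longrightarrow>
    pdist (orb E \<omega> k p) (orb E' \<omega> k p) \<le> c * \<bar>E - E'\<bar>"
proof (induction n)
  case 0
  show ?case by (rule exI[of _ 0]) auto
next
  case (Suc n)
  then obtain c where c: "c \<ge> 0" and le: "\<And>E E' p \<omega> k. \<bar>E\<bar> \<le> R + 2 \<Longrightarrow> \<bar>E'\<bar> \<le> R + 2 \<Longrightarrow> p \<noteq> 0 \<Longrightarrow> k \<le> n \<Longrightarrow>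
    pdist (orb E \<omega> k p) (orb E' \<omega> k p) \<le> c * \<bar>E - E'\<bar>" by blast
  let ?L = "step_bound\<^sup>2"
  have L: "?L \<ge> 1" using step_bound_ge by (simp add: one_le_power)
  have "1 * (c + 1) \<le> ?L * (c + 1)" using L c by (intro mult_right_mono) auto
  hence cL: "c \<le> ?L * (c + 1)" by (rule order_trans[rotated]) simp
  have "pdist (orb E \<omega> k p) (orb E' \<omega> k p) \<le> ?L * (c + 1) * \<bar>E - E'\<bar>"
    if E: "\<bar>E\<bar> \<le> R + 2" "\<bar>E'\<bar> \<le> R + 2" and p: "p \<noteq> 0" and k: "k \<le> Suc n" for E E' p \<omega> k
  proof (cases "k \<le> n")
    case True
    have "c * \<bar>E - E'\<bar> \<le> ?L * (c + 1) * \<bar>E - E'\<bar>" using cL by (intro mult_right_mono) auto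
    thus ?thesis using le[OF E p True, of \<omega>] by linarith
  next
    case False
    hence k: "k = Suc n" using k by simp
    let ?x = "orb E \<omega> n p" and ?y = "orb E' \<omega> n p"
    have nz: "?x \<noteq> 0" "?y \<noteq> 0" using p by auto
    have "pdist (T E (\<omega> n) ?x) (T E' (\<omega> n) ?y) \<le>
        pdist (T E (\<omega> n) ?x) (T E (\<omega> n) ?y) + pdist (T E (\<omega> n) ?y) (T E' (\<omega> n) ?y)"
      using nz by (intro pdist_triangle) auto
    also have "\<dots> \<le> ?L * pdist ?x ?y + ?L * \<bar>E - E'\<bar>"
      by (intro add_mono pdist_T_le pdist_T_energy_le E nz)
    also have "\<dots> \<le> ?L * (c * \<bar>E - E'\<bar>) + ?L * \<bar>E - E'\<bar>"
      using le[OF E p, of n \<omega>] L by (intro add_mono mult_left_mono) auto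
    finally show ?thesis by (simp add: k algebra_simps)
  qed
  moreover have "?L * (c + 1) \<ge> 0" using c L by simp
  ultimately show ?case by blast
qed

text \<open>The increments depend only on the lines, so unit vectors with the better choice of sign
  may be compared. Their images have norm at least \<open>1 / step_bound\<close>, where
  \<open>ln\<close> is Lipschitz.\<close>

lemma log_increment_le:
  "\<exists>A\<ge>0. \<forall>E E' a p q. \<bar>E\<bar> \<le> R + 2 \<longrightarrow> \<bar>E'\<bar> \<le> R + 2 \<longrightarrow> p \<noteq> 0 \<longrightarrow> q \<noteq> 0 \<longrightarrow>
    \<bar>(ln (norm (T E a p)) - ln (norm p)) - (ln (norm (T E' a q)) - ln (norm q))\<bar>
      \<le> A * (pdist p q + \<bar>E - E'\<bar>)"
proof (intro exI[of _ "2 * step_bound\<^sup>2"] conjI allI impI)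
  show "2 * step_bound\<^sup>2 \<ge> 0" by simp
  fix E E' a and p q :: "real \<times> real"
  assume E: "\<bar>E\<bar> \<le> R + 2" "\<bar>E'\<bar> \<le> R + 2" and pq: "p \<noteq> 0" "q \<noteq> 0"
  let ?L = step_bound
  have L: "?L \<ge> 4" by (rule step_bound_ge)
  define p1 where "p1 = (1 / norm p) *\<^sub>R p"
  define q1 where "q1 = (1 / norm q) *\<^sub>R q"
  have u: "norm p1 = 1" "norm q1 = 1" using pq by (simp_all add: p1_def q1_def)
  have w: "\<bar>wedge p1 q1\<bar> = pdist p q"
    using pq by (simp add: p1_def q1_def wedge_def pdist_def abs_mult[symmetric] field_simps)
  obtain q2 where q2: "q2 \<in> {q1, - q1}" "norm (p1 - q2) \<le> 2 * pdist p q"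
    using unit_vectors_close[OF u] unfolding w by blast
  have uq2: "norm q2 = 1" using q2 u by auto
  have Tp: "ln (norm (T E a p)) - ln (norm p) = ln (norm (T E a p1))"
    using pq by (simp add: p1_def shift_map_scaleR ln_mult ln_div)
  have "norm (T E' a q2) = norm (T E' a q1)"
    using q2(1) shift_map_scaleR[of _ "-1" q1] by auto
  hence Tq: "ln (norm (T E' a q)) - ln (norm q) = ln (norm (T E' a q2))"
    using pq by (simp add: q1_def shift_map_scaleR ln_mult ln_div)
  have "\<bar>ln (norm (T E a p1)) - ln (norm (T E' a q2))\<bar> \<le> ?L * \<bar>norm (T E a p1) - norm (T E' a q2)\<bar>"
    using norm_T_ge[OF E(1), of p1 a] norm_T_ge[OF E(2), of q2 a] u uq2 L
    by (intro abs_ln_diff_le_mult) auto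
  also have "\<bar>norm (T E a p1) - norm (T E' a q2)\<bar> \<le> norm (T E a p1 - T E' a q2)"
    by (rule norm_triangle_ineq3)
  also have "T E a p1 - T E' a q2 = T E a (p1 - q2) + ((E - E') * fst q2, 0)"
    by (simp add: shift_map_def algebra_simps)
  also have "norm (T E a (p1 - q2) + ((E - E') * fst q2, 0)) \<le>
      norm (T E a (p1 - q2)) + norm ((E - E') * fst q2, 0 :: real)"
    by (rule norm_triangle_ineq)
  also have "\<dots> \<le> ?L * (2 * pdist p q) + \<bar>E - E'\<bar> * 1"
  proof (rule add_mono)
    have "norm (T E a (p1 - q2)) \<le> ?L * norm (p1 - q2)" by (rule norm_T_le[OF E(1)])
    also have "\<dots> \<le> ?L * (2 * pdist p q)" using q2 L by (intro mult_left_mono) auto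
    finally show "norm (T E a (p1 - q2)) \<le> ?L * (2 * pdist p q)" .
    have "norm ((E - E') * fst q2, 0 :: real) = \<bar>E - E'\<bar> * \<bar>fst q2\<bar>"
      by (simp add: norm_Pair abs_mult)
    also have "\<dots> \<le> \<bar>E - E'\<bar> * 1"
      using abs_fst_le_norm[of q2] uq2 by (intro mult_left_mono) auto
    finally show "norm ((E - E') * fst q2, 0 :: real) \<le> \<bar>E - E'\<bar> * 1" .
  qed
  also have "?L * (?L * (2 * pdist p q) + \<bar>E - E'\<bar> * 1) \<le> 2 * ?L\<^sup>2 * (pdist p q + \<bar>E - E'\<bar>)"
  proof -
    have "?L * \<bar>E - E'\<bar> \<le> ?L * (2 * ?L) * \<bar>E - E'\<bar>"
      using L mult_left_mono[of 1 "2 * ?L" ?L] by (intro mult_right_mono) auto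
    thus ?thesis by (simp add: power2_eq_square algebra_simps)
  qed
  finally show "\<bar>(ln (norm (T E a p)) - ln (norm p)) - (ln (norm (T E' a q)) - ln (norm q))\<bar>
      \<le> 2 * ?L\<^sup>2 * (pdist p q + \<bar>E - E'\<bar>)"
    unfolding Tp Tq using L by (auto intro: mult_left_mono)
qed

text \<open>Energies and starting vectors vary separately: different energies with one vector give
  the regularity, one energy with two vectors the convergence.\<close>

definition coupling :: "real \<Rightarrow> real \<Rightarrow> real \<Rightarrow> nat \<Rightarrow> real \<times> real \<Rightarrow> real \<times> real \<Rightarrow> real" where
  "coupling s E E' k p q = (\<integral>\<omega>. pdist (orb E \<omega> k p) (orb E' \<omega> k q) powr s \<partial>S)"

lemma coupling_integrable:
  "0 < s \<Longrightarrow> integrable S (\<lambda>\<omega>. pdist (orb E \<omega> k p) (orb E' \<omega> k q) powr s)"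
  by (intro S.integrable_const_bound[of _ 1]) (simp_all add: pdist_powr_le_1)

text \<open>The triangle inequality goes through the orbit that starts at the second vector but runs
  with the first energy: one leg contracts by \<open>contr\<close>, the other is short by
  \<open>en\<close>.\<close>

lemma coupling_step:
  assumes s: "0 < s" "s \<le> 1" and \<rho>: "0 < \<rho>"
    and contr: "\<And>p q. p \<noteq> 0 \<Longrightarrow> q \<noteq> 0 \<Longrightarrow>
      (\<integral>\<omega>. pdist (orb E \<omega> n p) (orb E \<omega> n q) powr s \<partial>S) \<le> \<rho> * pdist p q powr s"
    and c: "c \<ge> 0" and en: "\<And>p \<omega>. p \<noteq> 0 \<Longrightarrow> pdist (orb E \<omega> n p) (orb E' \<omega> n p) \<le> c * \<bar>E - E'\<bar>"
    and pq: "p \<noteq> 0" "q \<noteq> 0"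
  shows "coupling s E E' (k + n) p q \<le> \<rho> * coupling s E E' k p q + (c * \<bar>E - E'\<bar>) powr s"
proof -
  have inner: "(\<integral>\<omega>'. pdist (orb E \<omega>' n x) (orb E' \<omega>' n y) powr s \<partial>S)
      \<le> \<rho> * pdist x y powr s + (c * \<bar>E - E'\<bar>) powr s" if xy: "x \<noteq> 0" "y \<noteq> 0" for x y
  proof -
    have "(\<integral>\<omega>'. pdist (orb E \<omega>' n x) (orb E' \<omega>' n y) powr s \<partial>S)
      \<le> (\<integral>\<omega>'. pdist (orb E \<omega>' n x) (orb E \<omega>' n y) powr s + (c * \<bar>E - E'\<bar>) powr s \<partial>S)"
    proof (rule integral_mono)
      fix \<omega>
      have "pdist (orb E \<omega> n x) (orb E' \<omega> n y) \<le>
          pdist (orb E \<omega> n x) (orb E \<omega> n y) + pdist (orb E \<omega> n y) (orb E' \<omega> n y)"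
        using xy by (intro pdist_triangle) auto
      also have "\<dots> \<le> pdist (orb E \<omega> n x) (orb E \<omega> n y) + c * \<bar>E - E'\<bar>"
        using en[OF xy(2)] by simp
      finally have "pdist (orb E \<omega> n x) (orb E' \<omega> n y) powr s \<le>
          (pdist (orb E \<omega> n x) (orb E \<omega> n y) + c * \<bar>E - E'\<bar>) powr s"
        using s pdist_nonneg by (intro powr_mono2) auto
      also have "\<dots> \<le> pdist (orb E \<omega> n x) (orb E \<omega> n y) powr s + (c * \<bar>E - E'\<bar>) powr s"
        using s c pdist_nonneg by (intro add_powr_le) auto
      finally show "pdist (orb E \<omega> n x) (orb E' \<omega> n y) powr s \<le>
          pdist (orb E \<omega> n x) (orb E \<omega> n y) powr s + (c * \<bar>E - E'\<bar>) powr s" .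
    qed (use coupling_integrable[OF s(1)] in auto)
    also have "\<dots> = (\<integral>\<omega>'. pdist (orb E \<omega>' n x) (orb E \<omega>' n y) powr s \<partial>S) + (c * \<bar>E - E'\<bar>) powr s"
      using coupling_integrable[OF s(1)] by (subst Bochner_Integration.integral_add) (simp_all add: S.prob_space)
    finally show ?thesis using contr[OF xy] by linarith
  qed
  have "coupling s E E' (k + n) p q =
      (\<integral>\<omega>. (\<integral>\<omega>'. pdist (orb E (comb_seq k \<omega> \<omega>') (k + n) p) (orb E' (comb_seq k \<omega> \<omega>') (k + n) q) powr s \<partial>S) \<partial>S)"
    unfolding coupling_def using s
    by (intro integral_S_comb_seq[of _ 1]) (simp_all add: pdist_powr_le_1)
  also have "\<dots> = (\<integral>\<omega>. (\<integral>\<omega>'. pdist (orb E \<omega>' n (orb E \<omega> k p)) (orb E' \<omega>' n (orb E' \<omega> k q)) powr s \<partial>S) \<partial>S)"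
    by (simp add: orb_comb_seq)
  also have "\<dots> \<le> (\<integral>\<omega>. \<rho> * pdist (orb E \<omega> k p) (orb E' \<omega> k q) powr s + (c * \<bar>E - E'\<bar>) powr s \<partial>S)"
  proof (rule integral_mono)
    show "(\<integral>\<omega>'. pdist (orb E \<omega>' n (orb E \<omega> k p)) (orb E' \<omega>' n (orb E' \<omega> k q)) powr s \<partial>S)
      \<le> \<rho> * pdist (orb E \<omega> k p) (orb E' \<omega> k q) powr s + (c * \<bar>E - E'\<bar>) powr s" for \<omega>
      using pq by (intro inner) auto
    show "integrable S (\<lambda>\<omega>. \<integral>\<omega>'. pdist (orb E \<omega>' n (orb E \<omega> k p)) (orb E' \<omega>' n (orb E' \<omega> k q)) powr s \<partial>S)"
    proof (rule S.integrable_const_bound[of _ 1])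
      have "0 \<le> (\<integral>\<omega>'. pdist (orb E \<omega>' n x) (orb E' \<omega>' n y) powr s \<partial>S)" for x y
        by (rule integral_nonneg_AE) simp
      moreover have "(\<integral>\<omega>'. pdist (orb E \<omega>' n x) (orb E' \<omega>' n y) powr s \<partial>S) \<le> 1" for x y
        by (rule integral_S_le[OF coupling_integrable[OF s(1)] pdist_powr_le_1[OF s(1)]])
      ultimately show "AE \<omega> in S. norm (\<integral>\<omega>'. pdist (orb E \<omega>' n (orb E \<omega> k p)) (orb E' \<omega>' n (orb E' \<omega> k q)) powr s \<partial>S) \<le> 1"
        by simp
    qed measurable
  qed (use coupling_integrable[OF s(1)] in auto)
  also have "\<dots> = \<rho> * coupling s E E' k p q + (c * \<bar>E - E'\<bar>) powr s"
    unfolding coupling_def using coupling_integrable[OF s(1)]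
    by (subst Bochner_Integration.integral_add) (simp_all add: S.prob_space)
  finally show ?thesis .
qed

lemma log_norm_diff_le_sum:
  assumes A: "\<And>a p q. p \<noteq> 0 \<Longrightarrow> q \<noteq> 0 \<Longrightarrow>
    \<bar>(ln (norm (T E a p)) - ln (norm p)) - (ln (norm (T E' a q)) - ln (norm q))\<bar>
      \<le> A * (pdist p q + \<bar>E - E'\<bar>)"
    and pq: "p \<noteq> 0" "q \<noteq> 0"
  shows "\<bar>(ln (norm (orb E \<omega> n p)) - ln (norm p)) - (ln (norm (orb E' \<omega> n q)) - ln (norm q))\<bar>
    \<le> (\<Sum>k<n. A * (pdist (orb E \<omega> k p) (orb E' \<omega> k q) + \<bar>E - E'\<bar>))"
proof (induction n)
  case 0
  show ?case by simp
next
  case (Suc n)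
  have "\<bar>(ln (norm (T E (\<omega> n) (orb E \<omega> n p))) - ln (norm (orb E \<omega> n p)))
      - (ln (norm (T E' (\<omega> n) (orb E' \<omega> n q))) - ln (norm (orb E' \<omega> n q)))\<bar>
      \<le> A * (pdist (orb E \<omega> n p) (orb E' \<omega> n q) + \<bar>E - E'\<bar>)"
    using pq by (intro A) auto
  with Suc.IH show ?case by simp
qed

lemma pdist_integrable: "integrable S (\<lambda>\<omega>. pdist (orb E \<omega> k p) (orb E' \<omega> k q))"
  by (intro S.integrable_const_bound[of _ 1]) (simp_all add: pdist_le_1 pdist_nonneg)

lemma integral_pdist_le_coupling:
  assumes s: "0 < s" "s \<le> 1"
  shows "(\<integral>\<omega>. pdist (orb E \<omega> k p) (orb E' \<omega> k q) \<partial>S) \<le> coupling s E E' k p q"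
  unfolding coupling_def
proof (rule integral_mono[OF pdist_integrable coupling_integrable[OF s(1)]])
  fix \<omega>
  let ?x = "pdist (orb E \<omega> k p) (orb E' \<omega> k q)"
  have "?x = ?x powr 1" using pdist_nonneg by simp
  also have "\<dots> \<le> ?x powr s" using s pdist_nonneg pdist_le_1 by (intro powr_mono') auto
  finally show "?x \<le> ?x powr s" .
qed

lemma integral_log_norm_diff_le:
  assumes A0: "A \<ge> 0" and A: "\<And>a p q. p \<noteq> 0 \<Longrightarrow> q \<noteq> 0 \<Longrightarrow>
    \<bar>(ln (norm (T E a p)) - ln (norm p)) - (ln (norm (T E' a q)) - ln (norm q))\<bar>
      \<le> A * (pdist p q + \<bar>E - E'\<bar>)"
    and E: "\<bar>E\<bar> \<le> R + 2" "\<bar>E'\<bar> \<le> R + 2" and pq: "norm p = 1" "norm q = 1"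
    and s: "0 < s" "s \<le> 1"
  shows "(\<integral>\<omega>. \<bar>ln (norm (orb E \<omega> n p)) - ln (norm (orb E' \<omega> n q))\<bar> \<partial>S)
    \<le> A * (\<Sum>k<n. coupling s E E' k p q) + A * real n * \<bar>E - E'\<bar>"
proof -
  have nz: "p \<noteq> 0" "q \<noteq> 0" using pq by auto
  have "(\<integral>\<omega>. \<bar>ln (norm (orb E \<omega> n p)) - ln (norm (orb E' \<omega> n q))\<bar> \<partial>S)
      \<le> (\<integral>\<omega>. (\<Sum>k<n. A * (pdist (orb E \<omega> k p) (orb E' \<omega> k q) + \<bar>E - E'\<bar>)) \<partial>S)"
  proof (rule integral_mono)
    show "\<bar>ln (norm (orb E \<omega> n p)) - ln (norm (orb E' \<omega> n q))\<bar>
        \<le> (\<Sum>k<n. A * (pdist (orb E \<omega> k p) (orb E' \<omega> k q) + \<bar>E - E'\<bar>))" for \<omega>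
      using log_norm_diff_le_sum[OF A nz, of \<omega> n] pq by simp
    show "integrable S (\<lambda>\<omega>. \<bar>ln (norm (orb E \<omega> n p)) - ln (norm (orb E' \<omega> n q))\<bar>)"
      using integrable_ln_norm_orb[OF E(1) nz(1)] integrable_ln_norm_orb[OF E(2) nz(2)] by auto
    show "integrable S (\<lambda>\<omega>. \<Sum>k<n. A * (pdist (orb E \<omega> k p) (orb E' \<omega> k q) + \<bar>E - E'\<bar>))"
      using pdist_integrable by auto
  qed
  also have "\<dots> = (\<Sum>k<n. A * ((\<integral>\<omega>. pdist (orb E \<omega> k p) (orb E' \<omega> k q) \<partial>S) + \<bar>E - E'\<bar>))"
    using pdist_integrable by (subst Bochner_Integration.integral_sum) (simp_all add: S.prob_space)
  also have "\<dots> \<le> (\<Sum>k<n. A * (coupling s E E' k p q + \<bar>E - E'\<bar>))"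
    using A0 integral_pdist_le_coupling[OF s] by (intro sum_mono mult_left_mono add_right_mono) auto
  also have "\<dots> = A * (\<Sum>k<n. coupling s E E' k p q) + A * real n * \<bar>E - E'\<bar>"
    by (simp add: sum.distrib sum_distrib_left algebra_simps)
  finally show ?thesis .
qed

text \<open>In the first bound the couplings at equal energies are summable, uniformly in
  \<open>n\<close>. In the second each coupling is at most a constant times
  \<open>\<bar>E - E'\<bar> powr s\<close>, and the error linear in \<open>n\<close> is what remains
  after division by \<open>n\<close>.\<close>

theorem lnn_Hoelder:
  "\<exists>C s. 0 \<le> C \<and> 0 < s \<and> s \<le> 1 \<and>
    (\<forall>E n p q. \<bar>E\<bar> \<le> R + 2 \<longrightarrow> norm p = 1 \<longrightarrow> norm q = 1 \<longrightarrow>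
      (\<integral>\<omega>. \<bar>ln (norm (orb E \<omega> n p)) - ln (norm (orb E \<omega> n q))\<bar> \<partial>S) \<le> C) \<and>
    (\<forall>E E' n p. \<bar>E\<bar> \<le> R + 2 \<longrightarrow> \<bar>E'\<bar> \<le> R + 2 \<longrightarrow> norm p = 1 \<longrightarrow>
      \<bar>lnn E n p - lnn E' n p\<bar> \<le> real n * (C * \<bar>E - E'\<bar> powr s))"
proof -
  obtain N :: nat and s \<rho> where s: "0 < s" "s \<le> 1" and \<rho>: "0 < \<rho>" "\<rho> < 1" and N: "N > 0"
    and contr: "\<And>E p q. \<bar>E\<bar> \<le> R + 2 \<Longrightarrow> p \<noteq> 0 \<Longrightarrow> q \<noteq> 0 \<Longrightarrow>
      (\<integral>\<omega>. pdist (orb E \<omega> N p) (orb E \<omega> N q) powr s \<partial>S) \<le> \<rho> * pdist p q powr s"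
    using uniform_contraction by blast
  obtain c where c: "c \<ge> 0"
    and en: "\<And>E E' p \<omega> k. \<bar>E\<bar> \<le> R + 2 \<Longrightarrow> \<bar>E'\<bar> \<le> R + 2 \<Longrightarrow> p \<noteq> 0 \<Longrightarrow> k \<le> N \<Longrightarrow>
      pdist (orb E \<omega> k p) (orb E' \<omega> k p) \<le> c * \<bar>E - E'\<bar>"
    using pdist_orb_energy_le[of N] by blast
  obtain A where A0: "A \<ge> 0"
    and A: "\<And>E E' a p q. \<bar>E\<bar> \<le> R + 2 \<Longrightarrow> \<bar>E'\<bar> \<le> R + 2 \<Longrightarrow> p \<noteq> 0 \<Longrightarrow> q \<noteq> 0 \<Longrightarrow>
    \<bar>(ln (norm (T E a p)) - ln (norm p)) - (ln (norm (T E' a q)) - ln (norm q))\<bar>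
      \<le> A * (pdist p q + \<bar>E - E'\<bar>)"
    using log_increment_le by blast
  have cstep: "coupling s E E' (k + N) p q \<le> \<rho> * coupling s E E' k p q + (c * \<bar>E - E'\<bar>) powr s"
    if E: "\<bar>E\<bar> \<le> R + 2" "\<bar>E'\<bar> \<le> R + 2" and pq: "p \<noteq> 0" "q \<noteq> 0" for E E' k p q
    by (rule coupling_step[OF s \<rho>(1) contr[OF E(1)] c en[OF E] pq]) auto
  have cle1: "coupling s E E' k p q \<le> 1" for E E' k p q
    unfolding coupling_def by (rule integral_S_le[OF coupling_integrable[OF s(1)] pdist_powr_le_1[OF s(1)]])
  have c0: "0 \<le> coupling s E E' k p q" for E E' k p q
    unfolding coupling_def by (rule integral_nonneg_AE) simp
  \<comment> \<open>The fixed point of the recursion \<open>x = \<rho> * x + c powr s\<close> from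
    \<open>cstep\<close>.\<close>
  define B where "B = c powr s / (1 - \<rho>)"
  have B: "B \<ge> 0" "c powr s \<le> B" "\<rho> * B + c powr s = B"
  proof -
    show "B \<ge> 0" using \<rho> by (simp add: B_def)
    show "c powr s \<le> B" using \<rho> mult_left_mono[of "1 - \<rho>" 1 "c powr s"] by (simp add: B_def le_divide_eq)
    show "\<rho> * B + c powr s = B" using \<rho> by (simp add: B_def field_simps)
  qed
  have same: "coupling s E E' k p p \<le> B * \<bar>E - E'\<bar> powr s"
    if E: "\<bar>E\<bar> \<le> R + 2" "\<bar>E'\<bar> \<le> R + 2" and p: "p \<noteq> 0" for E E' k p
  proof (induction k rule: less_induct)
    case (less k)
    let ?D = "\<bar>E - E'\<bar> powr s"
    have pm: "(c * \<bar>E - E'\<bar>) powr s = c powr s * ?D" using c by (simp add: powr_mult)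
    show ?case
    proof (cases "k < N")
      case True
      have "coupling s E E' k p p \<le> (c * \<bar>E - E'\<bar>) powr s"
        unfolding coupling_def
      proof (rule integral_S_le[OF coupling_integrable[OF s(1)]])
        show "pdist (orb E \<omega> k p) (orb E' \<omega> k p) powr s \<le> (c * \<bar>E - E'\<bar>) powr s" for \<omega>
          using en[OF E p, of k \<omega>] True s pdist_nonneg by (intro powr_mono2) auto
      qed
      also have "\<dots> \<le> B * ?D" unfolding pm using B by (intro mult_right_mono) auto
      finally show ?thesis .
    next
      case False
      hence k: "k = (k - N) + N" by simp
      have "coupling s E E' k p p \<le> \<rho> * coupling s E E' (k - N) p p + (c * \<bar>E - E'\<bar>) powr s"
        using cstep[OF E p p, of "k - N"] k by simp
      also have "\<dots> \<le> \<rho> * (B * ?D) + c powr s * ?D"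
        unfolding pm using \<rho> N False by (intro add_right_mono mult_left_mono less.IH) auto
      also have "\<dots> = (\<rho> * B + c powr s) * ?D" by (simp add: algebra_simps)
      finally show ?thesis unfolding B(3) .
    qed
  qed
  have diff: "(\<Sum>k<n. coupling s E E k p q) \<le> real N / (1 - \<rho>)"
    if E: "\<bar>E\<bar> \<le> R + 2" and pq: "p \<noteq> 0" "q \<noteq> 0" for E n p q
  proof -
    let ?d = "\<lambda>k. coupling s E E k p q"
    \<comment> \<open>The sum is compared with its shift by \<open>N\<close>: the first
      \<open>N\<close> terms are at most \<open>1\<close>, the others shrink by
      \<open>\<rho>\<close>, and the inequality is solved for the sum.\<close>
    have "(\<Sum>k<n. ?d k) \<le> (\<Sum>k<N + n. ?d k)"
      using c0 by (intro sum_mono2) auto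
    also have "\<dots> = (\<Sum>k<N. ?d k) + (\<Sum>k<n. ?d (k + N))"
      by (induction n) (simp_all add: add.commute add.left_commute)
    also have "\<dots> \<le> (\<Sum>k<N. 1) + (\<Sum>k<n. \<rho> * ?d k)"
    proof (intro add_mono sum_mono cle1)
      show "?d (k + N) \<le> \<rho> * ?d k" for k using cstep[OF E E pq, of k] s by simp
    qed
    also have "\<dots> = real N + \<rho> * (\<Sum>k<n. ?d k)" by (simp add: sum_distrib_left)
    finally have "(\<Sum>k<n. ?d k) * (1 - \<rho>) \<le> real N" by (simp add: algebra_simps)
    thus ?thesis using \<rho> by (simp add: le_divide_eq)
  qed
  \<comment> \<open>\<open>2 * R + 4\<close> is the length of the energy window; it allows
    \<open>\<bar>E - E'\<bar>\<close> to be absorbed into its power with exponent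
    \<open>s \<le> 1\<close>.\<close>
  define D where "D = (2 * R + 4) powr (1 - s)"
  have D: "\<bar>E - E'\<bar> \<le> D * \<bar>E - E'\<bar> powr s" if E: "\<bar>E\<bar> \<le> R + 2" "\<bar>E'\<bar> \<le> R + 2" for E E'
  proof (cases "E = E'")
    case False
    have "\<bar>E - E'\<bar> = \<bar>E - E'\<bar> powr (1 - s) * \<bar>E - E'\<bar> powr s"
      using False by (simp add: powr_add[symmetric])
    also have "\<dots> \<le> D * \<bar>E - E'\<bar> powr s"
      unfolding D_def using E s by (intro mult_right_mono powr_mono2) auto
    finally show ?thesis .
  qed simp
  define C where "C = max (A * (real N / (1 - \<rho>))) (A * B + A * D)"
  have AB: "A * B + A * D \<ge> 0" using A0 B by (simp add: D_def)
  have C: "C \<ge> 0" using AB by (simp add: C_def)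
  have 1: "(\<integral>\<omega>. \<bar>ln (norm (orb E \<omega> n p)) - ln (norm (orb E \<omega> n q))\<bar> \<partial>S) \<le> C"
    if E: "\<bar>E\<bar> \<le> R + 2" and pq: "norm p = 1" "norm q = 1" for E n p q
  proof -
    have nz: "p \<noteq> 0" "q \<noteq> 0" using pq by auto
    have "(\<integral>\<omega>. \<bar>ln (norm (orb E \<omega> n p)) - ln (norm (orb E \<omega> n q))\<bar> \<partial>S)
        \<le> A * (\<Sum>k<n. coupling s E E k p q) + A * real n * \<bar>E - E\<bar>"
      by (rule integral_log_norm_diff_le[OF A0 A[OF E E] E E pq s])
    also have "\<dots> \<le> A * (real N / (1 - \<rho>))"
      using mult_left_mono[OF diff[OF E nz, of n] A0] by simp
    finally show ?thesis by (simp add: C_def)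
  qed
  have 2: "\<bar>lnn E n p - lnn E' n p\<bar> \<le> real n * (C * \<bar>E - E'\<bar> powr s)"
    if E: "\<bar>E\<bar> \<le> R + 2" "\<bar>E'\<bar> \<le> R + 2" and p: "norm p = 1" for E E' n p
  proof -
    have nz: "p \<noteq> 0" using p by auto
    have "lnn E n p - lnn E' n p = (\<integral>\<omega>. ln (norm (orb E \<omega> n p)) - ln (norm (orb E' \<omega> n p)) \<partial>S)"
      unfolding lnn_def using integrable_ln_norm_orb[OF E(1) nz] integrable_ln_norm_orb[OF E(2) nz] by simp
    also have "\<bar>\<dots>\<bar> \<le> (\<integral>\<omega>. \<bar>ln (norm (orb E \<omega> n p)) - ln (norm (orb E' \<omega> n p))\<bar> \<partial>S)"
      by (rule integral_abs_bound)
    also have "\<dots> \<le> A * (\<Sum>k<n. coupling s E E' k p p) + A * real n * \<bar>E - E'\<bar>"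
      by (rule integral_log_norm_diff_le[OF A0 A[OF E] E p p s])
    also have "\<dots> \<le> A * (\<Sum>k<n. B * \<bar>E - E'\<bar> powr s) + A * real n * (D * \<bar>E - E'\<bar> powr s)"
      using A0 by (intro add_mono mult_left_mono sum_mono same[OF E nz] D[OF E]) auto
    also have "\<dots> = real n * ((A * B + A * D) * \<bar>E - E'\<bar> powr s)" by (simp add: algebra_simps)
    also have "\<dots> \<le> real n * (C * \<bar>E - E'\<bar> powr s)"
      by (intro mult_left_mono mult_right_mono) (auto simp: C_def)
    finally show ?thesis .
  qed
  show ?thesis using C s 1 2 by blast
qed

end

section \<open>The Lyapunov exponent\<close>

text \<open>\<open>b (m * n)\<close> is close to \<open>m\<close> times \<open>b n\<close> and to
  \<open>n\<close> times \<open>b m\<close>, so \<open>b m / real m\<close> and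
  \<open>b n / real n\<close> are both close to \<open>b (m * n) / (real m * real n)\<close>: a
  Cauchy sequence.\<close>

lemma quasi_additive_convergent:
  fixes b :: "nat \<Rightarrow> real"
  assumes b: "\<And>k n. \<bar>b (k + n) - b k - b n\<bar> \<le> C"
  shows "convergent (\<lambda>n. b n / real n)"
proof -
  have C: "C \<ge> 0" using b[of 0 0] by linarith
  have mult: "\<bar>b (m * n) - real m * b n\<bar> \<le> (real m + 1) * C" for m n
  proof (induction m)
    case 0
    show ?case using b[of 0 0] by simp
  next
    case (Suc m)
    have "b (Suc m * n) - real (Suc m) * b n = (b (n + m * n) - b n - b (m * n)) + (b (m * n) - real m * b n)"
      by (simp add: algebra_simps)
    thus ?case using b[of n "m * n"] Suc.IH by (simp add: algebra_simps abs_le_iff)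
  qed
  have one: "\<bar>b (m * n) / (real m * real n) - b n / real n\<bar> \<le> 2 * C / real n" if mn: "m > 0" "n > 0" for m n
  proof -
    have "b (m * n) / (real m * real n) - b n / real n = (b (m * n) - real m * b n) / (real m * real n)"
      using mn by (simp add: field_simps)
    also have "\<bar>\<dots>\<bar> = \<bar>b (m * n) - real m * b n\<bar> / (real m * real n)" using mn by simp
    also have "\<dots> \<le> (2 * real m * C) / (real m * real n)"
    proof (rule divide_right_mono)
      have "(real m + 1) * C \<le> 2 * real m * C" using mn C by (intro mult_right_mono) auto
      thus "\<bar>b (m * n) - real m * b n\<bar> \<le> 2 * real m * C" using mult[of m n] by linarith
    qed simp
    also have "\<dots> = 2 * C / real n" using mn by simp
    finally show ?thesis .
  qed
  have close: "\<bar>b m / real m - b n / real n\<bar> \<le> 2 * C / real m + 2 * C / real n" if "m > 0" "n > 0" for m n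
    using one[of m n] one[of n m] that by (simp add: mult.commute abs_le_iff)
  have "Cauchy (\<lambda>n. b n / real n)"
  proof (rule metric_CauchyI)
    fix e :: real assume e: "e > 0"
    obtain M :: nat where M: "4 * C / e < real M" using reals_Archimedean2 by blast
    have bd: "2 * C / real n < e / 2" if "n \<ge> Suc M" for n
    proof -
      have "4 * C / e < real n" using M that by linarith
      hence "4 * C < real n * e" using e by (simp add: pos_divide_less_eq)
      moreover have "real n > 0" using that by simp
      ultimately show ?thesis by (simp add: pos_divide_less_eq mult.commute)
    qed
    have "dist (b m / real m) (b n / real n) < e" if "m \<ge> Suc M" "n \<ge> Suc M" for m n
      using close[of m n] bd[OF that(1)] bd[OF that(2)] that by (simp add: dist_real_def)
    thus "\<exists>M. \<forall>m\<ge>M. \<forall>n\<ge>M. dist (b m / real m) (b n / real n) < e" by blast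
  qed
  thus ?thesis by (simp add: Cauchy_convergent_iff)
qed

section \<open>From plane vectors to matrices\<close>

definition column_matrix :: "real \<times> real \<Rightarrow> real \<times> real \<Rightarrow> real^2^2" where
  "column_matrix p q = (\<chi> i j. if i = 1 then (if j = 1 then fst p else fst q)
                                else (if j = 1 then snd p else snd q))"

lemma transfer_column_matrix:
  "transfer E a ** column_matrix p q = column_matrix (shift_map (E - a) p) (shift_map (E - a) q)"
  by (simp add: vec_eq_iff forall_2 matrix_matrix_mult_def sum_2 transfer_def column_matrix_def shift_map_def)

lemma norm_real2: "norm (v :: real^2) = sqrt ((v $ 1)\<^sup>2 + (v $ 2)\<^sup>2)"
  by (simp add: norm_vec_def L2_set_def sum_2)

lemma column_matrix_mult_1: "norm (column_matrix p q *v axis 1 1) = norm p"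
  by (simp add: norm_real2 matrix_vector_mult_def sum_2 column_matrix_def axis_def norm_fst_snd)

lemma norm_column_matrix_mult_le: "norm (column_matrix p q *v v) \<le> (norm p + norm q) * norm v"
proof -
  have "column_matrix p q *v v = (v $ 1) *\<^sub>R (column_matrix p q *v axis 1 1) + (v $ 2) *\<^sub>R (column_matrix p q *v axis 2 1)"
    by (simp add: vec_eq_iff forall_2 matrix_vector_mult_def sum_2 column_matrix_def axis_def)
  also have "norm \<dots> \<le> \<bar>v $ 1\<bar> * norm p + \<bar>v $ 2\<bar> * norm q"
  proof (rule order_trans[OF norm_triangle_ineq])
    have "norm (column_matrix p q *v axis 2 1) = norm q"
      by (simp add: norm_real2 matrix_vector_mult_def sum_2 column_matrix_def axis_def norm_fst_snd)
    thus "norm ((v $ 1) *\<^sub>R (column_matrix p q *v axis 1 1)) + norm ((v $ 2) *\<^sub>R (column_matrix p q *v axis 2 1))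
      \<le> \<bar>v $ 1\<bar> * norm p + \<bar>v $ 2\<bar> * norm q"
      by (simp add: column_matrix_mult_1)
  qed
  also have "\<dots> \<le> norm v * norm p + norm v * norm q"
    by (intro add_mono mult_right_mono component_le_norm_cart) auto
  finally show ?thesis by (simp add: algebra_simps)
qed

lemma opnorm_column_matrix_le: "opnorm (column_matrix p q) \<le> norm p + norm q"
  unfolding opnorm_def by (rule onorm_le) (rule norm_column_matrix_mult_le)

lemma opnorm_column_matrix_ge: "norm p \<le> opnorm (column_matrix p q)"
proof -
  have "norm (column_matrix p q *v axis 1 1) \<le> opnorm (column_matrix p q) * norm (axis 1 1 :: real^2)"
    unfolding opnorm_def by (rule onorm) simp
  thus ?thesis by (simp add: column_matrix_mult_1)
qed

lemma opnorm_column_matrix_diff: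
  "opnorm (column_matrix p q) \<le> opnorm (column_matrix p' q') + (norm (p - p') + norm (q - q'))"
proof -
  have "column_matrix p q *v v = column_matrix p' q' *v v + column_matrix (p - p') (q - q') *v v" for v
    by (simp add: vec_eq_iff forall_2 matrix_vector_mult_def sum_2 column_matrix_def algebra_simps)
  hence "opnorm (column_matrix p q) = onorm (\<lambda>v. column_matrix p' q' *v v + column_matrix (p - p') (q - q') *v v)"
    by (simp add: opnorm_def)
  also have "\<dots> \<le> opnorm (column_matrix p' q') + opnorm (column_matrix (p - p') (q - q'))"
    unfolding opnorm_def by (intro onorm_triangle) simp_all
  also have "opnorm (column_matrix (p - p') (q - q')) \<le> norm (p - p') + norm (q - q')"
    by (rule opnorm_column_matrix_le)
  finally show ?thesis by simp
qed

text \<open>The operator norm is Lipschitz in the columns, hence continuous.\<close>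

lemma opnorm_column_matrix_measurable [measurable (raw)]:
  assumes [measurable]: "f \<in> borel_measurable M" "g \<in> borel_measurable M"
  shows "(\<lambda>x. opnorm (column_matrix (f x) (g x))) \<in> borel_measurable M"
proof -
  have "continuous_on UNIV (\<lambda>z. opnorm (column_matrix (fst z) (snd z)))"
  proof (rule continuous_onI)
    fix x :: "(real \<times> real) \<times> (real \<times> real)" and e :: real assume e: "e > 0"
    have "dist (opnorm (column_matrix (fst y) (snd y))) (opnorm (column_matrix (fst x) (snd x))) \<le> e"
      if d: "dist y x < e / 2" for y
    proof -
      have "norm (fst y - fst x) + norm (snd y - snd x) \<le> 2 * dist y x"
        using dist_fst_le[of y x] dist_snd_le[of y x] by (simp add: dist_norm)
      moreover have "norm (fst x - fst y) + norm (snd x - snd y) = norm (fst y - fst x) + norm (snd y - snd x)"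
        by (simp add: norm_minus_commute)
      ultimately show ?thesis
        using d opnorm_column_matrix_diff[of "fst y" "snd y" "fst x" "snd x"]
          opnorm_column_matrix_diff[of "fst x" "snd x" "fst y" "snd y"]
        unfolding dist_real_def by linarith
    qed
    thus "\<exists>d>0. \<forall>y\<in>UNIV. dist y x < d \<longrightarrow>
        dist (opnorm (column_matrix (fst y) (snd y))) (opnorm (column_matrix (fst x) (snd x))) \<le> e"
      using e by (intro exI[of _ "e / 2"]) auto
  qed
  hence "(\<lambda>z. opnorm (column_matrix (fst z) (snd z))) \<in> borel_measurable borel"
    by (rule borel_measurable_continuous_onI)
  from measurable_compose[OF borel_measurable_Pair[OF assms] this] show ?thesis by simp
qed

lemma column_matrix_entries: "column_matrix (A $ 1 $ 1, A $ 2 $ 1) (A $ 1 $ 2, A $ 2 $ 2) = A"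
  by (simp add: vec_eq_iff forall_2 column_matrix_def)

text \<open>Required on the two-sided product space itself, where \<open>transfer_n\<close> is
  identified with the clipped orbits only almost everywhere.\<close>

lemma opnorm_transfer_n_measurable:
  assumes sets: "sets m = sets borel"
  shows "(\<lambda>\<omega>. opnorm (transfer_n E \<omega> n)) \<in> borel_measurable (\<Pi>\<^sub>M i\<in>(UNIV :: int set). m)"
proof -
  let ?Z = "\<Pi>\<^sub>M i\<in>(UNIV :: int set). m"
  have [measurable]: "(\<lambda>\<omega>. \<omega> i) \<in> borel_measurable ?Z" for i
    using measurable_component_singleton[of i UNIV "\<lambda>_. m"] measurable_cong_sets[OF refl sets, of ?Z] by simp
  have [measurable]: "(\<lambda>\<omega>. transfer E (\<omega> k) $ i $ j) \<in> borel_measurable ?Z" for k i j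
    unfolding transfer_def by (cases "i = 1"; cases "j = 1") simp_all
  have [measurable]: "(\<lambda>\<omega>. transfer_n E \<omega> n $ i $ j) \<in> borel_measurable ?Z" for i j
  proof (induction n arbitrary: i j)
    case 0
    show ?case by simp
  next
    case (Suc n)
    note [measurable] = Suc.IH
    show ?case by (simp add: matrix_matrix_mult_def)
  qed
  have "(\<lambda>\<omega>. opnorm (column_matrix (transfer_n E \<omega> n $ 1 $ 1, transfer_n E \<omega> n $ 2 $ 1)
      (transfer_n E \<omega> n $ 1 $ 2, transfer_n E \<omega> n $ 2 $ 2))) \<in> borel_measurable ?Z"
    by (intro opnorm_column_matrix_measurable borel_measurable_Pair) measurable
  thus ?thesis by (simp only: column_matrix_entries)
qed

section \<open>Convergence and regularity of the exponent\<close>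

context random_potential
begin

definition log_opnorm :: "real \<Rightarrow> nat \<Rightarrow> (nat \<Rightarrow> real) \<Rightarrow> real" where
  "log_opnorm E n \<omega> = ln (opnorm (column_matrix (orb E \<omega> n (1, 0)) (orb E \<omega> n (0, 1))))"

lemma log_opnorm_measurable [measurable]: "log_opnorm E n \<in> borel_measurable S"
  unfolding log_opnorm_def[abs_def] by measurable

lemma transfer_n_eq_column_matrix:
  assumes "\<And>k. clip R (\<omega> (int k)) = \<omega> (int k)"
  shows "transfer_n E \<omega> n = column_matrix (orb E (\<lambda>k. \<omega> (int k)) n (1, 0)) (orb E (\<lambda>k. \<omega> (int k)) n (0, 1))"
proof (induction n)
  case 0
  show ?case by (simp add: vec_eq_iff forall_2 mat_def column_matrix_def)
next
  case (Suc n)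
  thus ?case by (simp add: transfer_column_matrix assms)
qed

text \<open>The operator norm lies between the first column and the sum of both. The mean difference
  of the logarithms of the columns is bounded in \<open>n\<close> by \<open>lnn_Hoelder\<close>, so
  the matrix norm and a single vector have the same growth rate.\<close>

lemma log_opnorm_bounds:
  "ln (norm (orb E \<omega> n (1, 0))) \<le> log_opnorm E n \<omega>"
  "log_opnorm E n \<omega> \<le> ln (norm (orb E \<omega> n (1, 0)))
     + \<bar>ln (norm (orb E \<omega> n (1, 0))) - ln (norm (orb E \<omega> n (0, 1)))\<bar> + ln 2"
proof -
  let ?x = "norm (orb E \<omega> n (1, 0))" and ?y = "norm (orb E \<omega> n (0, 1))"
  let ?o = "opnorm (column_matrix (orb E \<omega> n (1, 0)) (orb E \<omega> n (0, 1)))"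
  have "(1, 0) \<noteq> (0 :: real \<times> real)" "(0, 1) \<noteq> (0 :: real \<times> real)" by (simp_all add: zero_prod_def)
  hence x: "?x > 0" and y: "?y > 0" by simp_all
  have "?x \<le> ?o" by (rule opnorm_column_matrix_ge)
  thus "ln ?x \<le> log_opnorm E n \<omega>" unfolding log_opnorm_def using x by (intro ln_mono)
  let ?d = "\<bar>ln ?x - ln ?y\<bar>"
  have "?y = exp (ln ?y)" using y by simp
  also have "\<dots> \<le> exp (ln ?x + ?d)" by simp
  also have "\<dots> = ?x * exp ?d" using x by (simp add: exp_add)
  finally have "?y \<le> ?x * exp ?d" .
  moreover have "?x * 1 \<le> ?x * exp ?d" by (intro mult_left_mono) auto
  ultimately have "?x + ?y \<le> ?x * exp ?d + ?x * exp ?d" by linarith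
  moreover have "?o \<le> ?x + ?y" by (rule opnorm_column_matrix_le)
  ultimately have "?o \<le> ?x * (exp ?d * 2)" by (simp add: algebra_simps)
  moreover have "?o > 0" using \<open>?x \<le> ?o\<close> x by linarith
  ultimately have "ln ?o \<le> ln (?x * (exp ?d * 2))" by (intro ln_mono)
  also have "\<dots> = ln ?x + (?d + ln 2)" using x by (simp add: ln_mult)
  finally show "log_opnorm E n \<omega> \<le> ln ?x + ?d + ln 2" by (simp add: log_opnorm_def)
qed

text \<open>After \<open>k\<close> steps the remaining growth starts from a random direction instead
  of \<open>p\<close>; by \<open>C\<close> this changes its mean by a bounded amount only.\<close>

lemma lnn_quasi_additive:
  assumes E: "\<bar>E\<bar> \<le> R + 2"
    and C: "\<And>n p q. norm p = 1 \<Longrightarrow> norm q = 1 \<Longrightarrow>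
      (\<integral>\<omega>. \<bar>ln (norm (orb E \<omega> n p)) - ln (norm (orb E \<omega> n q))\<bar> \<partial>S) \<le> C"
    and p: "norm p = 1"
  shows "\<bar>lnn E (k + n) p - lnn E k p - lnn E n p\<bar> \<le> C"
proof -
  have nz: "p \<noteq> 0" using p by auto
  have cmp: "\<bar>lnn E n q - ln (norm q) - lnn E n p\<bar> \<le> C" if q: "q \<noteq> 0" for q
  proof -
    define q1 where "q1 = (1 / norm q) *\<^sub>R q"
    have q1: "norm q1 = 1" "q1 \<noteq> 0" using q by (simp_all add: q1_def)
    have "norm q *\<^sub>R q1 = q" using q by (simp add: q1_def)
    hence "lnn E n q = ln (norm q) + lnn E n q1"
      using lnn_scaleR[OF E q1(2), of "norm q" n] q by simp
    moreover have "lnn E n q1 - lnn E n p = (\<integral>\<omega>. ln (norm (orb E \<omega> n q1)) - ln (norm (orb E \<omega> n p)) \<partial>S)"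
      unfolding lnn_def using integrable_ln_norm_orb[OF E q1(2)] integrable_ln_norm_orb[OF E nz] by simp
    moreover have "\<bar>\<integral>\<omega>. ln (norm (orb E \<omega> n q1)) - ln (norm (orb E \<omega> n p)) \<partial>S\<bar> \<le> C"
      using integral_abs_bound C[OF q1(1) p] by (rule order_trans)
    ultimately show ?thesis by simp
  qed
  have eq: "lnn E (k + n) p = (\<integral>\<omega>. lnn E n (orb E \<omega> k p) \<partial>S)"
  proof -
    have "lnn E (k + n) p = (\<integral>\<omega>. (\<integral>\<omega>'. ln (norm (orb E (comb_seq k \<omega> \<omega>') (k + n) p)) \<partial>S) \<partial>S)"
      unfolding lnn_def by (rule integral_S_comb_seq[OF _ abs_ln_norm_orb_le'[OF E nz]]) measurable
    thus ?thesis by (simp add: orb_comb_seq lnn_def)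
  qed
  have int: "integrable S (\<lambda>\<omega>. lnn E n (orb E \<omega> k p))"
  proof (rule S.integrable_const_bound)
    have "\<bar>lnn E n (orb E \<omega> k p)\<bar> \<le> real k * ln step_bound + real n * ln step_bound" for \<omega>
      using lnn_bounds[OF E, of "orb E \<omega> k p" n] abs_ln_norm_orb_le'[OF E nz, of \<omega> k] nz p by simp
    thus "AE \<omega> in S. norm (lnn E n (orb E \<omega> k p)) \<le> real k * ln step_bound + real n * ln step_bound" by simp
  qed measurable
  note int2 = integrable_ln_norm_orb[OF E nz, of k]
  have diff: "lnn E (k + n) p - lnn E k p - lnn E n p =
      (\<integral>\<omega>. lnn E n (orb E \<omega> k p) - ln (norm (orb E \<omega> k p)) - lnn E n p \<partial>S)"
  proof -
    have "(\<integral>\<omega>. lnn E n (orb E \<omega> k p) - ln (norm (orb E \<omega> k p)) - lnn E n p \<partial>S) =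
        (\<integral>\<omega>. lnn E n (orb E \<omega> k p) \<partial>S) - (\<integral>\<omega>. ln (norm (orb E \<omega> k p)) \<partial>S) - lnn E n p"
      using int int2 by (simp add: S.prob_space)
    thus ?thesis by (simp only: eq lnn_def[of E k p])
  qed
  have "\<bar>\<integral>\<omega>. lnn E n (orb E \<omega> k p) - ln (norm (orb E \<omega> k p)) - lnn E n p \<partial>S\<bar>
      \<le> (\<integral>\<omega>. \<bar>lnn E n (orb E \<omega> k p) - ln (norm (orb E \<omega> k p)) - lnn E n p\<bar> \<partial>S)"
    by (rule integral_abs_bound)
  also have "\<dots> \<le> C"
  proof (rule integral_S_le)
    show "integrable S (\<lambda>\<omega>. \<bar>lnn E n (orb E \<omega> k p) - ln (norm (orb E \<omega> k p)) - lnn E n p\<bar>)"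
      by (intro integrable_abs Bochner_Integration.integrable_diff int int2 S.integrable_const)
    show "\<bar>lnn E n (orb E \<omega> k p) - ln (norm (orb E \<omega> k p)) - lnn E n p\<bar> \<le> C" for \<omega>
      by (rule cmp) (simp add: nz)
  qed
  finally show ?thesis unfolding diff .
qed

theorem lyapunov_Hoelder:
  "\<exists>C s. 0 \<le> C \<and> 0 < s \<and> (\<forall>E E'. \<bar>E\<bar> \<le> R + 2 \<longrightarrow> \<bar>E'\<bar> \<le> R + 2 \<longrightarrow>
    \<bar>lim (\<lambda>n. 1 / real n * (\<integral>\<omega>. log_opnorm E n \<omega> \<partial>S)) - lim (\<lambda>n. 1 / real n * (\<integral>\<omega>. log_opnorm E' n \<omega> \<partial>S))\<bar>
      \<le> C * \<bar>E - E'\<bar> powr s)"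
proof -
  obtain C s where C: "0 \<le> C" and s: "0 < s"
    and bdd': "\<forall>E n p q. \<bar>E\<bar> \<le> R + 2 \<longrightarrow> norm p = 1 \<longrightarrow> norm q = 1 \<longrightarrow>
      (\<integral>\<omega>. \<bar>ln (norm (orb E \<omega> n p)) - ln (norm (orb E \<omega> n q))\<bar> \<partial>S) \<le> C"
    and hoe': "\<forall>E E' n p. \<bar>E\<bar> \<le> R + 2 \<longrightarrow> \<bar>E'\<bar> \<le> R + 2 \<longrightarrow> norm p = 1 \<longrightarrow>
      \<bar>lnn E n p - lnn E' n p\<bar> \<le> real n * (C * \<bar>E - E'\<bar> powr s)"
    using lnn_Hoelder by (elim exE conjE)
  note bdd = bdd'[rule_format] and hoe = hoe'[rule_format]
  let ?e = "(1, 0) :: real \<times> real" and ?f = "(0, 1) :: real \<times> real"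
  have e: "norm ?e = 1" "norm ?f = 1" "?e \<noteq> 0" "?f \<noteq> 0" by (auto simp: norm_Pair zero_prod_def)
  have opn: "\<bar>(\<integral>\<omega>. log_opnorm E n \<omega> \<partial>S) - lnn E n ?e\<bar> \<le> C + ln 2" if E: "\<bar>E\<bar> \<le> R + 2" for E n
  proof -
    let ?u = "\<lambda>\<omega>. ln (norm (orb E \<omega> n ?e))"
      and ?v = "\<lambda>\<omega>. \<bar>ln (norm (orb E \<omega> n ?e)) - ln (norm (orb E \<omega> n ?f))\<bar>"
    have iu: "integrable S ?u" and iv: "integrable S ?v"
      using integrable_ln_norm_orb[OF E e(3)] integrable_ln_norm_orb[OF E e(4)] by auto
    have il: "integrable S (log_opnorm E n)"
    proof (rule Bochner_Integration.integrable_bound)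
      show "integrable S (\<lambda>\<omega>. \<bar>?u \<omega>\<bar> + ?v \<omega> + ln 2)" using iu iv by auto
      have "\<bar>log_opnorm E n \<omega>\<bar> \<le> \<bar>?u \<omega>\<bar> + ?v \<omega> + ln 2" for \<omega>
        using log_opnorm_bounds[where E = E and n = n and \<omega> = \<omega>] ln_ge_zero[of 2] by linarith
      from order_trans[OF this abs_ge_self]
      show "AE \<omega> in S. norm (log_opnorm E n \<omega>) \<le> norm (\<bar>?u \<omega>\<bar> + ?v \<omega> + ln 2)"
        unfolding real_norm_def by (rule AE_I2)
    qed measurable
    have "lnn E n ?e \<le> (\<integral>\<omega>. log_opnorm E n \<omega> \<partial>S)"
      unfolding lnn_def by (rule integral_mono[OF iu il log_opnorm_bounds(1)])
    moreover have "(\<integral>\<omega>. log_opnorm E n \<omega> \<partial>S) \<le> (\<integral>\<omega>. ?u \<omega> + ?v \<omega> + ln 2 \<partial>S)"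
      using iu iv by (intro integral_mono[OF il _ log_opnorm_bounds(2)]) auto
    moreover have "(\<integral>\<omega>. ?u \<omega> + ?v \<omega> + ln 2 \<partial>S) = lnn E n ?e + (\<integral>\<omega>. ?v \<omega> \<partial>S) + ln 2"
      unfolding lnn_def using iu iv by (simp add: S.prob_space)
    ultimately show ?thesis using bdd[OF E e(1,2), of n] by linarith
  qed
  have lnn_conv: "(\<lambda>n. lnn E n ?e / real n) \<longlonglongrightarrow> lim (\<lambda>n. lnn E n ?e / real n)"
    if E: "\<bar>E\<bar> \<le> R + 2" for E
  proof -
    have "convergent (\<lambda>n. lnn E n ?e / real n)"
      by (rule quasi_additive_convergent[OF lnn_quasi_additive[OF E bdd[OF E] e(1)]])
    thus ?thesis by (simp add: convergent_LIMSEQ_iff)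
  qed
  have conv: "(\<lambda>n. 1 / real n * (\<integral>\<omega>. log_opnorm E n \<omega> \<partial>S)) \<longlonglongrightarrow> lim (\<lambda>n. lnn E n ?e / real n)"
    if E: "\<bar>E\<bar> \<le> R + 2" for E
  proof -
    note 1 = lnn_conv[OF E]
    have "(\<lambda>n. ((\<integral>\<omega>. log_opnorm E n \<omega> \<partial>S) - lnn E n ?e) / real n) \<longlonglongrightarrow> 0"
    proof (rule Lim_null_comparison)
      show "eventually (\<lambda>n. norm (((\<integral>\<omega>. log_opnorm E n \<omega> \<partial>S) - lnn E n ?e) / real n) \<le> (C + ln 2) / real n) sequentially"
        using opn[OF E] by (intro always_eventually allI) (simp add: divide_right_mono)
      show "(\<lambda>n. (C + ln 2) / real n) \<longlonglongrightarrow> 0" by (rule lim_const_over_n)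
    qed
    from tendsto_add[OF 1 this] show ?thesis by (simp add: diff_divide_distrib)
  qed
  have "\<bar>lim (\<lambda>n. 1 / real n * (\<integral>\<omega>. log_opnorm E n \<omega> \<partial>S)) - lim (\<lambda>n. 1 / real n * (\<integral>\<omega>. log_opnorm E' n \<omega> \<partial>S))\<bar>
      \<le> C * \<bar>E - E'\<bar> powr s" if E: "\<bar>E\<bar> \<le> R + 2" "\<bar>E'\<bar> \<le> R + 2" for E E'
  proof -
    have "\<bar>lim (\<lambda>n. lnn E n ?e / real n) - lim (\<lambda>n. lnn E' n ?e / real n)\<bar> \<le> C * \<bar>E - E'\<bar> powr s"
    proof (rule LIMSEQ_le_const2)
      show "(\<lambda>n. \<bar>lnn E n ?e / real n - lnn E' n ?e / real n\<bar>) \<longlonglongrightarrow>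
          \<bar>lim (\<lambda>n. lnn E n ?e / real n) - lim (\<lambda>n. lnn E' n ?e / real n)\<bar>"
        by (intro tendsto_rabs tendsto_diff lnn_conv E)
      show "\<exists>N. \<forall>n\<ge>N. \<bar>lnn E n ?e / real n - lnn E' n ?e / real n\<bar> \<le> C * \<bar>E - E'\<bar> powr s"
      proof (intro exI[of _ 1] allI impI)
        fix n :: nat assume n: "n \<ge> 1"
        have "\<bar>lnn E n ?e / real n - lnn E' n ?e / real n\<bar> = \<bar>lnn E n ?e - lnn E' n ?e\<bar> / real n"
          by (simp only: diff_divide_distrib[symmetric] abs_divide abs_of_nat)
        also have "\<dots> \<le> real n * (C * \<bar>E - E'\<bar> powr s) / real n"
          by (rule divide_right_mono[OF hoe[OF E e(1)]]) simp
        also have "\<dots> = C * \<bar>E - E'\<bar> powr s" using n by simp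
        finally show "\<bar>lnn E n ?e / real n - lnn E' n ?e / real n\<bar> \<le> C * \<bar>E - E'\<bar> powr s" .
      qed
    qed
    \<comment> \<open>By \<open>conv\<close> both \<open>lim\<close> terms are genuine limits, equal
      to those for \<open>lnn\<close>.\<close>
    thus ?thesis using limI[OF conv[OF E(1)]] limI[OF conv[OF E(2)]] by simp
  qed
  thus ?thesis using C s by blast
qed

text \<open>The letters at nonnegative positions of a two-sided sequence have the law
  \<open>S\<close>, and almost surely \<open>clip\<close> alters none of them.\<close>

lemma lyap_eq:
  assumes supp: "AE a in m. clip R a = a"
  shows "lyap m E = lim (\<lambda>n. 1 / real n * (\<integral>\<omega>. log_opnorm E n \<omega> \<partial>S))"
proof -
  let ?Z = "\<Pi>\<^sub>M i\<in>(UNIV :: int set). m"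
  have "(\<integral>\<omega>. ln (opnorm (transfer_n E \<omega> n)) \<partial>?Z) = (\<integral>\<omega>. log_opnorm E n \<omega> \<partial>S)" for n
  proof -
    have meas: "(\<lambda>\<omega>. \<lambda>k\<in>UNIV. \<omega> (int k)) \<in> measurable ?Z S"
      by (intro measurable_restrict measurable_component_singleton) auto
    have AE: "AE \<omega> in ?Z. \<forall>k. clip R (\<omega> (int k)) = \<omega> (int k)"
      unfolding AE_all_countable using supp prob_space_axioms
      by (intro allI AE_PiM_component[where P = "\<lambda>a. clip R a = a"]) auto
    have "(\<integral>\<omega>. log_opnorm E n \<omega> \<partial>S) = (\<integral>\<omega>. log_opnorm E n \<omega> \<partial>(distr ?Z S (\<lambda>\<omega>. \<lambda>k\<in>UNIV. \<omega> (int k))))"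
      using distr_PiM_reindex[of UNIV "\<lambda>_. m" int UNIV] prob_space_axioms by simp
    also have "\<dots> = (\<integral>\<omega>. log_opnorm E n (\<lambda>k. \<omega> (int k)) \<partial>?Z)"
      using integral_distr[OF meas log_opnorm_measurable] by (simp add: restrict_def)
    also have "\<dots> = (\<integral>\<omega>. ln (opnorm (transfer_n E \<omega> n)) \<partial>?Z)"
    proof (rule integral_cong_AE)
      show "(\<lambda>\<omega>. log_opnorm E n (\<lambda>k. \<omega> (int k))) \<in> borel_measurable ?Z"
        using measurable_compose[OF meas log_opnorm_measurable[of E n]] by (simp add: restrict_def)
      show "(\<lambda>\<omega>. ln (opnorm (transfer_n E \<omega> n))) \<in> borel_measurable ?Z"
        using opnorm_transfer_n_measurable[OF sets_m] by measurable
      show "AE \<omega> in ?Z. log_opnorm E n (\<lambda>k. \<omega> (int k)) = ln (opnorm (transfer_n E \<omega> n))"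
        using AE by eventually_elim (simp add: transfer_n_eq_column_matrix log_opnorm_def)
    qed
    finally show ?thesis by simp
  qed
  thus ?thesis by (simp add: lyap_def)
qed

theorem lyap_Hoelder:
  assumes "AE a in m. clip R a = a"
  shows "\<exists>C>0. \<exists>\<beta>>0. \<forall>E\<in>{-(2 + R)..2 + R}. \<forall>E'\<in>{-(2 + R)..2 + R}.
    \<bar>lyap m E - lyap m E'\<bar> \<le> C * \<bar>E - E'\<bar> powr \<beta>"
proof -
  obtain C s where C: "0 \<le> C" "0 < s"
    and H: "\<forall>E E'. \<bar>E\<bar> \<le> R + 2 \<longrightarrow> \<bar>E'\<bar> \<le> R + 2 \<longrightarrow>
      \<bar>lyap m E - lyap m E'\<bar> \<le> C * \<bar>E - E'\<bar> powr s"
    using lyapunov_Hoelder[folded lyap_eq[OF assms]] by (elim exE conjE)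
  \<comment> \<open>\<open>C\<close> may be zero, so \<open>C + 1\<close> serves as the positive
    constant.\<close>
  have "\<bar>lyap m E - lyap m E'\<bar> \<le> (C + 1) * \<bar>E - E'\<bar> powr s"
    if "E \<in> {-(2 + R)..2 + R}" "E' \<in> {-(2 + R)..2 + R}" for E E'
  proof -
    have "\<bar>lyap m E - lyap m E'\<bar> \<le> C * \<bar>E - E'\<bar> powr s"
      using that by (intro H[rule_format]) (simp_all add: abs_le_iff)
    also have "\<dots> \<le> (C + 1) * \<bar>E - E'\<bar> powr s" by (intro mult_right_mono) auto
    finally show ?thesis .
  qed
  moreover have "C + 1 > 0" using C by simp
  ultimately show ?thesis using C(2) by blast
qed

end

text \<open>Points outside the support lie in null balls with rational centre and radius, of which
  there are countably many.\<close>

lemma AE_msupp: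
  assumes "prob_space m" and sets: "sets m = sets borel"
  shows "AE a in m. a \<in> msupp m"
proof -
  interpret prob_space m by fact
  define Q :: "(real \<times> real) set"
    where "Q = {(q, r). q \<in> \<rat> \<and> r \<in> \<rat> \<and> measure m (ball q r) = 0}"
  have "countable Q"
    by (rule countable_subset[of _ "\<rat> \<times> \<rat>"]) (auto simp: Q_def countable_rat)
  moreover have "AE a in m. a \<notin> ball (fst x) (snd x)" if "x \<in> Q" for x
  proof (rule AE_I'[of "ball (fst x) (snd x)"])
    show "ball (fst x) (snd x) \<in> null_sets m"
      using that sets by (auto simp: Q_def null_sets_def emeasure_eq_measure)
  qed auto
  ultimately have "AE a in m. \<forall>x\<in>Q. a \<notin> ball (fst x) (snd x)"
    by (simp add: AE_ball_countable)
  thus ?thesis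
  proof eventually_elim
    fix a assume a: "\<forall>x\<in>Q. a \<notin> ball (fst x) (snd x)"
    show "a \<in> msupp m"
    proof (rule ccontr)
      assume "a \<notin> msupp m"
      then obtain e where e: "e > 0" "measure m (ball a e) = 0"
        by (auto simp: msupp_def not_less) (meson measure_le_0_iff)
      \<comment> \<open>The centre is within \<open>e / 4\<close> of \<open>a\<close> and the radius
        between \<open>e / 4\<close> and \<open>e / 2\<close>, so the rational ball contains
        \<open>a\<close> and stays inside \<open>ball a e\<close>.\<close>
      obtain q where q: "q \<in> \<rat>" "a < q" "q < a + e / 4"
        using Rats_dense_in_real[of a "a + e / 4"] e by auto
      obtain r where r: "r \<in> \<rat>" "e / 4 < r" "r < e / 2"
        using Rats_dense_in_real[of "e / 4" "e / 2"] e by auto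
      have "ball q r \<subseteq> ball a e" using q r by (auto simp: dist_real_def)
      hence "measure m (ball q r) \<le> measure m (ball a e)"
        by (rule finite_measure_mono) (simp add: sets)
      hence "measure m (ball q r) = 0" using e by (simp add: measure_le_0_iff)
      hence "(q, r) \<in> Q" using q r by (simp add: Q_def)
      moreover have "a \<in> ball q r" using q r by (auto simp: dist_real_def)
      ultimately show False using a by force
    qed
  qed
qed

theorem theorem4p1:
  fixes m :: "real measure"
  assumes "prob_space m"
    and "sets m = sets borel"
    and "compact (msupp m)"
    and "\<exists>x\<in>msupp m. \<exists>y\<in>msupp m. x \<noteq> y"
  shows "\<exists>C>0. \<exists>\<beta>>0. \<forall>E\<in>{-(2 + Sup (abs ` msupp m)) .. 2 + Sup (abs ` msupp m)}.
           \<forall>E'\<in>{-(2 + Sup (abs ` msupp m)) .. 2 + Sup (abs ` msupp m)}.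
             \<bar>lyap m E - lyap m E'\<bar> \<le> C * \<bar>E - E'\<bar> powr \<beta>"
proof -
  define R where "R = Sup (abs ` msupp m)"
  have "bounded (abs ` msupp m)"
    by (intro compact_imp_bounded compact_continuous_image assms(3) continuous_intros)
  hence bdd: "bdd_above (abs ` msupp m)" by (rule bounded_imp_bdd_above)
  have R: "\<bar>a\<bar> \<le> R" if "a \<in> msupp m" for a
    unfolding R_def using that by (intro cSup_upper bdd) auto
  obtain x y where xy: "x \<in> msupp m" "y \<in> msupp m" "x < y"
    using assms(4) by (auto simp: neq_iff)
  have "random_potential m R x y"
  proof (intro random_potential.intro random_potential_axioms.intro)
    show "prob_space m" by fact
    show "sets m = sets borel" by fact
    show "0 \<le> R" using R[OF xy(1)] by simp
    show "\<bar>x\<bar> \<le> R" "\<bar>y\<bar> \<le> R" by (intro R xy)+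
    show "x < y" by fact
    show "0 < measure m (ball x r)" "0 < measure m (ball y r)" if "r > 0" for r
      using xy(1,2) that by (simp_all add: msupp_def)
  qed
  moreover have "AE a in m. clip R a = a"
    using AE_msupp[OF assms(1,2)]
  proof eventually_elim
    case (elim a)
    from R[OF this] show ?case by (auto simp: clip_def)
  qed
  ultimately show ?thesis unfolding R_def by (rule random_potential.lyap_Hoelder)
qed

end
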